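(* Let $D$ be a smooth and bounded domain of a Carnot group $\mathbb{G}$ with $\dim_h\mathbb{G}\geq 3$, let $2^*=\frac{2\dim_h\mathbb{G}}{\dim_h\mathbb{G}-2}$, and for $\varrho>0$ let $$\overline{B_{S^1_0(D)}(0,\varrho)}=\left\{u\in S^1_0(D):\left(\int_D|\nabla_{\mathbb{G}}u(\xi)|^2\,d\xi\right)^{1/2}\leq\varrho\right\}$$ be the closed ball centered at $0$ of radius $\varrho$ in the Folland-Stein space $S^1_0(D)$. Then for every $\mu>0$ there exists $\varrho_{0,\mu}>0$ such that the functional $$\mathcal{L}_\mu(u)=\frac12\int_D|\nabla_{\mathbb{G}}u(\xi)|^2\,d\xi-\frac{\mu}{2^*}\int_D|u(\xi)|^{2^*}\,d\xi$$ is sequentially weakly lower semicontinuous on $\overline{B_{S^1_0(D)}(0,\varrho_{0,\mu})}$.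
   Context: A homogeneous group is a Lie group $\mathbb{G}=(\mathbb{R}^n,\circ)$ equipped with a family of group automorphisms (dilatations) $\{\delta_\eta\}_{\eta>0}$ of the form $\delta_\eta(\xi^{(1)},\dots,\xi^{(r)})=(\eta\xi^{(1)},\eta^2\xi^{(2)},\dots,\eta^r\xi^{(r)})$, where $\xi^{(k)}\in\mathbb{R}^{n_k}$ and $\sum_{k=1}^rn_k=n$. Its homogeneous dimension is $\dim_h\mathbb{G}=\sum_{k=1}^rkn_k$. A Carnot group is a homogeneous group whose Lie algebra $\mathfrak{g}$ of left invariant vector fields is stratified: $\mathfrak{g}=\bigoplus_{k=1}^rV_k$ with linear subspaces $V_k$, $\dim V_k=n_k$, $[V_1,V_k]=V_{k+1}$ for $1\leq k\leq r-1$, and $[V_1,V_r]=\{0\}$. Here $[V_1,V_k]$ is the subspace generated by the commutators $[X,Y]$ with $X\in V_1$, $Y\in V_k$. Fix a basis $\{X_1,\dots,X_{n_1}\}$ of $V_1$. The horizontal gradient is $\nabla_{\mathbb{G}}=(X_1,\dots,X_{n_1})$. Integrals are with respect to Lebesgue measure $d\xi$ on $\mathbb{R}^n$. The Folland-Stein space $S^1_0(D)$ is the completion of $C_0^\infty(D)$ with respect to the norm $\|u\|_{S^1_0(D)}=\left(\int_D|\nabla_{\mathbb{G}}u(\xi)|^2\,d\xi\right)^{1/2}$. It embeds continuously into $L^{2^*}(D)$ and compactly into $L^q(D)$ for $1\leq q<2^*$. A functional $F$ is sequentially weakly lower semicontinuous on a set $B\subset S^1_0(D)$ if $F(u_\infty)\leq\liminf_{j\to+\infty}F(u_j)$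 whenever $u_j,u_\infty\in B$ and $u_j\to u_\infty$ weakly in $S^1_0(D)$. A smooth bounded domain is a nonempty bounded connected open set with smooth boundary. *)

theory Defs
  imports "HOL-Analysis.Analysis" "HOL-Library.Function_Algebras"
begin

text \<open>Vector fields and functions form real vector spaces under the pointwise operations, so that
  \<^const>\<open>span\<close>, \<^const>\<open>dim\<close>, \<^const>\<open>subspace\<close> and \<^const>\<open>independent\<close> apply to them.\<close>

instantiation "fun" :: (type, real_vector) real_vector
begin

definition scaleR_fun :: "real \<Rightarrow> ('a \<Rightarrow> 'b) \<Rightarrow> 'a \<Rightarrow> 'b" where
  "scaleR_fun c f = (\<lambda>x. c *\<^sub>R f x)"

instance
  by standard (simp_all add: scaleR_fun_def fun_eq_iff scaleR_add_right scaleR_add_left)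

end

section \<open>Smooth functions and smooth domains\<close>

text \<open>\<open>Ck_on k S f\<close>, for open \<open>S\<close> in a finite-dimensional space: all derivatives of \<open>f\<close> up to
  order \<open>k\<close> exist and are continuous on \<open>S\<close>.\<close>

primrec Ck_on ::
  "nat \<Rightarrow> 'a::euclidean_space set \<Rightarrow> ('a \<Rightarrow> 'b::euclidean_space) \<Rightarrow> bool" where
  "Ck_on 0 S f \<longleftrightarrow> continuous_on S f"
| "Ck_on (Suc k) S f \<longleftrightarrow> (\<forall>x\<in>S. f differentiable (at x)) \<and>
     (\<forall>v. Ck_on k S (\<lambda>x. frechet_derivative f (at x) v))"

definition smooth_on :: "'a::euclidean_space set \<Rightarrow> ('a \<Rightarrow> 'b::euclidean_space) \<Rightarrow> bool" where
  "smooth_on S f \<longleftrightarrow> (\<forall>k. Ck_on k S f)"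

text \<open>Smoothness of the boundary is expressed by local defining functions: near each boundary
  point, \<open>D\<close> is the negativity set of a smooth function without critical points.\<close>

definition smooth_boundary :: "'a::euclidean_space set \<Rightarrow> bool" where
  "smooth_boundary D \<longleftrightarrow> (\<forall>p\<in>frontier D. \<exists>U (\<rho>::'a \<Rightarrow> real). open U \<and> p \<in> U \<and> smooth_on U \<rho> \<and>
     (\<forall>x\<in>U. frechet_derivative \<rho> (at x) \<noteq> (\<lambda>v. 0)) \<and> D \<inter> U = {x \<in> U. \<rho> x < 0})"

definition smooth_bounded_domain :: "'a::euclidean_space set \<Rightarrow> bool" where
  "smooth_bounded_domain D \<longleftrightarrow>
     D \<noteq> {} \<and> open D \<and> connected D \<and> bounded D \<and> smooth_boundary D"

definition test_functions :: "'a::euclidean_space set \<Rightarrow> ('a \<Rightarrow> real) set" where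
  "test_functions D = {\<phi>. smooth_on UNIV \<phi> \<and>
     compact (closure {x. \<phi> x \<noteq> 0}) \<and> closure {x. \<phi> x \<noteq> 0} \<subseteq> D}"

section \<open>Carnot groups\<close>

text \<open>The block decomposition \<open>\<xi> = (\<xi>\<^sup>(\<^sup>1\<^sup>), \<dots>, \<xi>\<^sup>(\<^sup>r\<^sup>))\<close> is encoded by a degree function \<open>\<sigma>\<close>: the
  coordinate \<open>i\<close> belongs to the block \<open>\<xi>\<^sup>(\<^sup>k\<^sup>)\<close> with \<open>k = \<sigma> i\<close>.\<close>

definition dilation :: "('n::finite \<Rightarrow> nat) \<Rightarrow> real \<Rightarrow> real^'n \<Rightarrow> real^'n" where
  "dilation \<sigma> \<eta> \<xi> = (\<chi> i. \<eta> ^ \<sigma> i * \<xi> $ i)"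

definition block_dim :: "('n::finite \<Rightarrow> nat) \<Rightarrow> nat \<Rightarrow> nat" where
  "block_dim \<sigma> k = card {i. \<sigma> i = k}"

definition hom_dim :: "('n::finite \<Rightarrow> nat) \<Rightarrow> nat \<Rightarrow> nat" where
  "hom_dim \<sigma> r = (\<Sum>k=1..r. k * block_dim \<sigma> k)"

locale homogeneous_group = group mul e iv
  for mul :: "real^'n \<Rightarrow> real^'n \<Rightarrow> real^'n" and e :: "real^'n" and iv :: "real^'n \<Rightarrow> real^'n" +
  fixes \<sigma> :: "'n::finite \<Rightarrow> nat" and r :: nat
  assumes smooth_mul: "smooth_on UNIV (\<lambda>(x, y). mul x y)"
    and smooth_iv: "smooth_on UNIV iv"
    and degrees: "\<sigma> i \<in> {1..r}"
    and dilation_bij: "\<eta> > 0 \<Longrightarrow> bij (dilation \<sigma> \<eta>)"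
    and dilation_hom: "\<eta> > 0 \<Longrightarrow> dilation \<sigma> \<eta> (mul x y) = mul (dilation \<sigma> \<eta> x) (dilation \<sigma> \<eta> y)"

text \<open>A vector field \<open>X = \<Sum>\<^sub>j a\<^sub>j \<partial>\<^sub>j\<close> is identified with its coefficient map \<open>(a\<^sub>j)\<^sub>j\<close>; it acts on
  functions by \<open>(X f)(\<xi>) = Df(\<xi>)(X \<xi>)\<close>.\<close>

definition left_invariant_fields ::
  "(real^'n \<Rightarrow> real^'n \<Rightarrow> real^'n) \<Rightarrow> (real^'n \<Rightarrow> real^'n) set" where
  "left_invariant_fields mul = {X. smooth_on UNIV X \<and>
     (\<forall>a \<xi>. X (mul a \<xi>) = frechet_derivative (mul a) (at \<xi>) (X \<xi>))}"

text \<open>The commutator \<open>[X, Y] = X Y - Y X\<close> of derivations, in coordinates.\<close>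

definition commutator ::
  "(real^'n \<Rightarrow> real^'n) \<Rightarrow> (real^'n \<Rightarrow> real^'n) \<Rightarrow> real^'n \<Rightarrow> real^'n" where
  "commutator X Y = (\<lambda>\<xi>. frechet_derivative Y (at \<xi>) (X \<xi>) - frechet_derivative X (at \<xi>) (Y \<xi>))"

definition commutator_space ::
  "(real^'n \<Rightarrow> real^'n) set \<Rightarrow> (real^'n \<Rightarrow> real^'n) set \<Rightarrow> (real^'n \<Rightarrow> real^'n) set" where
  "commutator_space A B = span {commutator X Y | X Y. X \<in> A \<and> Y \<in> B}"

locale carnot_group = homogeneous_group mul e iv \<sigma> r
  for mul :: "real^'n \<Rightarrow> real^'n \<Rightarrow> real^'n" and e :: "real^'n" and iv :: "real^'n \<Rightarrow> real^'n"
    and \<sigma> :: "'n::finite \<Rightarrow> nat" and r :: nat +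
  fixes V :: "nat \<Rightarrow> (real^'n \<Rightarrow> real^'n) set"
  assumes layer_subspace: "k \<in> {1..r} \<Longrightarrow> subspace (V k)"
    and layer_subset: "k \<in> {1..r} \<Longrightarrow> V k \<subseteq> left_invariant_fields mul"
    and direct_sum: "X \<in> left_invariant_fields mul \<Longrightarrow>
          \<exists>!Y. Y \<in> (\<Pi>\<^sub>E k\<in>{1..r}. V k) \<and> X = (\<Sum>k=1..r. Y k)"
    and layer_dim: "k \<in> {1..r} \<Longrightarrow> dim (V k) = block_dim \<sigma> k"
    and layer_commutator: "1 \<le> k \<Longrightarrow> k \<le> r - 1 \<Longrightarrow> commutator_space (V 1) (V k) = V (k + 1)"
    and layer_last: "commutator_space (V 1) (V r) = {0}"

text \<open>Bases of the first layer are indexed by a finite type \<open>'m\<close>, which necessarily has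
  cardinality \<open>n\<^sub>1\<close>, so that horizontal gradients take values in \<open>real^'m\<close>.\<close>

definition basis_of ::
  "('m::finite \<Rightarrow> real^'n \<Rightarrow> real^'n) \<Rightarrow> (real^'n \<Rightarrow> real^'n) set \<Rightarrow> bool" where
  "basis_of X W \<longleftrightarrow> inj X \<and> independent (range X) \<and> span (range X) = W"

section \<open>The Folland-Stein space\<close>

definition grad_classical ::
  "('m::finite \<Rightarrow> real^'n \<Rightarrow> real^'n) \<Rightarrow> (real^'n \<Rightarrow> real) \<Rightarrow> real^'n \<Rightarrow> real^'m" where
  "grad_classical X \<phi> \<xi> = (\<chi> i. frechet_derivative \<phi> (at \<xi>) (X i \<xi>))"

definition norm_classical ::
  "('m::finite \<Rightarrow> real^'n \<Rightarrow> real^'n) \<Rightarrow> (real^'n) set \<Rightarrow> (real^'n \<Rightarrow> real) \<Rightarrow> real" where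
  "norm_classical X D \<phi> = sqrt (\<integral>\<xi>. (norm (grad_classical X \<phi> \<xi>))\<^sup>2 \<partial>lebesgue_on D)"

definition Lp_converges :: "real \<Rightarrow> 'a::euclidean_space set \<Rightarrow>
    (nat \<Rightarrow> 'a \<Rightarrow> 'b::euclidean_space) \<Rightarrow> ('a \<Rightarrow> 'b) \<Rightarrow> bool" where
  "Lp_converges p D f g \<longleftrightarrow> g \<in> borel_measurable (lebesgue_on D) \<and>
     (\<lambda>j. \<integral>\<^sup>+\<xi>. ennreal (norm (f j \<xi> - g \<xi>) powr p) \<partial>lebesgue_on D) \<longlonglongrightarrow> 0"

text \<open>The completion of the test functions is realised inside \<open>L\<^sup>p(D)\<close>, \<open>p\<close> being the critical
  exponent: an element is the \<open>L\<^sup>p\<close>-limit of a sequence of test functions that is Cauchy in the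
  gradient norm.  By the Folland-Stein inequality every such Cauchy sequence has an \<open>L\<^sup>p\<close>-limit.
  Elements are functions rather than classes; only their values almost everywhere on \<open>D\<close> matter.\<close>

definition folland_stein ::
  "('m::finite \<Rightarrow> real^'n \<Rightarrow> real^'n) \<Rightarrow> real \<Rightarrow> (real^'n) set \<Rightarrow> (real^'n \<Rightarrow> real) set" where
  "folland_stein X p D = {u. \<exists>\<phi>. (\<forall>j. \<phi> j \<in> test_functions D) \<and>
     (\<forall>\<epsilon>>0. \<exists>N. \<forall>j\<ge>N. \<forall>k\<ge>N. norm_classical X D (\<phi> j - \<phi> k) < \<epsilon>) \<and>
     Lp_converges p D \<phi> u}"

text \<open>The horizontal gradient of an element of the completion is the \<open>L\<^sup>2\<close>-limit of the gradients
  of approximating test functions; it is determined almost everywhere on \<open>D\<close>.\<close>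

definition hgrad :: "('m::finite \<Rightarrow> real^'n \<Rightarrow> real^'n) \<Rightarrow> real \<Rightarrow> (real^'n) set \<Rightarrow>
    (real^'n \<Rightarrow> real) \<Rightarrow> real^'n \<Rightarrow> real^'m" where
  "hgrad X p D u = (SOME G. \<exists>\<phi>. (\<forall>j. \<phi> j \<in> test_functions D) \<and> Lp_converges p D \<phi> u \<and>
     Lp_converges 2 D (\<lambda>j. grad_classical X (\<phi> j)) G)"

definition fs_norm :: "('m::finite \<Rightarrow> real^'n \<Rightarrow> real^'n) \<Rightarrow> real \<Rightarrow> (real^'n) set \<Rightarrow>
    (real^'n \<Rightarrow> real) \<Rightarrow> real" where
  "fs_norm X p D u = sqrt (\<integral>\<xi>. (norm (hgrad X p D u \<xi>))\<^sup>2 \<partial>lebesgue_on D)"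

definition fs_closed_ball :: "('m::finite \<Rightarrow> real^'n \<Rightarrow> real^'n) \<Rightarrow> real \<Rightarrow> (real^'n) set \<Rightarrow>
    real \<Rightarrow> (real^'n \<Rightarrow> real) set" where
  "fs_closed_ball X p D \<rho> = {u \<in> folland_stein X p D. fs_norm X p D u \<le> \<rho>}"

definition fs_dual :: "('m::finite \<Rightarrow> real^'n \<Rightarrow> real^'n) \<Rightarrow> real \<Rightarrow> (real^'n) set \<Rightarrow>
    ((real^'n \<Rightarrow> real) \<Rightarrow> real) set" where
  "fs_dual X p D = {\<Lambda>.
     (\<forall>u\<in>folland_stein X p D. \<forall>v\<in>folland_stein X p D. \<Lambda> (u + v) = \<Lambda> u + \<Lambda> v) \<and>
     (\<forall>c. \<forall>u\<in>folland_stein X p D. \<Lambda> (c *\<^sub>R u) = c * \<Lambda> u) \<and>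
     (\<exists>C. \<forall>u\<in>folland_stein X p D. \<bar>\<Lambda> u\<bar> \<le> C * fs_norm X p D u)}"

definition fs_weakly_converges :: "('m::finite \<Rightarrow> real^'n \<Rightarrow> real^'n) \<Rightarrow> real \<Rightarrow> (real^'n) set \<Rightarrow>
    (nat \<Rightarrow> real^'n \<Rightarrow> real) \<Rightarrow> (real^'n \<Rightarrow> real) \<Rightarrow> bool" where
  "fs_weakly_converges X p D us u \<longleftrightarrow> (\<forall>\<Lambda>\<in>fs_dual X p D. (\<lambda>j. \<Lambda> (us j)) \<longlonglongrightarrow> \<Lambda> u)"

definition fs_seq_weakly_lsc_on :: "('m::finite \<Rightarrow> real^'n \<Rightarrow> real^'n) \<Rightarrow> real \<Rightarrow> (real^'n) set \<Rightarrow>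
    (real^'n \<Rightarrow> real) set \<Rightarrow> ((real^'n \<Rightarrow> real) \<Rightarrow> real) \<Rightarrow> bool" where
  "fs_seq_weakly_lsc_on X p D B F \<longleftrightarrow>
     (\<forall>us u. (\<forall>j. us j \<in> B) \<and> u \<in> B \<and> fs_weakly_converges X p D us u \<longrightarrow>
        ereal (F u) \<le> liminf (\<lambda>j. ereal (F (us j))))"

definition critical_exponent :: "nat \<Rightarrow> real" where
  "critical_exponent Q = 2 * real Q / (real Q - 2)"

definition critical_functional :: "('m::finite \<Rightarrow> real^'n \<Rightarrow> real^'n) \<Rightarrow> real \<Rightarrow> (real^'n) set \<Rightarrow>
    real \<Rightarrow> (real^'n \<Rightarrow> real) \<Rightarrow> real" where
  "critical_functional X p D \<mu> u =
     1 / 2 * (\<integral>\<xi>. (norm (hgrad X p D u \<xi>))\<^sup>2 \<partial>lebesgue_on D)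
     - \<mu> / p * (\<integral>\<xi>. \<bar>u \<xi>\<bar> powr p \<partial>lebesgue_on D)"

end

theory Submission
  imports Defs
begin

text \<open>On a small ball the functional is convex: the remainder of the Dirichlet energy at \<open>u\<close> is
  \<open>\<parallel>v - u\<parallel>\<^sup>2 / 2\<close>, while by Hoelder and the Folland-Stein inequality the Taylor remainder of the
  critical term is at most a constant times \<open>\<mu> \<rho>\<^sup>p\<^sup>-\<^sup>2 \<parallel>v - u\<parallel>\<^sup>2\<close>. So the functional lies above its
  tangents, which are weakly continuous, and no compactness is needed.

  The Folland-Stein inequality follows from an \<open>L\<^sup>2\<close> bound for right translations.
  Translating along a flow line of a horizontal field for time \<open>t\<close> costs \<open>t\<close> times the norm of
  the horizontal gradient, and a \<open>k\<close>-fold group commutator of such flow lines reaches any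
  displacement of size \<open>t\<^sup>k\<close> in the layer of weight \<open>k\<close>, up to higher layers. Multiplying one such
  element for each coordinate gives a triangular, hence measure preserving, parametrisation of a
  set of volume \<open>t\<^sup>Q\<close> of admissible translations. This yields a weak-type estimate, which
  becomes the strong inequality after truncation at dyadic levels.\<close>

section \<open>Triangular maps preserve Lebesgue measure\<close>

text \<open>Of the group law only smoothness and compatibility with the dilations are known, neither
  polynomial coordinates nor a Baker-Campbell-Hausdorff formula. What replaces them is a rigidity of
  smooth homogeneous functions: derivatives in directions of weight at least the degree are
  constant. Hence coordinate \<open>j\<close> of a product is a sum plus a correction in coordinates
  of smaller weight, and the correction of weight \<open>k + 1\<close> is bilinear as soon as one
  factor lies in step \<open>k\<close> of the weight filtration. The first fact makes translations
  measure preserving and flow lines global; the second lets group commutators and Lie brackets share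
  their leading parts.

  The strong inequality follows from its weak form because the level estimate carries the
  \<open>p\<close>-integral itself with exponent \<open>2 / Q\<close>, and
  \<open>2 / p + 2 / Q = 1\<close> allows dividing by it.

  A second obstacle: \<open>hgrad\<close> picks a representative by Hilbert choice. The tangent
  functional is linear only because the gradient is unique almost everywhere, that is, because the
  horizontal gradient is closable; this rests on left invariant fields being divergence
  free.\<close>

lemma nn_integral_lborel_shear:
  fixes f :: "'a::euclidean_space \<Rightarrow> ennreal" and F :: "'a \<Rightarrow> real"
  assumes b: "b \<in> Basis"
    and [measurable]: "f \<in> borel_measurable borel" "F \<in> borel_measurable borel"
    and F: "\<And>x c. F (x + c *\<^sub>R b) = F x"
  shows "(\<integral>\<^sup>+x. f (x + F x *\<^sub>R b) \<partial>lborel) = (\<integral>\<^sup>+x. f x \<partial>lborel)"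
proof -
  interpret product_sigma_finite "\<lambda>_::'a. lborel :: real measure" ..
  let ?I = "Basis - {b} :: 'a set"
  let ?P = "\<lambda>g::'a \<Rightarrow> real. \<Sum>d\<in>Basis. g d *\<^sub>R d"
  have B: "Basis = insert b ?I"
    using b by auto
  have upd: "?P (g(b := y)) = (\<Sum>d\<in>?I. g d *\<^sub>R d) + y *\<^sub>R b" for g y
    by (subst B, subst sum.insert) (auto intro!: sum.cong)
  \<comment> \<open>Tonelli with coordinate \<open>b\<close> innermost: on each line parallel to
    \<open>b\<close> the shear is a translation, because \<open>F\<close> does not vary along
    \<open>b\<close>.\<close>
  have split: "(\<integral>\<^sup>+x. h x \<partial>lborel)
      = (\<integral>\<^sup>+g. (\<integral>\<^sup>+y. h ((\<Sum>d\<in>?I. g d *\<^sub>R d) + y *\<^sub>R b) \<partial>lborel) \<partial>Pi\<^sub>M ?I (\<lambda>_. lborel))"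
    if [measurable]: "h \<in> borel_measurable borel" for h :: "'a \<Rightarrow> ennreal"
  proof -
    have "(\<integral>\<^sup>+x. h x \<partial>lborel) = (\<integral>\<^sup>+g. h (?P g) \<partial>Pi\<^sub>M Basis (\<lambda>_. lborel))"
      by (subst lborel_eq) (simp add: nn_integral_distr)
    also have "\<dots> = (\<integral>\<^sup>+g. h (?P g) \<partial>Pi\<^sub>M (insert b ?I) (\<lambda>_. lborel))"
      using B by simp
    also have "\<dots> = (\<integral>\<^sup>+g. (\<integral>\<^sup>+y. h (?P (g(b := y))) \<partial>lborel) \<partial>Pi\<^sub>M ?I (\<lambda>_. lborel))"
    proof (rule product_nn_integral_insert)
      show "(\<lambda>g. h (?P g)) \<in> borel_measurable (Pi\<^sub>M (insert b ?I) (\<lambda>_. lborel))"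
        using B by simp
    qed auto
    finally show ?thesis
      by (simp only: upd)
  qed
  have "(\<integral>\<^sup>+x. f (x + F x *\<^sub>R b) \<partial>lborel)
      = (\<integral>\<^sup>+g. (\<integral>\<^sup>+y. f ((\<Sum>d\<in>?I. g d *\<^sub>R d) + (y + F (\<Sum>d\<in>?I. g d *\<^sub>R d)) *\<^sub>R b) \<partial>lborel) \<partial>Pi\<^sub>M ?I (\<lambda>_. lborel))"
    by (subst split) (auto simp: F scaleR_add_left add.assoc)
  also have "\<dots> = (\<integral>\<^sup>+g. (\<integral>\<^sup>+y. f ((\<Sum>d\<in>?I. g d *\<^sub>R d) + y *\<^sub>R b) \<partial>lborel) \<partial>Pi\<^sub>M ?I (\<lambda>_. lborel))"
  proof (rule nn_integral_cong)
    fix g :: "'a \<Rightarrow> real"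
    define c where "c = F (\<Sum>d\<in>?I. g d *\<^sub>R d)"
    show "(\<integral>\<^sup>+y. f ((\<Sum>d\<in>?I. g d *\<^sub>R d) + (y + c) *\<^sub>R b) \<partial>lborel)
        = (\<integral>\<^sup>+y. f ((\<Sum>d\<in>?I. g d *\<^sub>R d) + y *\<^sub>R b) \<partial>lborel)"
      using nn_integral_real_affine[of "\<lambda>y. f ((\<Sum>d\<in>?I. g d *\<^sub>R d) + y *\<^sub>R b)" 1 c]
      by (simp add: add.commute)
  qed
  also have "\<dots> = (\<integral>\<^sup>+x. f x \<partial>lborel)"
    by (subst split[of f]) auto
  finally show ?thesis .
qed

lemma borel_measurable_vec_nth' [measurable]:
  assumes "f \<in> borel_measurable M"
  shows "(\<lambda>x. (f x :: real^'n) $ j) \<in> borel_measurable M"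
  by (rule measurable_compose[OF assms borel_measurable_continuous_onI]) (intro continuous_intros)

definition tri_dep :: "('n \<Rightarrow> nat) \<Rightarrow> (real^'n \<Rightarrow> 'b) \<Rightarrow> nat \<Rightarrow> bool" where
  "tri_dep \<sigma> F d \<longleftrightarrow> (\<forall>u u'. (\<forall>i. \<sigma> i < d \<longrightarrow> u $ i = u' $ i) \<longrightarrow> F u = F u')"

text \<open>The map is a composition of shears, one for each coordinate, performed from high weights
  to low ones; \<open>TS S\<close> has performed those in \<open>S\<close>.\<close>

lemma nn_integral_lborel_triangular:
  fixes T :: "real^'n \<Rightarrow> real^'n" and f :: "real^'n \<Rightarrow> ennreal" and \<sigma> :: "'n::finite \<Rightarrow> nat"
  assumes T[measurable]: "T \<in> borel_measurable borel" and f: "f \<in> borel_measurable borel"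
    and tri: "\<And>j. tri_dep \<sigma> (\<lambda>u. T u $ j - u $ j) (\<sigma> j)"
  shows "(\<integral>\<^sup>+x. f (T x) \<partial>lborel) = (\<integral>\<^sup>+x. f x \<partial>lborel)"
proof -
  define TS where "TS = (\<lambda>S u. \<chi> j. if j \<in> S then T u $ j else u $ j)"
  have meas: "TS S \<in> borel_measurable borel" for S
  proof -
    have "(\<lambda>u. TS S u $ j) \<in> borel_measurable borel" for j
    proof (cases "j \<in> S")
      case True
      then have "(\<lambda>u. TS S u $ j) = (\<lambda>u. T u $ j)"
        by (auto simp: TS_def)
      then show ?thesis
        by simp
    next
      case False
      then have "(\<lambda>u. TS S u $ j) = (\<lambda>u. u $ j)"
        by (auto simp: TS_def)
      then show ?thesis
        by simp
    qed
    then show ?thesis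
      by (auto simp: borel_measurable_euclidean_space[where 'c="real^'n"] Basis_vec_def inner_axis)
  qed
  have "\<lbrakk>\<And>i j. j \<in> S \<Longrightarrow> \<sigma> j < \<sigma> i \<Longrightarrow> i \<in> S; f \<in> borel_measurable borel\<rbrakk> \<Longrightarrow>
    (\<integral>\<^sup>+x. f (TS S x) \<partial>lborel) = (\<integral>\<^sup>+x. f x \<partial>lborel)" for S f
  proof (induction "card S" arbitrary: S f)
    case 0
    then show ?case
      by (simp add: TS_def)
  next
    case (Suc m)
    note [measurable] = meas Suc.prems(2)
    from Suc have "S \<noteq> {}"
      by auto
    \<comment> \<open>An index of least weight in \<open>S\<close>: its increment reads only
      coordinates outside \<open>S\<close>, which the other shears leave alone, so it may be
      evaluated after them.\<close>
    then obtain i where i: "i \<in> S" "\<And>j. j \<in> S \<Longrightarrow> \<sigma> i \<le> \<sigma> j"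
      by (metis ex_has_least_nat[of "\<lambda>j. j \<in> S" _ \<sigma>] ex_in_conv)
    define S' where "S' = S - {i}"
    define F where "F = (\<lambda>u. T u $ i - u $ i)"
    have [measurable]: "F \<in> borel_measurable borel"
      unfolding F_def by measurable
    have Fdep: "F u = F u'" if "\<And>l. \<sigma> l < \<sigma> i \<Longrightarrow> u $ l = u' $ l" for u u'
      using tri[of i] that by (auto simp: tri_dep_def F_def)
    have F1: "F (x + c *\<^sub>R axis i 1) = F x" for x c
      by (rule Fdep) (auto simp: axis_def)
    have F2: "F (TS S' u) = F u" for u
      by (rule Fdep) (use i in \<open>force simp: TS_def S'_def\<close>)
    have TS: "TS S u = TS S' u + F (TS S' u) *\<^sub>R axis i 1" for u
      unfolding F2 using i by (auto simp: vec_eq_iff TS_def S'_def F_def axis_def)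
    have "(\<integral>\<^sup>+x. f (TS S x) \<partial>lborel)
        = (\<integral>\<^sup>+x. (\<lambda>y. f (y + F y *\<^sub>R axis i 1)) (TS S' x) \<partial>lborel)"
      by (simp add: TS)
    also have "\<dots> = (\<integral>\<^sup>+y. f (y + F y *\<^sub>R axis i 1) \<partial>lborel)"
    proof (rule Suc.hyps(1))
      show "m = card S'"
        using Suc.hyps(2) i by (simp add: S'_def)
      show "b \<in> S'" if "a \<in> S'" "\<sigma> a < \<sigma> b" for a b
        using that Suc.prems(1)[of a b] i(2)[of a] by (auto simp: S'_def)
    qed measurable
    also have "\<dots> = (\<integral>\<^sup>+y. f y \<partial>lborel)"
      by (rule nn_integral_lborel_shear) (auto simp: F1 axis_in_Basis_iff)
    finally show ?case .
  qed
  from this[of UNIV f] f show ?thesis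
    by (simp add: TS_def)
qed

section \<open>Homogeneous smooth functions\<close>

lemma frechet_derivative_eqI: "(f has_derivative f') (at x) \<Longrightarrow> frechet_derivative f (at x) = f'"
  by (metis frechet_derivative_at)

lemma smooth_on_continuous: "smooth_on S f \<Longrightarrow> continuous_on S f"
  unfolding smooth_on_def by (metis Ck_on.simps(1))

lemma smooth_on_has_derivative:
  "smooth_on UNIV f \<Longrightarrow> (f has_derivative frechet_derivative f (at x)) (at x)"
  unfolding smooth_on_def by (metis Ck_on.simps(2) UNIV_I frechet_derivative_works)

lemma smooth_on_derivative:
  "smooth_on UNIV f \<Longrightarrow> smooth_on UNIV (\<lambda>x. frechet_derivative f (at x) v)"
  unfolding smooth_on_def by (metis Ck_on.simps(2))

lemma Ck_on_const: "Ck_on k UNIV (\<lambda>x::'a::euclidean_space. c::'b::euclidean_space)"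
proof (induction k arbitrary: c)
  case (Suc k)
  have "frechet_derivative (\<lambda>x::'a. c) (at x) = (\<lambda>h. 0)" for x
    by (rule frechet_derivative_eqI) simp
  with Suc show ?case
    by simp
qed simp

lemma smooth_on_linear:
  fixes L :: "'a::euclidean_space \<Rightarrow> 'b::euclidean_space"
  assumes "bounded_linear L"
  shows "smooth_on UNIV L"
proof -
  have "Ck_on k UNIV L" for k
  proof (cases k)
    case 0
    then show ?thesis
      using assms by (simp add: linear_continuous_on)
  next
    case (Suc m)
    have d: "(L has_derivative L) (at x)" for x
      using assms by (rule bounded_linear_imp_has_derivative)
    then have "frechet_derivative L (at x) = L" for x
      by (rule frechet_derivative_eqI)
    with Suc d show ?thesis
      by (auto simp: Ck_on_const differentiable_def)
  qed
  then show ?thesis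
    by (simp add: smooth_on_def)
qed

lemma Ck_on_add:
  assumes "Ck_on k UNIV f" "Ck_on k UNIV g"
  shows "Ck_on k UNIV (\<lambda>x::'a::euclidean_space. f x + g x :: 'b::euclidean_space)"
  using assms
proof (induction k arbitrary: f g)
  case (Suc k)
  have "frechet_derivative (\<lambda>x. f x + g x) (at x)
      = (\<lambda>v. frechet_derivative f (at x) v + frechet_derivative g (at x) v)" for x
    by (rule frechet_derivative_eqI, rule has_derivative_add) (use Suc.prems in \<open>simp_all add: frechet_derivative_works\<close>)
  with Suc show ?case
    by (simp add: differentiable_add)
qed (simp add: continuous_on_add)

lemma Ck_on_linear_left:
  assumes "bounded_linear L" "Ck_on k UNIV f"
  shows "Ck_on k UNIV (\<lambda>x::'a::euclidean_space. L (f x :: 'b::euclidean_space) :: 'c::euclidean_space)"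
  using assms(2)
proof (induction k arbitrary: f)
  case 0
  then show ?case
    using assms(1) by (simp add: bounded_linear.continuous_on)
next
  case (Suc k)
  have d: "((\<lambda>x. L (f x)) has_derivative (\<lambda>v. L (frechet_derivative f (at x) v))) (at x)" for x
    by (rule bounded_linear.has_derivative[OF assms(1)]) (use Suc.prems in \<open>simp add: frechet_derivative_works\<close>)
  with Suc show ?case
    by (auto simp: frechet_derivative_eqI[OF d] differentiable_def)
qed

lemma Ck_on_linear_right:
  assumes "bounded_linear L" "Ck_on k UNIV f"
  shows "Ck_on k UNIV (\<lambda>x::'a::euclidean_space. f (L x :: 'b::euclidean_space) :: 'c::euclidean_space)"
  using assms(2)
proof (induction k arbitrary: f)
  case 0
  then show ?case
    using assms(1) by (auto intro: continuous_on_compose2 simp: linear_continuous_on)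
next
  case (Suc k)
  have d: "((\<lambda>x. f (L x)) has_derivative (\<lambda>v. frechet_derivative f (at (L x)) (L v))) (at x)" for x
    by (rule has_derivative_compose[of L L]) (use Suc.prems assms(1) in \<open>auto simp: frechet_derivative_works bounded_linear_imp_has_derivative\<close>)
  with Suc show ?case
    by (auto simp: frechet_derivative_eqI[OF d] differentiable_def)
qed

lemma smooth_on_add:
  "smooth_on UNIV f \<Longrightarrow> smooth_on UNIV g \<Longrightarrow> smooth_on UNIV (\<lambda>x. f x + g x)"
  by (simp add: smooth_on_def Ck_on_add)

lemma smooth_on_linear_left:
  "bounded_linear L \<Longrightarrow> smooth_on UNIV f \<Longrightarrow> smooth_on UNIV (\<lambda>x. L (f x))"
  by (simp add: smooth_on_def Ck_on_linear_left)

lemma smooth_on_linear_right: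
  "bounded_linear L \<Longrightarrow> smooth_on UNIV f \<Longrightarrow> smooth_on UNIV (\<lambda>x. f (L x))"
  by (simp add: smooth_on_def Ck_on_linear_right)

text \<open>Expanding the direction in the basis reduces joint continuity to continuity in the base
  point for finitely many fixed directions.\<close>

lemma derivative_tendsto:
  fixes f' :: "'a::euclidean_space \<Rightarrow> 'a \<Rightarrow> 'b::real_normed_vector"
  assumes lin: "\<And>x. linear (f' x)" and cont: "\<And>h. continuous_on UNIV (\<lambda>x. f' x h)"
    and x: "(x \<longlongrightarrow> x0) F" and h: "(h \<longlongrightarrow> h0) F"
  shows "((\<lambda>t. f' (x t) (h t)) \<longlongrightarrow> f' x0 h0) F"
proof -
  have eq: "f' y k = (\<Sum>b\<in>Basis. (k \<bullet> b) *\<^sub>R f' y b)" for y k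
  proof -
    have "f' y k = f' y (\<Sum>b\<in>Basis. (k \<bullet> b) *\<^sub>R b)"
      by (simp add: euclidean_representation)
    also have "\<dots> = (\<Sum>b\<in>Basis. (k \<bullet> b) *\<^sub>R f' y b)"
      using lin[of y] by (simp add: linear_sum linear_scale)
    finally show ?thesis .
  qed
  have "((\<lambda>t. f' (x t) b) \<longlongrightarrow> f' x0 b) F" for b
    using continuous_on_tendsto_compose[OF cont[of b] x] by simp
  then show ?thesis
    unfolding eq[of _ "h _"] eq[of _ h0] using h by (intro tendsto_intros)
qed

lemma smooth_derivative_tendsto:
  fixes f :: "'a::euclidean_space \<Rightarrow> 'b::euclidean_space"
  assumes "smooth_on UNIV f" "(x \<longlongrightarrow> x0) F" "(h \<longlongrightarrow> h0) F"
  shows "((\<lambda>t. frechet_derivative f (at (x t)) (h t)) \<longlongrightarrow> frechet_derivative f (at x0) h0) F"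
  by (rule derivative_tendsto)
    (use assms in \<open>auto intro: smooth_on_continuous smooth_on_derivative has_derivative_linear smooth_on_has_derivative\<close>)

text \<open>Turns constancy of a directional derivative into an exact affine formula along the line,
  the form in which the rigidity of homogeneous functions is exploited.\<close>

lemma line_derivative_const:
  fixes f :: "'a::real_normed_vector \<Rightarrow> real"
  assumes f: "\<And>x. (f has_derivative f' x) (at x)" and c: "\<And>s. f' (z + s *\<^sub>R h) h = c"
  shows "f (z + s *\<^sub>R h) = f z + s * c"
proof -
  have "((\<lambda>s. f (z + s *\<^sub>R h)) has_derivative (\<lambda>t. f' (z + s *\<^sub>R h) (t *\<^sub>R h))) (at s)" for s
    by (rule has_derivative_compose[OF _ f]) (auto intro!: derivative_eq_intros)
  moreover have "f' (z + s *\<^sub>R h) (t *\<^sub>R h) = t * c" for s t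
    using c[of s] f by (metis has_derivative_linear linear_scale real_scaleR_def)
  ultimately have "((\<lambda>s. f (z + s *\<^sub>R h)) has_real_derivative c) (at s)" for s
    by (simp add: has_field_derivative_def mult_commute_abs)
  then have "((\<lambda>s. f (z + s *\<^sub>R h) - s * c) has_real_derivative 0) (at s)" for s
    by (auto intro!: derivative_eq_intros)
  then have "f (z + s *\<^sub>R h) - s * c = f (z + 0 *\<^sub>R h) - 0 * c"
    by (intro DERIV_isconst_all) auto
  then show ?thesis
    by simp
qed

section \<open>Layers, weight filtration and dilations\<close>

definition lay :: "('n \<Rightarrow> nat) \<Rightarrow> nat \<Rightarrow> real^'n \<Rightarrow> real^'n" where
  "lay \<sigma> k x = (\<chi> i. if \<sigma> i = k then x $ i else 0)"

text \<open>The filtration by weight. Products, group commutators and the given stratification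
  respect it exactly, while layers are controlled only modulo the next step; hence
  \<open>lay \<sigma> k\<close> is mostly applied to elements of \<open>flt \<sigma> k\<close>,
  where it gives the leading part.\<close>

definition flt :: "('n \<Rightarrow> nat) \<Rightarrow> nat \<Rightarrow> (real^'n) set" where
  "flt \<sigma> k = {x. \<forall>i. \<sigma> i < k \<longrightarrow> x $ i = 0}"

lemma lay_nth [simp]: "lay \<sigma> k x $ i = (if \<sigma> i = k then x $ i else 0)"
  by (simp add: lay_def)

lemma lay_lay [simp]: "lay \<sigma> k (lay \<sigma> k x) = lay \<sigma> k x"
  by (simp add: vec_eq_iff)

lemma linear_lay: "linear (lay \<sigma> k)"
  by (rule linearI) (auto simp: vec_eq_iff)

lemma lay_in_flt: "lay \<sigma> k x \<in> flt \<sigma> k"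
  by (simp add: flt_def)

lemma subspace_flt: "subspace (flt \<sigma> k)"
  by (auto simp: subspace_def flt_def)

lemma flt_antimono: "k \<le> l \<Longrightarrow> flt \<sigma> l \<subseteq> flt \<sigma> k"
  by (auto simp: flt_def)

lemma flt_diff_lay: "x \<in> flt \<sigma> k \<Longrightarrow> x - lay \<sigma> k x \<in> flt \<sigma> (Suc k)"
  by (auto simp: flt_def less_Suc_eq)

lemma linear_dilation: "linear (dilation \<sigma> \<eta>)"
  by (rule linearI) (auto simp: dilation_def vec_eq_iff algebra_simps)

lemma dilation_nth [simp]: "dilation \<sigma> \<eta> x $ i = \<eta> ^ \<sigma> i * x $ i"
  by (simp add: dilation_def)

text \<open>After rescaling, coordinate \<open>i\<close> carries the power
  \<open>\<sigma> i - d\<close> of \<open>\<eta>\<close>: the factor is 1 on layer \<open>d\<close>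
  and tends to 0 above it. Below \<open>d\<close> it would blow up, which membership in
  \<open>flt \<sigma> d\<close> excludes.\<close>

lemma tendsto_dilation_lay:
  fixes x :: "real^'n::finite"
  assumes "x \<in> flt \<sigma> d"
  shows "((\<lambda>\<eta>. inverse (\<eta> ^ d) *\<^sub>R dilation \<sigma> \<eta> x) \<longlongrightarrow> lay \<sigma> d x) (at_right 0)"
proof (rule vec_tendstoI)
  fix i
  have pos: "\<forall>\<^sub>F \<eta> in at_right 0. (\<eta>::real) > 0"
    by (rule eventually_at_right_less)
  show "((\<lambda>\<eta>. (inverse (\<eta> ^ d) *\<^sub>R dilation \<sigma> \<eta> x) $ i) \<longlongrightarrow> lay \<sigma> d x $ i) (at_right 0)"
  proof (cases "\<sigma> i < d")
    case True
    with assms show ?thesis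
      by (simp add: flt_def)
  next
    case False
    have "((\<lambda>\<eta>. \<eta> ^ (\<sigma> i - d) * x $ i) \<longlongrightarrow> 0 ^ (\<sigma> i - d) * x $ i) (at_right (0::real))"
      by (intro tendsto_intros)
    \<comment> \<open>Here \<open>0 ^ 0 = 1\<close> singles out the coordinates of weight exactly
      \<open>d\<close>.\<close>
    moreover have "0 ^ (\<sigma> i - d) * x $ i = lay \<sigma> d x $ i"
      using False by simp
    ultimately have lim: "((\<lambda>\<eta>. \<eta> ^ (\<sigma> i - d) * x $ i) \<longlongrightarrow> lay \<sigma> d x $ i) (at_right (0::real))"
      by simp
    have "\<forall>\<^sub>F \<eta> in at_right (0::real). \<eta> ^ (\<sigma> i - d) * x $ i = (inverse (\<eta> ^ d) *\<^sub>R dilation \<sigma> \<eta> x) $ i"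
      using pos
    proof eventually_elim
      case (elim \<eta>)
      have "\<eta> ^ \<sigma> i = \<eta> ^ d * \<eta> ^ (\<sigma> i - d)"
        using False by (simp flip: power_add)
      with elim show ?case
        by simp
    qed
    with lim show ?thesis
      by (rule Lim_transform_eventually)
  qed
qed

lemma tendsto_dilation_0:
  fixes x :: "real^'n::finite"
  assumes "\<And>i. 1 \<le> \<sigma> i"
  shows "((\<lambda>\<eta>. dilation \<sigma> \<eta> x) \<longlongrightarrow> 0) (at_right 0)"
proof (rule vec_tendstoI)
  fix i
  have "((\<lambda>\<eta>. \<eta> ^ \<sigma> i * x $ i) \<longlongrightarrow> 0 ^ \<sigma> i * x $ i) (at_right (0::real))"
    by (intro tendsto_intros)
  then show "((\<lambda>\<eta>. dilation \<sigma> \<eta> x $ i) \<longlongrightarrow> 0 $ i) (at_right 0)"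
    using assms[of i] by (simp add: zero_power)
qed

definition dilation2 :: "('n::finite \<Rightarrow> nat) \<Rightarrow> real \<Rightarrow> (real^'n) \<times> (real^'n) \<Rightarrow> (real^'n) \<times> (real^'n)" where
  "dilation2 \<sigma> \<eta> z = (dilation \<sigma> \<eta> (fst z), dilation \<sigma> \<eta> (snd z))"

lemma linear_dilation2: "linear (dilation2 \<sigma> \<eta>)"
  by (rule linearI) (simp_all add: dilation2_def linear_add[OF linear_dilation] linear_scale[OF linear_dilation])

text \<open>The derivative of a homogeneous function is homogeneous; letting the dilation parameter
  tend to \<open>0\<close> shows that its components of top or higher weight are constant.\<close>

lemma homogeneous_derivative:
  fixes f :: "(real^'n::finite) \<times> (real^'n) \<Rightarrow> real"
  assumes f: "smooth_on UNIV f" and \<sigma>: "\<And>i. 1 \<le> \<sigma> i"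
    and hom: "\<And>\<eta> z. \<eta> > 0 \<Longrightarrow> f (dilation2 \<sigma> \<eta> z) = \<eta> ^ d * f z"
  shows homogeneous_derivative_scale: "\<eta> > 0 \<Longrightarrow>
          frechet_derivative f (at (dilation2 \<sigma> \<eta> z)) (dilation2 \<sigma> \<eta> h)
            = \<eta> ^ d * frechet_derivative f (at z) h"
    and homogeneous_derivative_top: "a \<in> flt \<sigma> d \<Longrightarrow> b \<in> flt \<sigma> d \<Longrightarrow>
          frechet_derivative f (at z) (a, b) = frechet_derivative f (at 0) (lay \<sigma> d a, lay \<sigma> d b)"
proof -
  let ?D = "\<lambda>z. frechet_derivative f (at z)"
  have scale: "?D (dilation2 \<sigma> \<eta> z) (dilation2 \<sigma> \<eta> h) = \<eta> ^ d * ?D z h" if "\<eta> > 0" for \<eta> z h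
  proof -
    have "((\<lambda>z. f (dilation2 \<sigma> \<eta> z)) has_derivative (\<lambda>h. ?D (dilation2 \<sigma> \<eta> z) (dilation2 \<sigma> \<eta> h))) (at z)"
      by (rule has_derivative_compose[OF _ smooth_on_has_derivative[OF f]])
        (simp add: bounded_linear_imp_has_derivative linear_linear linear_dilation2)
    moreover have "((\<lambda>z. \<eta> ^ d * f z) has_derivative (\<lambda>h. \<eta> ^ d * ?D z h)) (at z)"
      by (intro derivative_intros smooth_on_has_derivative f)
    ultimately have "(\<lambda>h. ?D (dilation2 \<sigma> \<eta> z) (dilation2 \<sigma> \<eta> h)) = (\<lambda>h. \<eta> ^ d * ?D z h)"
      using has_derivative_unique by (simp add: hom[OF that])
    then show ?thesis
      by (rule fun_cong)
  qed
  then show "\<eta> > 0 \<Longrightarrow> ?D (dilation2 \<sigma> \<eta> z) (dilation2 \<sigma> \<eta> h) = \<eta> ^ d * ?D z h" .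
  assume ab: "a \<in> flt \<sigma> d" "b \<in> flt \<sigma> d"
  have "((\<lambda>\<eta>. ?D (dilation2 \<sigma> \<eta> z) (inverse (\<eta> ^ d) *\<^sub>R dilation \<sigma> \<eta> a, inverse (\<eta> ^ d) *\<^sub>R dilation \<sigma> \<eta> b))
      \<longlongrightarrow> ?D 0 (lay \<sigma> d a, lay \<sigma> d b)) (at_right 0)"
    by (intro smooth_derivative_tendsto f tendsto_Pair tendsto_dilation_lay ab)
      (auto simp: dilation2_def zero_prod_def intro!: tendsto_Pair tendsto_dilation_0 \<sigma>)
  moreover have "\<forall>\<^sub>F \<eta> in at_right 0. ?D (dilation2 \<sigma> \<eta> z)
      (inverse (\<eta> ^ d) *\<^sub>R dilation \<sigma> \<eta> a, inverse (\<eta> ^ d) *\<^sub>R dilation \<sigma> \<eta> b) = ?D z (a, b)"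
    using eventually_at_right_less
  proof eventually_elim
    case (elim \<eta>)
    have "(inverse (\<eta> ^ d) *\<^sub>R dilation \<sigma> \<eta> a, inverse (\<eta> ^ d) *\<^sub>R dilation \<sigma> \<eta> b)
        = inverse (\<eta> ^ d) *\<^sub>R dilation2 \<sigma> \<eta> (a, b)"
      by (simp add: dilation2_def)
    then show ?case
      using elim scale[OF elim, of z "(a, b)"] has_derivative_linear[OF smooth_on_has_derivative[OF f]]
      by (simp add: linear_scale)
  qed
  ultimately have "((\<lambda>\<eta>. ?D z (a, b)) \<longlongrightarrow> ?D 0 (lay \<sigma> d a, lay \<sigma> d b)) (at_right (0::real))"
    by (rule Lim_transform_eventually)
  then show "?D z (a, b) = ?D 0 (lay \<sigma> d a, lay \<sigma> d b)"
    by (simp add: tendsto_const_iff)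
qed

lemma homogeneous_zero:
  assumes "\<And>\<eta>. \<eta> > 0 \<Longrightarrow> f (dilation2 \<sigma> \<eta> 0) = \<eta> ^ d * f 0" "0 < d"
  shows "f 0 = (0::real)"
  using assms(1)[of 2] one_less_power[of "2::real", OF _ assms(2)] linear_0[OF linear_dilation2, of \<sigma> 2] by auto

text \<open>The derivative in a direction of weight \<open>k\<close> has weight \<open>1\<close>, hence is linear.\<close>

lemma homogeneous_bilinear:
  fixes f :: "(real^'n::finite) \<times> (real^'n) \<Rightarrow> real"
  assumes f: "smooth_on UNIV f" and \<sigma>: "\<And>i. 1 \<le> \<sigma> i"
    and hom: "\<And>\<eta> z. \<eta> > 0 \<Longrightarrow> f (dilation2 \<sigma> \<eta> z) = \<eta> ^ Suc k * f z"
    and f0: "\<And>y. f (0, y) = 0" "\<And>x. f (x, 0) = 0"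
  obtains \<beta> where "\<And>x y. y \<in> flt \<sigma> k \<Longrightarrow> f (x, y) = \<beta> x y" "\<And>y. linear (\<lambda>x. \<beta> x y)" "\<And>x. linear (\<beta> x)"
    "\<And>x y. y \<in> flt \<sigma> k \<Longrightarrow> \<beta> x y = \<beta> (lay \<sigma> 1 x) (lay \<sigma> k y)"
proof -
  let ?D = "\<lambda>z. frechet_derivative f (at z)"
  define R where "R = (\<lambda>y z. ?D z (0, lay \<sigma> k y))"
  have linD: "linear (?D z)" for z
    by (rule has_derivative_linear[OF smooth_on_has_derivative[OF f]])
  have zero: "?D (0, y') (0, y) = 0" for y y'
  proof -
    have "((\<lambda>t. f (0, y' + t *\<^sub>R y)) has_derivative (\<lambda>t. ?D (0, y' + 0 *\<^sub>R y) (0, t *\<^sub>R y))) (at 0)"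
      by (rule has_derivative_compose[OF _ smooth_on_has_derivative[OF f]]) (auto intro!: derivative_eq_intros)
    then have "(\<lambda>t. ?D (0, y') (0, t *\<^sub>R y)) = (\<lambda>t. 0)"
      using f0(1) has_derivative_unique[OF _ has_derivative_const] by simp
    then show ?thesis
      by (metis scaleR_one)
  qed
  \<comment> \<open>The part of \<open>y\<close> beyond weight \<open>k\<close> has weight at least
    the degree \<open>Suc k\<close>, so the derivative along it is the same at every point; at the
    origin it vanishes because \<open>f (0, y) = 0\<close>.\<close>
  have D_lay: "?D z (0, y) = R y z" if "y \<in> flt \<sigma> k" for y z
  proof -
    have "?D z (0, y - lay \<sigma> k y) = 0"
      by (subst homogeneous_derivative_top[OF f \<sigma> hom])
        (use flt_diff_lay[OF that] zero[of 0] in \<open>auto simp: subspace_0 subspace_flt zero_prod_def linear_0[OF linear_lay]\<close>)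
    moreover have "?D z (0, y) = ?D z (0, y - lay \<sigma> k y) + ?D z (0, lay \<sigma> k y)"
      by (simp flip: linear_add[OF linD])
    ultimately show ?thesis
      by (simp add: R_def)
  qed
  have Rsm: "smooth_on UNIV (R y)" for y
    unfolding R_def by (rule smooth_on_derivative[OF f])
  \<comment> \<open>The direction \<open>lay \<sigma> k y\<close> itself scales with
    \<open>\<eta> ^ k\<close>, which leaves a single power of \<open>\<eta>\<close> for the base
    point.\<close>
  have Rhom: "R y (dilation2 \<sigma> \<eta> z) = \<eta> ^ 1 * R y z" if "\<eta> > 0" for y \<eta> z
  proof -
    have "dilation2 \<sigma> \<eta> (0, lay \<sigma> k y) = \<eta> ^ k *\<^sub>R (0, lay \<sigma> k y)"
      by (auto simp: dilation2_def vec_eq_iff)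
    then have "\<eta> ^ k * R y (dilation2 \<sigma> \<eta> z) = \<eta> ^ Suc k * R y z"
      using homogeneous_derivative_scale[OF f \<sigma> hom that, of z "(0, lay \<sigma> k y)"]
      by (simp add: R_def linear_scale[OF linD] del: scaleR_Pair)
    then show ?thesis
      using that by simp
  qed
  define \<beta> where "\<beta> = (\<lambda>x y. R y (x, 0))"
  let ?R' = "\<lambda>y z. frechet_derivative (R y) (at z)"
  have linR': "linear (?R' y z)" for y z
    by (rule has_derivative_linear[OF smooth_on_has_derivative[OF Rsm]])
  have in1: "x \<in> flt \<sigma> 1" for x
    unfolding flt_def using \<sigma> leD by blast
  have R': "?R' y z (a, b) = ?R' y 0 (lay \<sigma> 1 a, lay \<sigma> 1 b)" for y z a b
    by (rule homogeneous_derivative_top[OF Rsm \<sigma> Rhom in1 in1])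
  have R'2: "?R' y z h = ?R' y 0 h" for y z h
    using R'[of y z "fst h" "snd h"] R'[of y 0 "fst h" "snd h"] by simp
  have R: "R y z = ?R' y 0 z" for y z
    using line_derivative_const[of "R y" "?R' y" 0 z "?R' y 0 z" 1] R'2[of y _ z]
      homogeneous_zero[of "R y" \<sigma> 1] Rhom smooth_on_has_derivative[OF Rsm] by auto
  \<comment> \<open>\<open>R y\<close> is linear and vanishes on pairs \<open>(0, y')\<close>, so it
    depends on the first argument only.\<close>
  have R_add: "R y (x, \<tau> *\<^sub>R y') = \<beta> x y" for x y y' \<tau>
  proof -
    have "R y (x, \<tau> *\<^sub>R y') = ?R' y 0 ((x, 0) + (0, \<tau> *\<^sub>R y'))"
      using R by simp
    also have "\<dots> = R y (x, 0) + R y (0, \<tau> *\<^sub>R y')"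
      by (simp only: linear_add[OF linR'] R)
    finally show ?thesis
      using zero by (simp add: \<beta>_def R_def)
  qed
  show thesis
  proof (rule that[of \<beta>])
    fix x y :: "real^'n"
    assume y: "y \<in> flt \<sigma> k"
    \<comment> \<open>Along the segment from \<open>(x, 0)\<close> to \<open>(x, y)\<close> the
      derivative is constantly \<open>\<beta> x y\<close>, and \<open>f\<close> starts from
      0.\<close>
    have "f ((x, 0) + 1 *\<^sub>R (0, y)) = f (x, 0) + 1 * \<beta> x y"
      by (rule line_derivative_const[of f ?D]) (auto simp: smooth_on_has_derivative[OF f] D_lay[OF y] R_add)
    then show "f (x, y) = \<beta> x y"
      by (simp add: f0)
    have idem: "lay \<sigma> k (lay \<sigma> k y) = lay \<sigma> k y"
      by (simp add: vec_eq_iff)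
    have "\<beta> x y = ?R' y 0 (lay \<sigma> 1 x, lay \<sigma> 1 0)"
      unfolding \<beta>_def R[of y "(x, 0)"] by (rule R')
    also have "\<dots> = ?R' y 0 (lay \<sigma> 1 x, 0)"
      by (simp add: linear_0[OF linear_lay])
    also have "\<dots> = \<beta> (lay \<sigma> 1 x) y"
      by (simp only: \<beta>_def R[of y "(lay \<sigma> 1 x, 0)"])
    also have "\<dots> = \<beta> (lay \<sigma> 1 x) (lay \<sigma> k y)"
      by (simp add: \<beta>_def R_def idem)
    finally show "\<beta> x y = \<beta> (lay \<sigma> 1 x) (lay \<sigma> k y)" .
  next
    fix y :: "real^'n"
    have "linear (?R' y 0 \<circ> (\<lambda>x. (x, 0)))"
      by (intro linear_compose linR') (simp add: linear_iff)
    then show "linear (\<lambda>x. \<beta> x y)"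
      by (simp add: \<beta>_def o_def flip: R)
  next
    fix x :: "real^'n"
    have "linear (?D (x, 0) \<circ> ((\<lambda>y. (0, y)) \<circ> lay \<sigma> k))"
      by (intro linear_compose linD linear_lay) (simp add: linear_iff)
    then show "linear (\<beta> x)"
      by (simp add: \<beta>_def R_def o_def)
  qed
qed

text \<open>Only the plane spanned by \<open>(v, 0)\<close> and \<open>(0, w)\<close> enters, so
  bilinearity there is enough. This is how Lie brackets, which are second derivatives of the group
  law, are read off from its values.\<close>

lemma mixed_derivative_bilinear:
  fixes f :: "'a::euclidean_space \<times> 'b::euclidean_space \<Rightarrow> real"
  assumes f: "smooth_on UNIV f" and c: "\<And>s \<tau>. f (s *\<^sub>R v, \<tau> *\<^sub>R w) = s * \<tau> * c"
  shows "frechet_derivative (\<lambda>z. frechet_derivative f (at z) (0, w)) (at 0) (v, 0) = c"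
proof -
  let ?D = "\<lambda>z. frechet_derivative f (at z)"
  have 1: "?D (s *\<^sub>R v, 0) (0, w) = s * c" for s
  proof -
    have "((\<lambda>t. f (s *\<^sub>R v, t *\<^sub>R w)) has_derivative (\<lambda>t. ?D (s *\<^sub>R v, 0 *\<^sub>R w) (0, t *\<^sub>R w))) (at 0)"
      by (rule has_derivative_compose[OF _ smooth_on_has_derivative[OF f]]) (auto intro!: derivative_eq_intros)
    moreover have "((\<lambda>t. f (s *\<^sub>R v, t *\<^sub>R w)) has_derivative (\<lambda>t. s * t * c)) (at 0)"
      unfolding c by (auto intro!: derivative_eq_intros)
    ultimately have "(\<lambda>t. ?D (s *\<^sub>R v, 0 *\<^sub>R w) (0, t *\<^sub>R w)) = (\<lambda>t. s * t * c)"
      by (rule has_derivative_unique)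
    from fun_cong[OF this, of 1] show ?thesis
      by simp
  qed
  let ?D2 = "frechet_derivative (\<lambda>z. ?D z (0, w)) (at (0 *\<^sub>R v, 0))"
  have "((\<lambda>s. ?D (s *\<^sub>R v, 0) (0, w)) has_derivative (\<lambda>t. ?D2 (t *\<^sub>R v, 0))) (at 0)"
    by (rule has_derivative_compose[of "\<lambda>s. (s *\<^sub>R v, 0)", OF _ smooth_on_has_derivative[OF smooth_on_derivative[OF f]]])
      (auto intro!: derivative_eq_intros)
  moreover have "((\<lambda>s. ?D (s *\<^sub>R v, 0) (0, w)) has_derivative (\<lambda>t. t * c)) (at 0)"
    unfolding 1 by (auto intro!: derivative_eq_intros)
  ultimately have "(\<lambda>t. ?D2 (t *\<^sub>R v, 0)) = (\<lambda>t. t * c)"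
    by (rule has_derivative_unique)
  from fun_cong[OF this, of 1] show ?thesis
    by (simp add: zero_prod_def)
qed

section \<open>Homogeneous groups\<close>

context homogeneous_group
begin

abbreviation M where "M \<equiv> (\<lambda>z. mul (fst z) (snd z))"

text \<open>The deviation of the group law from addition in coordinate \<open>j\<close>. It is
  homogeneous of degree \<open>\<sigma> j\<close> and carries all of the noncommutativity.\<close>

definition P :: "'n \<Rightarrow> (real^'n) \<times> (real^'n) \<Rightarrow> real" where
  "P j z = mul (fst z) (snd z) $ j - (fst z $ j + snd z $ j)"

lemma mul_nth: "mul x y $ j = x $ j + y $ j + P j (x, y)"
  by (simp add: P_def)

lemma weight_pos: "1 \<le> \<sigma> i"
  using degrees[of i] by simp

lemma smooth_M: "smooth_on UNIV M"
  using smooth_mul by (simp only: case_prod_beta')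

text \<open>A dilation maps the unit to an idempotent, hence to itself; since all weights are
  positive, the dilation by 2 fixes only 0.\<close>

lemma unit_eq_0: "e = 0"
proof -
  have "mul (dilation \<sigma> 2 e) (dilation \<sigma> 2 e) = dilation \<sigma> 2 e"
    by (simp flip: dilation_hom)
  then have "dilation \<sigma> 2 e = e"
    by (metis left_cancel right_neutral)
  then have "2 ^ \<sigma> i * e $ i = e $ i" for i
    by (metis dilation_nth)
  moreover have "2 ^ \<sigma> i > (1::real)" for i
    using weight_pos[of i] by (intro one_less_power) auto
  ultimately have "e $ i = 0" for i
    by (metis less_irrefl mult_cancel_right1)
  then show ?thesis
    by (simp add: vec_eq_iff)
qed

lemma mul_0 [simp]: "mul 0 x = x" "mul x 0 = x"
  using left_neutral[of x] right_neutral[of x] unfolding unit_eq_0 .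

lemma P_0 [simp]: "P j (0, y) = 0" "P j (x, 0) = 0"
  by (simp_all add: P_def)

lemma smooth_P: "smooth_on UNIV (P j)"
proof -
  have 1: "bounded_linear (\<lambda>x::real^'n. x $ j)"
    by (rule bounded_linear_vec_nth)
  have 2: "bounded_linear (\<lambda>z::(real^'n) \<times> (real^'n). - (fst z $ j + snd z $ j))"
    by (intro bounded_linear_minus bounded_linear_add bounded_linear_compose[OF 1] bounded_linear_fst bounded_linear_snd)
  from smooth_on_add[OF smooth_on_linear_left[OF 1 smooth_M] smooth_on_linear[OF 2]]
  moreover have "(\<lambda>z. M z $ j + - (fst z $ j + snd z $ j)) = P j"
    by (auto simp: P_def)
  ultimately show ?thesis
    by simp
qed

lemma P_homogeneous: "\<eta> > 0 \<Longrightarrow> P j (dilation2 \<sigma> \<eta> z) = \<eta> ^ \<sigma> j * P j z"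
  by (simp add: P_def dilation2_def algebra_simps flip: dilation_hom)

abbreviation DP where "DP j z \<equiv> frechet_derivative (P j) (at z)"
abbreviation DM where "DM z \<equiv> frechet_derivative M (at z)"

lemma P_has_derivative: "(P j has_derivative DP j z) (at z)"
  by (rule smooth_on_has_derivative[OF smooth_P])

lemma M_has_derivative: "(M has_derivative DM z) (at z)"
  by (rule smooth_on_has_derivative[OF smooth_M])

lemma DM_nth: "DM z h $ j = fst h $ j + snd h $ j + DP j z h"
proof -
  have "((\<lambda>z. M z $ j) has_derivative (\<lambda>h. DM z h $ j)) (at z)"
    by (rule bounded_linear.has_derivative[OF bounded_linear_vec_nth M_has_derivative])
  moreover have "((\<lambda>z. M z $ j) has_derivative (\<lambda>h. fst h $ j + snd h $ j + DP j z h)) (at z)"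
    unfolding mul_nth
    by (intro has_derivative_add bounded_linear.has_derivative[OF bounded_linear_vec_nth])
      (auto intro!: derivative_eq_intros P_has_derivative)
  ultimately show ?thesis
    by (metis (no_types, lifting) has_derivative_unique)
qed

lemma linear_DP: "linear (DP j z)"
  using P_has_derivative has_derivative_linear by blast

lemma linear_DM: "linear (DM z)"
  using M_has_derivative has_derivative_linear by blast

lemma DM_origin: "DM (0, y) (0, v) = v" "DM (x, 0) (v, 0) = v"
proof -
  have "((\<lambda>t. M (0, y + t *\<^sub>R v)) has_derivative (\<lambda>t. DM (0, y + 0 *\<^sub>R v) (0, t *\<^sub>R v))) (at 0)"
    by (rule has_derivative_compose[OF _ M_has_derivative]) (auto intro!: derivative_eq_intros)
  moreover have "((\<lambda>t. y + t *\<^sub>R v) has_derivative (\<lambda>t. t *\<^sub>R v)) (at (0::real))"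
    by (auto intro!: derivative_eq_intros)
  ultimately have "(\<lambda>t. DM (0, y) (0, t *\<^sub>R v)) = (\<lambda>t. t *\<^sub>R v)"
    by (simp add: has_derivative_unique)
  from fun_cong[OF this, of 1] show "DM (0, y) (0, v) = v"
    by simp
  have "((\<lambda>t. M (x + t *\<^sub>R v, 0)) has_derivative (\<lambda>t. DM (x + 0 *\<^sub>R v, 0) (t *\<^sub>R v, 0))) (at 0)"
    by (rule has_derivative_compose[OF _ M_has_derivative]) (auto intro!: derivative_eq_intros)
  moreover have "((\<lambda>t. x + t *\<^sub>R v) has_derivative (\<lambda>t. t *\<^sub>R v)) (at (0::real))"
    by (auto intro!: derivative_eq_intros)
  ultimately have "(\<lambda>t. DM (x, 0) (t *\<^sub>R v, 0)) = (\<lambda>t. t *\<^sub>R v)"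
    by (simp add: has_derivative_unique)
  from fun_cong[OF this, of 1] show "DM (x, 0) (v, 0) = v"
    by simp
qed

text \<open>By homogeneity the derivative along such directions equals its value at the origin.
  There it splits into the two partial derivatives, which vanish because multiplication by the unit
  on either side is the identity.\<close>

lemma DP_top_eq_0:
  assumes "a \<in> flt \<sigma> (\<sigma> j)" "b \<in> flt \<sigma> (\<sigma> j)"
  shows "DP j z (a, b) = 0"
proof -
  have "DP j 0 (a, b) = 0" for a b
  proof -
    have "DP j 0 (0, b) = 0" "DP j 0 (a, 0) = 0"
      using DM_nth[of 0 "(0, b)" j] DM_nth[of 0 "(a, 0)" j] DM_origin[of 0] by (simp_all add: zero_prod_def)
    then show ?thesis
      using linear_add[OF linear_DP[of j 0], of "(a, 0)" "(0, b)"] by simp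
  qed
  then show ?thesis
    using homogeneous_derivative_top[OF smooth_P weight_pos P_homogeneous assms] by simp
qed

text \<open>The two arguments differ by a vector along which \<open>DP j\<close> vanishes. So
  \<open>P j\<close> is a function of the coordinates of weight below \<open>\<sigma> j\<close>, and
  every triangular structure below comes from here.\<close>

lemma P_cong:
  assumes "\<And>i. \<sigma> i < \<sigma> j \<Longrightarrow> x $ i = x' $ i" "\<And>i. \<sigma> i < \<sigma> j \<Longrightarrow> y $ i = y' $ i"
  shows "P j (x, y) = P j (x', y')"
proof -
  have "P j ((x', y') + 1 *\<^sub>R (x - x', y - y')) = P j (x', y') + 1 * 0"
    by (rule line_derivative_const[OF P_has_derivative]) (auto intro!: DP_top_eq_0 simp: flt_def assms)
  then show ?thesis
    by simp
qed

lemma DP_cong: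
  assumes "\<And>i. \<sigma> i < \<sigma> j \<Longrightarrow> x $ i = x' $ i" "\<And>i. \<sigma> i < \<sigma> j \<Longrightarrow> y $ i = y' $ i"
  shows "DP j (x, y) = DP j (x', y')"
proof -
  have "((\<lambda>z. P j (z + (x - x', y - y'))) has_derivative (\<lambda>h. DP j ((x', y') + (x - x', y - y')) h)) (at (x', y'))"
    by (rule has_derivative_compose[OF _ P_has_derivative]) (auto intro!: derivative_eq_intros)
  moreover have "P j (z + (x - x', y - y')) = P j z" for z
    by (cases z) (auto intro!: P_cong simp: assms)
  ultimately have "(P j has_derivative DP j (x, y)) (at (x', y'))"
    by simp
  with P_has_derivative show ?thesis
    using has_derivative_unique by blast
qed

section \<open>Measurability and invariance of Lebesgue measure\<close>

lemma continuous_mul: "continuous_on S f \<Longrightarrow> continuous_on S g \<Longrightarrow> continuous_on S (\<lambda>x. mul (f x) (g x))"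
  using continuous_on_compose2[OF smooth_on_continuous[OF smooth_M], of S "\<lambda>x. (f x, g x)"]
  by (simp add: continuous_on_Pair)

lemma continuous_iv: "continuous_on S f \<Longrightarrow> continuous_on S (\<lambda>x. iv (f x))"
  using continuous_on_compose2[OF smooth_on_continuous[OF smooth_iv], of S f] by simp

lemma borel_measurable_mul [measurable]:
  assumes "f \<in> borel_measurable N" "g \<in> borel_measurable N"
  shows "(\<lambda>x. mul (f x) (g x)) \<in> borel_measurable N"
  by (rule borel_measurable_continuous_Pair[OF assms smooth_on_continuous[OF smooth_M]])

lemma borel_measurable_iv [measurable]:
  assumes "f \<in> borel_measurable N"
  shows "(\<lambda>x. iv (f x)) \<in> borel_measurable N"
  by (rule measurable_compose[OF assms borel_measurable_continuous_onI]) (rule continuous_iv, rule continuous_on_id)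

text \<open>Translations are triangular by \<open>P_cong\<close>, so Lebesgue measure is a Haar
  measure on both sides.\<close>

lemma nn_integral_right_translate:
  assumes "f \<in> borel_measurable borel"
  shows "(\<integral>\<^sup>+x. f (mul x h) \<partial>lborel) = (\<integral>\<^sup>+x. f x \<partial>lborel)"
proof (rule nn_integral_lborel_triangular[OF _ assms])
  show "(\<lambda>x. mul x h) \<in> borel_measurable borel"
    by measurable
  show "tri_dep \<sigma> (\<lambda>u. mul u h $ j - u $ j) (\<sigma> j)" for j
    unfolding tri_dep_def by (auto simp: mul_nth intro: P_cong)
qed

lemma nn_integral_left_translate:
  assumes "f \<in> borel_measurable borel"
  shows "(\<integral>\<^sup>+x. f (mul h x) \<partial>lborel) = (\<integral>\<^sup>+x. f x \<partial>lborel)"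
proof (rule nn_integral_lborel_triangular[OF _ assms])
  show "(\<lambda>x. mul h x) \<in> borel_measurable borel"
    by measurable
  show "tri_dep \<sigma> (\<lambda>u. mul h u $ j - u $ j) (\<sigma> j)" for j
    unfolding tri_dep_def by (auto simp: mul_nth intro: P_cong)
qed

section \<open>Group commutators and their leading parts\<close>

lemma flt_mul: "x \<in> flt \<sigma> k \<Longrightarrow> y \<in> flt \<sigma> k \<Longrightarrow> mul x y \<in> flt \<sigma> k"
  using P_cong[of _ x 0 y 0] by (fastforce simp: flt_def mul_nth)

text \<open>Up to weight \<open>k\<close> the correction \<open>P j\<close> reads only coordinates
  in which \<open>y\<close> vanishes, so it is the correction of a product with the unit.\<close>

lemma mul_nth_flt:
  assumes "y \<in> flt \<sigma> k" "\<sigma> j \<le> k"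
  shows "mul x y $ j = x $ j + y $ j" "mul y x $ j = x $ j + y $ j"
  using P_cong[of j x x y 0] P_cong[of j y 0 x x] assms by (auto simp: flt_def mul_nth)

text \<open>Equal to g h g^-1 h^-1. With a single inverse it is the solution \<open>c\<close> of
  \<open>mul c (mul h g) = mul g h\<close>, which can be solved weight by weight without knowing the
  coordinates of \<open>iv\<close>.\<close>

definition group_comm :: "real^'n \<Rightarrow> real^'n \<Rightarrow> real^'n" where
  "group_comm g h = mul (mul g h) (iv (mul h g))"

lemma group_comm_mul: "mul (group_comm g h) (mul h g) = mul g h"
proof -
  have "mul (group_comm g h) (mul h g) = mul (mul g h) (mul (iv (mul h g)) (mul h g))"
    by (simp only: group_comm_def assoc)
  then show ?thesis
    by (simp add: left_inverse)
qed

text \<open>Compare coordinates in \<open>mul c (mul h g) = mul g h\<close>. Up to weight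
  \<open>k\<close> both products with \<open>h\<close> are sums, so \<open>c\<close> has no
  component there; in weight \<open>k + 1\<close> the correction involving \<open>c\<close> is then
  still zero, and only the antisymmetrised \<open>P\<close> remains.\<close>

lemma group_comm_nth:
  assumes h: "h \<in> flt \<sigma> k"
  shows group_comm_flt: "group_comm g h \<in> flt \<sigma> (Suc k)"
    and group_comm_nth_Suc: "\<sigma> j = Suc k \<Longrightarrow> group_comm g h $ j = P j (g, h) - P j (h, g)"
proof -
  let ?c = "group_comm g h" and ?q = "mul h g"
  have c: "?c $ j + ?q $ j + P j (?c, ?q) = mul g h $ j" for j
    using mul_nth[of ?c ?q j] by (simp add: group_comm_mul)
  have low: "?c $ j = 0" if "\<sigma> j \<le> k" for j
    using that
  proof (induction "\<sigma> j" arbitrary: j rule: less_induct)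
    case less
    have "P j (?c, ?q) = P j (0, ?q)"
      by (rule P_cong) (use less in auto)
    then show ?case
      using c[of j] mul_nth_flt[OF h less.prems, of g] by simp
  qed
  then show "?c \<in> flt \<sigma> (Suc k)"
    by (simp add: flt_def)
  assume j: "\<sigma> j = Suc k"
  have "P j (?c, ?q) = P j (0, ?q)"
    by (rule P_cong) (use j low in auto)
  then show "?c $ j = P j (g, h) - P j (h, g)"
    using c[of j] by (simp add: mul_nth)
qed

text \<open>The left invariant field with value \<open>v\<close> at the unit: the differential at 0
  of left translation by \<open>\<xi>\<close>, applied to \<open>v\<close>.\<close>

definition left_field :: "real^'n \<Rightarrow> real^'n \<Rightarrow> real^'n" where
  "left_field v \<xi> = DM (\<xi>, 0) (0, v)"

lemma bilinear_P:
  assumes "\<sigma> j = Suc k"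
  obtains \<beta> where "\<And>x y. y \<in> flt \<sigma> k \<Longrightarrow> P j (x, y) = \<beta> x y" "\<And>y. linear (\<lambda>x. \<beta> x y)" "\<And>x. linear (\<beta> x)"
    "\<And>x y. y \<in> flt \<sigma> k \<Longrightarrow> \<beta> x y = \<beta> (lay \<sigma> 1 x) (lay \<sigma> k y)"
  using homogeneous_bilinear[of "P j" \<sigma> k] smooth_P weight_pos P_homogeneous[of _ j] assms P_0 by metis

lemma bilinear_P_swap:
  assumes "\<sigma> j = Suc k"
  obtains \<beta> where "\<And>x y. y \<in> flt \<sigma> k \<Longrightarrow> P j (y, x) = \<beta> x y" "\<And>y. linear (\<lambda>x. \<beta> x y)" "\<And>x. linear (\<beta> x)"
    "\<And>x y. y \<in> flt \<sigma> k \<Longrightarrow> \<beta> x y = \<beta> (lay \<sigma> 1 x) (lay \<sigma> k y)"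
proof (rule homogeneous_bilinear[of "\<lambda>z. P j (snd z, fst z)" \<sigma> k])
  show "smooth_on UNIV (\<lambda>z. P j (snd z, fst z))"
    by (rule smooth_on_linear_right[OF _ smooth_P, of "\<lambda>z. (snd z, fst z)"])
      (intro bounded_linear_Pair bounded_linear_fst bounded_linear_snd)
  show "P j (snd (dilation2 \<sigma> \<eta> z), fst (dilation2 \<sigma> \<eta> z)) = \<eta> ^ Suc k * P j (snd z, fst z)" if "\<eta> > 0" for \<eta> z
    using P_homogeneous[OF that, of j "(snd z, fst z)"] assms by (simp add: dilation2_def)
qed (use that weight_pos in auto)

text \<open>The bridge between group and Lie algebra: for \<open>w\<close> in
  \<open>flt \<sigma> k\<close> this is the leading part both of the group commutator and of the
  commutator of the left invariant fields.\<close>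

definition bracket :: "nat \<Rightarrow> real^'n \<Rightarrow> real^'n \<Rightarrow> real^'n" where
  "bracket k v w = (\<chi> j. if \<sigma> j = Suc k then P j (v, w) - P j (w, v) else 0)"

lemma group_comm_lay:
  assumes "h \<in> flt \<sigma> k"
  shows "lay \<sigma> (Suc k) (group_comm g h) = bracket k g h"
  using group_comm_nth_Suc[OF assms] by (auto simp: vec_eq_iff bracket_def)

lemma bracket_bilinear:
  assumes j: "\<sigma> j = Suc k"
  obtains \<beta> where "\<And>x y. y \<in> flt \<sigma> k \<Longrightarrow> P j (x, y) - P j (y, x) = \<beta> x y"
    "\<And>y. linear (\<lambda>x. \<beta> x y)" "\<And>x. linear (\<beta> x)"
    "\<And>x y. y \<in> flt \<sigma> k \<Longrightarrow> \<beta> x y = \<beta> (lay \<sigma> 1 x) (lay \<sigma> k y)"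
proof -
  obtain \<beta> where \<beta>: "\<And>x y. y \<in> flt \<sigma> k \<Longrightarrow> P j (x, y) = \<beta> x y"
    "\<And>y. linear (\<lambda>x. \<beta> x y)" "\<And>x. linear (\<beta> x)"
    "\<And>x y. y \<in> flt \<sigma> k \<Longrightarrow> \<beta> x y = \<beta> (lay \<sigma> 1 x) (lay \<sigma> k y)"
    using bilinear_P[OF j] by blast
  obtain \<gamma> where \<gamma>: "\<And>x y. y \<in> flt \<sigma> k \<Longrightarrow> P j (y, x) = \<gamma> x y"
    "\<And>y. linear (\<lambda>x. \<gamma> x y)" "\<And>x. linear (\<gamma> x)"
    "\<And>x y. y \<in> flt \<sigma> k \<Longrightarrow> \<gamma> x y = \<gamma> (lay \<sigma> 1 x) (lay \<sigma> k y)"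
    using bilinear_P_swap[OF j] by blast
  show thesis
  proof (rule that[of "\<lambda>x y. \<beta> x y - \<gamma> x y"])
    show "\<beta> x y - \<gamma> x y = \<beta> (lay \<sigma> 1 x) (lay \<sigma> k y) - \<gamma> (lay \<sigma> 1 x) (lay \<sigma> k y)"
      if "y \<in> flt \<sigma> k" for x y
      by (subst \<beta>(4)[OF that], subst \<gamma>(4)[OF that]) (rule refl)
  qed (simp_all add: \<beta>(1) \<gamma>(1) linear_compose_sub \<beta>(2,3) \<gamma>(2,3))
qed

lemma bracket_lay:
  assumes w: "w \<in> flt \<sigma> k"
  shows "bracket k v w = bracket k (lay \<sigma> 1 v) (lay \<sigma> k w)"
proof -
  have "P j (v, w) - P j (w, v) = P j (lay \<sigma> 1 v, lay \<sigma> k w) - P j (lay \<sigma> k w, lay \<sigma> 1 v)"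
    if j: "\<sigma> j = Suc k" for j
  proof -
    obtain \<beta> where \<beta>: "\<And>x y. y \<in> flt \<sigma> k \<Longrightarrow> P j (x, y) - P j (y, x) = \<beta> x y"
      "\<And>y. linear (\<lambda>x. \<beta> x y)" "\<And>x. linear (\<beta> x)"
      "\<And>x y. y \<in> flt \<sigma> k \<Longrightarrow> \<beta> x y = \<beta> (lay \<sigma> 1 x) (lay \<sigma> k y)"
      using bracket_bilinear[OF j] by blast
    show ?thesis
      using \<beta>(1)[OF w, of v] \<beta>(1)[OF lay_in_flt, of "lay \<sigma> 1 v" w] \<beta>(4)[OF w, of v] by linarith
  qed
  then show ?thesis
    unfolding bracket_def vec_eq_iff by simp
qed

lemma bracket_linear_left:
  assumes w: "w \<in> flt \<sigma> k"
  shows "linear (\<lambda>v. bracket k v w)"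
proof -
  have "linear (\<lambda>v. P j (v, w) - P j (w, v))" if j: "\<sigma> j = Suc k" for j
  proof -
    obtain \<beta> where \<beta>: "\<And>x y. y \<in> flt \<sigma> k \<Longrightarrow> P j (x, y) - P j (y, x) = \<beta> x y"
      "\<And>y. linear (\<lambda>x. \<beta> x y)" "\<And>x. linear (\<beta> x)"
      "\<And>x y. y \<in> flt \<sigma> k \<Longrightarrow> \<beta> x y = \<beta> (lay \<sigma> 1 x) (lay \<sigma> k y)"
      using bracket_bilinear[OF j] by blast
    show ?thesis
      unfolding \<beta>(1)[OF w] by (rule \<beta>(2))
  qed
  then show ?thesis
    by (auto simp: linear_iff bracket_def vec_eq_iff)
qed

lemma bracket_linear_right:
  assumes w: "w \<in> flt \<sigma> k" "w' \<in> flt \<sigma> k"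
  shows "bracket k v (w + w') = bracket k v w + bracket k v w'" "bracket k v (c *\<^sub>R w) = c *\<^sub>R bracket k v w"
proof -
  have *: "P j (v, w + w') - P j (w + w', v) = (P j (v, w) - P j (w, v)) + (P j (v, w') - P j (w', v)) \<and>
    P j (v, c *\<^sub>R w) - P j (c *\<^sub>R w, v) = c * (P j (v, w) - P j (w, v))" if j: "\<sigma> j = Suc k" for j
  proof -
    obtain \<beta> where \<beta>: "\<And>x y. y \<in> flt \<sigma> k \<Longrightarrow> P j (x, y) - P j (y, x) = \<beta> x y"
      "\<And>y. linear (\<lambda>x. \<beta> x y)" "\<And>x. linear (\<beta> x)"
      "\<And>x y. y \<in> flt \<sigma> k \<Longrightarrow> \<beta> x y = \<beta> (lay \<sigma> 1 x) (lay \<sigma> k y)"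
      using bracket_bilinear[OF j] by blast
    show ?thesis
      unfolding \<beta>(1)[OF w(1)] \<beta>(1)[OF w(2)] \<beta>(1)[OF subspace_add[OF subspace_flt w]]
        \<beta>(1)[OF subspace_scale[OF subspace_flt w(1)]]
      by (simp add: linear_add[OF \<beta>(3)] linear_scale[OF \<beta>(3)])
  qed
  then show "bracket k v (w + w') = bracket k v w + bracket k v w'" "bracket k v (c *\<^sub>R w) = c *\<^sub>R bracket k v w"
    by (simp_all add: bracket_def vec_eq_iff)
qed

end

section \<open>Stratification\<close>

lemma linear_inj_on_if_dim_image:
  fixes f :: "'a::euclidean_space \<Rightarrow> 'b::euclidean_space"
  assumes f: "linear f" and dim: "dim S \<le> dim (f ` S)" and S: "subspace S"
    and x: "x \<in> S" "f x = 0"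
  shows "x = 0"
proof (rule ccontr)
  assume "x \<noteq> 0"
  then have "independent {x}"
    by (simp add: dependent_single)
  then obtain B where B: "{x} \<subseteq> B" "B \<subseteq> S" "independent B" "S \<subseteq> span B"
    using maximal_independent_subset_extend[of "{x}" S] x by auto
  have fin: "finite B"
    using B(3) by (rule independent_imp_finite)
  have "f ` B \<subseteq> span (f ` (B - {x}))"
  proof (rule image_subsetI)
    fix b
    assume "b \<in> B"
    then show "f b \<in> span (f ` (B - {x}))"
      using x(2) by (cases "b = x") (auto intro: span_base span_zero)
  qed
  then have "span (f ` B) \<subseteq> span (f ` (B - {x}))"
    by (rule span_minimal) simp
  then have "f ` S \<subseteq> span (f ` (B - {x}))"
    using B(4) linear_span_image[OF f, of B] by blast
  then have "dim (f ` S) \<le> card (f ` (B - {x}))"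
    by (rule dim_le_card) (simp add: fin)
  also have "\<dots> \<le> card (B - {x})"
    by (rule card_image_le) (simp add: fin)
  also have "\<dots> < card B"
    using B(1) fin by (intro psubset_card_mono) auto
  also have "\<dots> = dim S"
    using B(2-4) by (metis basis_card_eq_dim)
  finally show False
    using dim by simp
qed

text \<open>The domain is an arbitrary real vector space, since the layers are subspaces of an
  infinite dimensional space of vector fields.\<close>

lemma dim_linear_inj_image:
  fixes f :: "'a::real_vector \<Rightarrow> 'b::euclidean_space"
  assumes f: "linear f" and S: "subspace S" and inj: "inj_on f S"
  shows "dim (f ` S) = dim S"
proof -
  obtain B where B: "B \<subseteq> S" "independent B" "S \<subseteq> span B" "card B = dim S"
    using basis_exists by blast
  have spB: "span B = S"
    using B S by (metis span_minimal subset_antisym)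
  have "independent (f ` B)"
    by (rule linear_independent_injective_image[OF f B(2)]) (simp add: spB inj)
  moreover have "f ` S = span (f ` B)"
    using linear_span_image[OF f, of B] by (simp add: spB)
  ultimately have "dim (f ` S) = card (f ` B)"
    by (simp add: dim_eq_card_independent)
  also have "\<dots> = card B"
    using inj B(1) by (intro card_image) (rule inj_on_subset)
  finally show ?thesis
    using B(4) by simp
qed

lemma dim_range_lay:
  fixes \<sigma> :: "'n::finite \<Rightarrow> nat"
  shows "dim (range (lay \<sigma> k)) = block_dim \<sigma> k"
proof -
  let ?B = "(\<lambda>i. axis i (1::real)) ` {i. \<sigma> i = k} :: (real^'n) set"
  have "?B \<subseteq> Basis"
    by (auto simp: Basis_vec_def)
  then have "independent ?B"
    using independent_Basis independent_mono by blast
  moreover have "range (lay \<sigma> k) \<subseteq> span ?B"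
  proof clarify
    fix x :: "real^'n"
    have "lay \<sigma> k x = (\<Sum>i\<in>{i. \<sigma> i = k}. x $ i *\<^sub>R axis i 1)"
      by (auto simp: vec_eq_iff axis_def if_distrib sum.If_cases Int_def cong: if_cong)
    also have "\<dots> \<in> span ?B"
      by (intro span_sum span_scale span_base) auto
    finally show "lay \<sigma> k x \<in> span ?B" .
  qed
  moreover have "?B \<subseteq> range (lay \<sigma> k)"
  proof clarify
    fix i
    assume "k = \<sigma> i"
    then have "lay \<sigma> (\<sigma> i) (axis i 1) = axis i (1::real)"
      by (auto simp: vec_eq_iff axis_def)
    then show "axis i 1 \<in> range (lay \<sigma> (\<sigma> i))"
      by (metis rangeI)
  qed
  ultimately have "dim (range (lay \<sigma> k)) = card ?B"
    by (metis basis_card_eq_dim)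
  also have "\<dots> = block_dim \<sigma> k"
    unfolding block_dim_def by (rule card_image) (auto simp: inj_on_def axis_eq_axis)
  finally show ?thesis .
qed

section \<open>Left invariant fields and their commutators\<close>

context homogeneous_group
begin

lemma smooth_lf: "smooth_on UNIV (left_field v)"
  unfolding left_field_def
  by (rule smooth_on_linear_right[OF _ smooth_on_derivative[OF smooth_M], of "\<lambda>\<xi>. (\<xi>, 0)"])
    (intro bounded_linear_Pair bounded_linear_ident bounded_linear_zero)

lemma mul_has_derivative: "(mul a has_derivative (\<lambda>h. DM (a, \<xi>) (0, h))) (at \<xi>)"
proof -
  have "((\<lambda>y. M (a, y)) has_derivative (\<lambda>h. DM (a, \<xi>) (0, h))) (at \<xi>)"
    by (rule has_derivative_compose[OF _ M_has_derivative]) (auto intro!: derivative_eq_intros)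
  then show ?thesis
    by simp
qed

lemma frechet_mul: "frechet_derivative (mul a) (at \<xi>) h = DM (a, \<xi>) (0, h)"
  using frechet_derivative_eqI[OF mul_has_derivative] by simp

text \<open>Differentiate the associative law
  \<open>mul a (mul \<xi> y) = mul (mul a \<xi>) y\<close> in \<open>y\<close> at 0.\<close>

lemma left_field_left_invariant: "left_field v \<in> left_invariant_fields mul"
proof -
  have "left_field v (mul a \<xi>) = frechet_derivative (mul a) (at \<xi>) (left_field v \<xi>)" for a \<xi>
  proof -
    have "((\<lambda>y. mul a (mul \<xi> y)) has_derivative (\<lambda>h. DM (a, mul \<xi> 0) (0, DM (\<xi>, 0) (0, h)))) (at 0)"
      by (rule has_derivative_compose[OF mul_has_derivative mul_has_derivative])
    moreover have "mul a (mul \<xi> y) = mul (mul a \<xi>) y" for y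
      by (simp add: assoc)
    ultimately have "(mul (mul a \<xi>) has_derivative (\<lambda>h. DM (a, mul \<xi> 0) (0, DM (\<xi>, 0) (0, h)))) (at 0)"
      by simp
    with mul_has_derivative[of "mul a \<xi>" 0]
    have "(\<lambda>h. DM (mul a \<xi>, 0) (0, h)) = (\<lambda>h. DM (a, mul \<xi> 0) (0, DM (\<xi>, 0) (0, h)))"
      by (rule has_derivative_unique)
    from fun_cong[OF this, of v] show ?thesis
      by (simp add: left_field_def frechet_mul)
  qed
  then show ?thesis
    by (simp add: left_invariant_fields_def smooth_lf)
qed

lemma left_field_0 [simp]: "left_field v 0 = v"
  using DM_origin(1)[of 0 v] by (simp add: left_field_def)

lemma left_invariant_eq_lf:
  assumes "X \<in> left_invariant_fields mul"
  shows "X = left_field (X 0)"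
proof
  fix \<xi>
  have "X (mul \<xi> 0) = frechet_derivative (mul \<xi>) (at 0) (X 0)"
    using assms unfolding left_invariant_fields_def by blast
  then show "X \<xi> = left_field (X 0) \<xi>"
    by (simp add: frechet_mul left_field_def)
qed

definition mixed :: "'n \<Rightarrow> real^'n \<Rightarrow> real^'n \<Rightarrow> real" where
  "mixed j v w = frechet_derivative (\<lambda>z. DP j z (0, w)) (at 0) (v, 0)"

lemma left_field_derivative_nth: "frechet_derivative (left_field w) (at 0) v $ j = mixed j v w"
proof -
  have "((\<lambda>\<xi>. left_field w \<xi> $ j) has_derivative (\<lambda>h. frechet_derivative (left_field w) (at 0) h $ j)) (at 0)"
    by (rule bounded_linear.has_derivative[OF bounded_linear_vec_nth smooth_on_has_derivative[OF smooth_lf]])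
  moreover have "((\<lambda>\<xi>. DP j (\<xi>, 0) (0, w)) has_derivative
      (\<lambda>h. frechet_derivative (\<lambda>z. DP j z (0, w)) (at (0, 0)) (h, 0))) (at 0)"
    by (rule has_derivative_compose[of "\<lambda>\<xi>. (\<xi>, 0)", OF _ smooth_on_has_derivative[OF smooth_on_derivative[OF smooth_P]]])
      (auto intro!: derivative_eq_intros)
  then have "((\<lambda>\<xi>. w $ j + DP j (\<xi>, 0) (0, w)) has_derivative (\<lambda>h. 0 + mixed j h w)) (at 0)"
    unfolding mixed_def zero_prod_def by (intro derivative_intros)
  then have "((\<lambda>\<xi>. left_field w \<xi> $ j) has_derivative (\<lambda>h. mixed j h w)) (at 0)"
    by (simp add: left_field_def DM_nth)
  ultimately have "(\<lambda>h. frechet_derivative (left_field w) (at 0) h $ j) = (\<lambda>h. mixed j h w)"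
    by (rule has_derivative_unique)
  then show ?thesis
    by (rule fun_cong)
qed

lemma commutator_lf_0: "commutator (left_field v) (left_field w) 0 $ j = mixed j v w - mixed j w v"
  by (simp add: commutator_def left_field_derivative_nth)

lemma mixed_eq:
  assumes "\<And>s \<tau>. P j (s *\<^sub>R v, \<tau> *\<^sub>R w) = s * \<tau> * P j (v, w)"
  shows "mixed j v w = P j (v, w)"
  unfolding mixed_def by (rule mixed_derivative_bilinear[OF smooth_P assms])

text \<open>On the plane spanned by \<open>v\<close> and \<open>w\<close> the correction
  \<open>P j\<close> vanishes for weight at most \<open>k\<close> and is bilinear for weight
  \<open>k + 1\<close>. Its mixed derivative at 0 is therefore its value at \<open>(v, w)\<close>,
  in either order of the arguments.\<close>

lemma commutator_lf:
  assumes w: "w \<in> flt \<sigma> k"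
  shows commutator_lf_flt: "commutator (left_field v) (left_field w) 0 \<in> flt \<sigma> (Suc k)"
    and commutator_lf_lay: "lay \<sigma> (Suc k) (commutator (left_field v) (left_field w) 0) = bracket k v w"
proof -
  have ws: "s *\<^sub>R w \<in> flt \<sigma> k" for s
    by (rule subspace_scale[OF subspace_flt w])
  have low: "P j (x, s *\<^sub>R w) = 0 \<and> P j (s *\<^sub>R w, x) = 0" if "\<sigma> j \<le> k" for j x s
    using mul_nth_flt[OF ws[of s] that, of x] by (simp add: mul_nth)
  have "commutator (left_field v) (left_field w) 0 $ j = 0" if "\<sigma> j \<le> k" for j
  proof -
    have z: "P j (x, s *\<^sub>R w) = 0" "P j (s *\<^sub>R w, x) = 0" "P j (x, w) = 0" "P j (w, x) = 0" for x s
      using low[OF that, of x s] low[OF that, of x 1] by simp_all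
    have "mixed j v w = P j (v, w)" "mixed j w v = P j (w, v)"
      by (rule mixed_eq, simp add: z)+
    then show ?thesis
      by (simp add: commutator_lf_0 z)
  qed
  then show "commutator (left_field v) (left_field w) 0 \<in> flt \<sigma> (Suc k)"
    by (simp add: flt_def)
  have "commutator (left_field v) (left_field w) 0 $ j = P j (v, w) - P j (w, v)" if j: "\<sigma> j = Suc k" for j
  proof -
    obtain \<beta> where \<beta>: "\<And>x y. y \<in> flt \<sigma> k \<Longrightarrow> P j (x, y) = \<beta> x y"
      "\<And>y. linear (\<lambda>x. \<beta> x y)" "\<And>x. linear (\<beta> x)"
      "\<And>x y. y \<in> flt \<sigma> k \<Longrightarrow> \<beta> x y = \<beta> (lay \<sigma> 1 x) (lay \<sigma> k y)"
      using bilinear_P[OF j] by blast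
    have 1: "mixed j v w = P j (v, w)"
      by (rule mixed_eq) (simp add: \<beta>(1)[OF w] \<beta>(1)[OF ws] linear_scale[OF \<beta>(2)] linear_scale[OF \<beta>(3)])
    obtain \<gamma> where \<gamma>: "\<And>x y. y \<in> flt \<sigma> k \<Longrightarrow> P j (y, x) = \<gamma> x y"
      "\<And>y. linear (\<lambda>x. \<gamma> x y)" "\<And>x. linear (\<gamma> x)"
      "\<And>x y. y \<in> flt \<sigma> k \<Longrightarrow> \<gamma> x y = \<gamma> (lay \<sigma> 1 x) (lay \<sigma> k y)"
      using bilinear_P_swap[OF j] by blast
    have 2: "mixed j w v = P j (w, v)"
      by (rule mixed_eq) (simp add: \<gamma>(1)[OF w] \<gamma>(1)[OF ws] linear_scale[OF \<gamma>(2)] linear_scale[OF \<gamma>(3)])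
    from 1 2 show ?thesis
      by (simp add: commutator_lf_0)
  qed
  then show "lay \<sigma> (Suc k) (commutator (left_field v) (left_field w) 0) = bracket k v w"
    by (simp add: vec_eq_iff bracket_def)
qed

end

lemma linear_eval: "linear (\<lambda>X. X x :: 'b::real_vector)"
  by (rule linearI) (simp_all add: scaleR_fun_def)

section \<open>The layers seen at the origin\<close>

context carnot_group
begin

text \<open>A left invariant field is determined by its value at 0, so this transports the layers to
  subspaces of the coordinate space without losing dimension.\<close>

definition E :: "nat \<Rightarrow> (real^'n) set" where
  "E k = (\<lambda>X. X 0) ` V k"

lemma V_eq_lf: "k \<in> {1..r} \<Longrightarrow> X \<in> V k \<Longrightarrow> X = left_field (X 0)"
  using layer_subset left_invariant_eq_lf by blast

lemma subspace_E: "k \<in> {1..r} \<Longrightarrow> subspace (E k)"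
  unfolding E_def by (rule linear_subspace_image[OF linear_eval layer_subspace])

lemma dim_E: "k \<in> {1..r} \<Longrightarrow> dim (E k) = block_dim \<sigma> k"
  unfolding E_def
  by (subst dim_linear_inj_image[OF linear_eval layer_subspace]) (auto intro!: inj_onI simp: layer_dim, metis V_eq_lf atLeastAtMost_iff One_nat_def)

lemma E_Suc:
  assumes "1 \<le> k" "k < r"
  shows "E (Suc k) = span {commutator (left_field v) (left_field w) 0 | v w. v \<in> E 1 \<and> w \<in> E k}"
proof -
  have k: "1 \<in> {1..r}" "k \<in> {1..r}"
    using assms by auto
  have "V (Suc k) = span {commutator X Y | X Y. X \<in> V 1 \<and> Y \<in> V k}"
    using layer_commutator[of k] assms by (simp add: commutator_space_def)
  then have "E (Suc k) = span ((\<lambda>X. X 0) ` {commutator X Y | X Y. X \<in> V 1 \<and> Y \<in> V k})"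
    unfolding E_def by (simp add: linear_span_image[OF linear_eval])
  also have "(\<lambda>X. X 0) ` {commutator X Y | X Y. X \<in> V 1 \<and> Y \<in> V k}
      = {commutator X Y 0 | X Y. X \<in> V 1 \<and> Y \<in> V k}"
    by blast
  also have "\<dots> = {commutator (left_field v) (left_field w) 0 | v w. v \<in> E 1 \<and> w \<in> E k}"
  proof (intro subset_antisym subsetI)
    fix x
    assume "x \<in> {commutator X Y 0 | X Y. X \<in> V 1 \<and> Y \<in> V k}"
    then obtain X Y where XY: "X \<in> V 1" "Y \<in> V k" "x = commutator X Y 0"
      by blast
    then have "x = commutator (left_field (X 0)) (left_field (Y 0)) 0" "X 0 \<in> E 1" "Y 0 \<in> E k"
      using V_eq_lf[OF k(1) XY(1)] V_eq_lf[OF k(2) XY(2)] by (auto simp: E_def)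
    then show "x \<in> {commutator (left_field v) (left_field w) 0 | v w. v \<in> E 1 \<and> w \<in> E k}"
      by blast
  next
    fix x
    assume "x \<in> {commutator (left_field v) (left_field w) 0 | v w. v \<in> E 1 \<and> w \<in> E k}"
    then obtain X Y where "X \<in> V 1" "Y \<in> V k" "x = commutator (left_field (X 0)) (left_field (Y 0)) 0"
      by (auto simp: E_def)
    then show "x \<in> {commutator X Y 0 | X Y. X \<in> V 1 \<and> Y \<in> V k}"
      using V_eq_lf[OF k(1), of X] V_eq_lf[OF k(2), of Y] by auto
  qed
  finally show ?thesis .
qed

text \<open>All weights are at least 1, and commutators with left invariant fields raise the weight
  filtration by one.\<close>

lemma E_flt: "1 \<le> k \<Longrightarrow> k \<le> r \<Longrightarrow> E k \<subseteq> flt \<sigma> k"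
proof (induction k rule: dec_induct)
  case base
  then show ?case
    using weight_pos leD by (auto simp: flt_def)
next
  case (step k)
  have "{commutator (left_field v) (left_field w) 0 | v w. v \<in> E 1 \<and> w \<in> E k} \<subseteq> flt \<sigma> (Suc k)"
    using step commutator_lf_flt by fastforce
  then show ?case
    using E_Suc[of k] step by (simp add: span_minimal subspace_flt)
qed

lemma E_decomposition: "\<exists>y. (\<forall>m\<in>{1..r}. y m \<in> E m) \<and> v = (\<Sum>m=1..r. y m)"
proof -
  obtain Y where "Y \<in> (\<Pi>\<^sub>E k\<in>{1..r}. V k)" "left_field v = (\<Sum>k=1..r. Y k)"
    using direct_sum[OF left_field_left_invariant[of v]] by blast
  moreover have "(\<Sum>k=1..r. Y k) 0 = (\<Sum>k=1..r. Y k 0)"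
    by (rule linear_sum[OF linear_eval])
  ultimately have "\<forall>m\<in>{1..r}. Y m 0 \<in> E m" "v = (\<Sum>k=1..r. Y k 0)"
    using left_field_0[of v] by (auto simp: E_def)
  then show ?thesis
    by (intro exI[of _ "\<lambda>m. Y m 0"]) simp
qed

lemma lay_flt_Suc: "x \<in> flt \<sigma> l \<Longrightarrow> k < l \<Longrightarrow> lay \<sigma> k x = 0"
  by (auto simp: flt_def vec_eq_iff)

text \<open>The stratification need not be compatible with the dilations, so only \<open>E k \<subseteq> flt \<sigma> k\<close> is
  clear; the equality of the filtrations comes from comparing dimensions layer by layer.\<close>

lemma flt_decomposition:
  "1 \<le> k \<Longrightarrow> k \<le> r \<Longrightarrow> x \<in> flt \<sigma> k \<Longrightarrow> \<exists>y. (\<forall>m\<in>{k..r}. y m \<in> E m) \<and> x = (\<Sum>m=k..r. y m)"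
proof (induction k arbitrary: x rule: dec_induct)
  case base
  then show ?case
    using E_decomposition by blast
next
  case (step k)
  have k: "k \<in> {1..r}"
    using step by auto
  have rest: "(\<Sum>m=Suc k..r. y m) \<in> flt \<sigma> (Suc k)" if "\<forall>m\<in>{k..r}. y m \<in> E m" for y
  proof (rule subspace_sum[OF subspace_flt])
    fix m
    assume "m \<in> {Suc k..r}"
    then have "y m \<in> E m" "E m \<subseteq> flt \<sigma> m" "flt \<sigma> m \<subseteq> flt \<sigma> (Suc k)"
      using that E_flt[of m] flt_antimono[of "Suc k" m \<sigma>] step(1) by auto
    then show "y m \<in> flt \<sigma> (Suc k)"
      by blast
  qed
  have split: "(\<Sum>m=k..r. y m) = y k + (\<Sum>m=Suc k..r. y m)" for y :: "nat \<Rightarrow> real^'n"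
    using step.prems by (simp add: sum.atLeast_Suc_atMost)
  \<comment> \<open>In the decomposition of a vector of weight \<open>k\<close>, the summands from
    later layers have no component of weight \<open>k\<close>. So the projection already maps
    \<open>E k\<close> onto the whole coordinate layer.\<close>
  have "range (lay \<sigma> k) \<subseteq> lay \<sigma> k ` E k"
  proof clarify
    fix x
    obtain y where y: "\<forall>m\<in>{k..r}. y m \<in> E m" "lay \<sigma> k x = (\<Sum>m=k..r. y m)"
      using step.IH[of "lay \<sigma> k x"] step.prems lay_in_flt by auto
    have "lay \<sigma> k x = lay \<sigma> k (lay \<sigma> k x)"
      by (simp add: vec_eq_iff)
    also have "\<dots> = lay \<sigma> k (y k)"
      unfolding y(2) split linear_add[OF linear_lay] using lay_flt_Suc[OF rest[OF y(1)]] by simp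
    finally show "lay \<sigma> k x \<in> lay \<sigma> k ` E k"
      using y(1) step.prems by auto
  qed
  then have "dim (range (lay \<sigma> k)) \<le> dim (lay \<sigma> k ` E k)"
    by (rule dim_subset)
  \<comment> \<open>Source and image have the same dimension, so the projection is injective on
    \<open>E k\<close>. A vector in \<open>flt \<sigma> (Suc k)\<close> therefore has no summand in
    \<open>E k\<close>.\<close>
  then have dim: "dim (E k) \<le> dim (lay \<sigma> k ` E k)"
    by (simp only: dim_range_lay dim_E[OF k])
  have "x \<in> flt \<sigma> k"
    using step.prems flt_antimono[of k "Suc k"] by auto
  then obtain y where y: "\<forall>m\<in>{k..r}. y m \<in> E m" "x = (\<Sum>m=k..r. y m)"
    using step.IH step.prems by auto
  have "lay \<sigma> k x = 0"
    using lay_flt_Suc[of x "Suc k" k] step.prems by simp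
  then have "lay \<sigma> k (y k) = 0"
    unfolding y(2) split linear_add[OF linear_lay] using lay_flt_Suc[OF rest[OF y(1)]] by simp
  moreover have "y k \<in> E k"
    using y(1) step.prems by auto
  ultimately have "y k = 0"
    using linear_inj_on_if_dim_image[OF linear_lay dim subspace_E[OF k]] by blast
  with y split show ?case
    by (intro exI[of _ y]) auto
qed

lemma lay_E:
  assumes "1 \<le> k" "k \<le> r"
  shows "lay \<sigma> k x \<in> lay \<sigma> k ` E k"
proof -
  obtain y where y: "\<forall>m\<in>{k..r}. y m \<in> E m" "lay \<sigma> k x = (\<Sum>m=k..r. y m)"
    using flt_decomposition[OF assms lay_in_flt] by blast
  have "lay \<sigma> k x = lay \<sigma> k (lay \<sigma> k x)"
    by (simp add: vec_eq_iff)
  also have "\<dots> = (\<Sum>m=k..r. lay \<sigma> k (y m))"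
    unfolding y(2) by (rule linear_sum[OF linear_lay])
  also have "\<dots> = lay \<sigma> k (y k)"
  proof -
    have "lay \<sigma> k (y m) = 0" if "m \<in> {Suc k..r}" for m
    proof (rule lay_flt_Suc)
      have "y m \<in> E m"
        using y(1) that by simp
      then show "y m \<in> flt \<sigma> m"
        using E_flt[of m] that assms by auto
    qed (use that in simp)
    then show ?thesis
      using assms by (simp add: sum.atLeast_Suc_atMost)
  qed
  finally show ?thesis
    using y(1) assms by auto
qed

text \<open>An induction principle for leading parts. Bilinearity of the bracket reduces
  \<open>E 1\<close> to the basis fields and \<open>E k\<close> to vectors of pure weight
  \<open>k\<close>, so closure under \<open>bracket\<close> is asked for in these cases
  only.\<close>

lemma layer_generation:
  fixes X :: "'m::finite \<Rightarrow> real^'n \<Rightarrow> real^'n"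
  assumes X: "basis_of X (V 1)" and sub: "\<And>k. subspace (S k)"
    and base: "\<And>i. lay \<sigma> 1 (X i 0) \<in> S 1"
    and bracket: "\<And>i k w. 1 \<le> k \<Longrightarrow> k < r \<Longrightarrow> w \<in> flt \<sigma> k \<Longrightarrow> lay \<sigma> k w = w \<Longrightarrow> w \<in> S k \<Longrightarrow> bracket k (X i 0) w \<in> S (Suc k)"
    and k: "1 \<le> k" "k \<le> r"
  shows "lay \<sigma> k x \<in> S k"
  using k
proof (induction k arbitrary: x rule: dec_induct)
  have E1: "E 1 = span (range (\<lambda>i. X i 0))"
  proof -
    have "V 1 = span (range X)"
      using X by (simp add: basis_of_def)
    then have "E 1 = span ((\<lambda>Y. Y 0) ` range X)"
      unfolding E_def by (simp add: linear_span_image[OF linear_eval])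
    then show ?thesis
      by (simp add: image_image)
  qed
  {
    case base
    then obtain v where "v \<in> E 1" "lay \<sigma> 1 x = lay \<sigma> 1 v"
      using lay_E[of 1 x] by auto
    moreover have "lay \<sigma> 1 ` span (range (\<lambda>i. X i 0)) \<subseteq> S 1"
      unfolding linear_span_image[OF linear_lay, symmetric]
      by (rule span_minimal[OF _ sub]) (use assms(3) in auto)
    ultimately show ?case
      unfolding E1 by auto
  next
    case (step k)
    have "bracket k v w \<in> S (Suc k)" if "v \<in> E 1" "w \<in> E k" for v w
    proof -
      have w: "w \<in> flt \<sigma> k"
        using E_flt[of k] step that by auto
      have "(\<lambda>v. bracket k v (lay \<sigma> k w)) ` span (range (\<lambda>i. X i 0)) \<subseteq> S (Suc k)"
        unfolding linear_span_image[OF bracket_linear_left[OF lay_in_flt], symmetric]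
      proof (rule span_minimal[OF _ sub], clarify)
        fix i
        show "bracket k (X i 0) (lay \<sigma> k w) \<in> S (Suc k)"
          by (rule bracket) (use step in \<open>auto simp: lay_in_flt vec_eq_iff\<close>)
      qed
      then have "bracket k v (lay \<sigma> k w) \<in> S (Suc k)"
        using that(1) E1 by blast
      moreover have "bracket k v (lay \<sigma> k w) = bracket k v w"
        using bracket_lay[OF w, of v] bracket_lay[OF lay_in_flt, of k v w] by simp
      ultimately show ?thesis
        by simp
    qed
    then have "lay \<sigma> (Suc k) ` {commutator (left_field v) (left_field w) 0 | v w. v \<in> E 1 \<and> w \<in> E k} \<subseteq> S (Suc k)"
      using E_flt[of k] step commutator_lf_lay[of _ k] by auto
    then have "lay \<sigma> (Suc k) ` E (Suc k) \<subseteq> S (Suc k)"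
      using E_Suc[of k] step
      by (simp add: linear_span_image[OF linear_lay, symmetric] span_minimal sub)
    then show ?case
      using lay_E[of "Suc k" x] step by auto
  }
qed

end

section \<open>Horizontal flow lines and translations\<close>

text \<open>Functions of class C^1 with bounded support. \<open>cutoff\<close> is only C^1, so
  truncations stay in this class but in general leave that of the test functions.\<close>

definition C1c :: "('a::euclidean_space \<Rightarrow> real) \<Rightarrow> bool" where
  "C1c f \<longleftrightarrow> Ck_on 1 UNIV f \<and> (\<exists>R. \<forall>x. R < norm x \<longrightarrow> f x = 0)"

lemma C1c_has_derivative: "C1c f \<Longrightarrow> (f has_derivative frechet_derivative f (at x)) (at x)"
  by (simp add: C1c_def frechet_derivative_works)

lemma C1c_continuous: "C1c f \<Longrightarrow> continuous_on S f"
  by (rule continuous_at_imp_continuous_on) (auto intro: has_derivative_continuous C1c_has_derivative)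

lemma C1c_continuous_derivative:
  assumes f: "C1c f" and g: "continuous_on S g" and h: "continuous_on S h"
  shows "continuous_on S (\<lambda>x. frechet_derivative f (at (g x)) (h x))"
  unfolding continuous_on_def
proof
  fix x
  assume x: "x \<in> S"
  have "continuous_on UNIV (\<lambda>x. frechet_derivative f (at x) h)" for h
    using f by (simp add: C1c_def)
  from derivative_tendsto[where f'="\<lambda>x. frechet_derivative f (at x)",
      OF has_derivative_linear[OF C1c_has_derivative[OF f]] this
        g[unfolded continuous_on_def, rule_format, OF x] h[unfolded continuous_on_def, rule_format, OF x]]
  show "((\<lambda>x. frechet_derivative f (at (g x)) (h x)) \<longlongrightarrow> frechet_derivative f (at (g x)) (h x)) (at x within S)" .
qed

lemma C1c_derivative_eq_0:
  assumes f: "C1c f" and R: "\<And>x. R < norm x \<Longrightarrow> f x = 0" and x: "R < norm x"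
  shows "frechet_derivative f (at x) h = 0"
proof -
  have "open {x. R < norm x}"
    by (intro open_Collect_less continuous_intros)
  then have "((\<lambda>x. 0) has_derivative frechet_derivative f (at x)) (at x)"
    by (rule has_derivative_transform_within_open[OF C1c_has_derivative[OF f]]) (use R x in auto)
  then have "frechet_derivative f (at x) = (\<lambda>h. 0)"
    using has_derivative_unique[OF _ has_derivative_const] by blast
  then show ?thesis
    by simp
qed

lemma integrable_continuous_bounded_support:
  fixes g :: "'a::euclidean_space \<Rightarrow> real"
  assumes "continuous_on UNIV g" "\<And>x. R < norm x \<Longrightarrow> g x = 0"
  shows "integrable lborel g"
proof -
  have "integrable lborel (\<lambda>x. indicator (cball 0 R) x *\<^sub>R g x)"
    by (rule borel_integrable_compact) (auto intro: continuous_on_subset[OF assms(1)])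
  also have "(\<lambda>x. indicator (cball 0 R) x *\<^sub>R g x) = g"
    using assms(2) by (auto simp: indicator_def fun_eq_iff)
  finally show ?thesis .
qed

lemma square_increment_le_nn_integral:
  fixes \<phi> g :: "real \<Rightarrow> real"
  assumes s: "0 \<le> s" and d: "\<And>t. (\<phi> has_real_derivative g t) (at t)" and cont: "continuous_on UNIV g"
  shows "ennreal ((\<phi> s - \<phi> 0)\<^sup>2) \<le> ennreal s * (\<integral>\<^sup>+t. ennreal ((g t)\<^sup>2) * indicator {0..s} t \<partial>lborel)"
proof (cases "s = 0")
  case False
  with s have s: "s > 0"
    by simp
  \<comment> \<open>The mean slope. Integrating the nonnegative square of \<open>g t - c\<close>
    gives Cauchy-Schwarz against the constant function.\<close>
  define c where "c = (\<phi> s - \<phi> 0) / s"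
  have cont': "continuous_on {0..s} g" "continuous_on {0..s} (\<lambda>t. (g t)\<^sup>2)"
    using cont by (auto intro!: continuous_intros intro: continuous_on_subset)
  have g: "(g has_integral \<phi> s - \<phi> 0) {0..s}"
    using s d by (intro fundamental_theorem_of_calculus)
      (auto simp flip: has_real_derivative_iff_has_vector_derivative intro: has_field_derivative_at_within)
  have g2: "(\<lambda>t. (g t)\<^sup>2) integrable_on {0..s}"
    by (intro integrable_continuous_interval cont')
  let ?I = "integral {0..s} (\<lambda>t. (g t)\<^sup>2)"
  have "((\<lambda>t. (g t)\<^sup>2 - 2 * c * g t + c\<^sup>2) has_integral ?I - 2 * c * (\<phi> s - \<phi> 0) + c\<^sup>2 * s) {0..s}"
    using has_integral_add[OF has_integral_diff[OF integrable_integral[OF g2] has_integral_mult_right[OF g, of "2 * c"]]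
        has_integral_const_real[of "c\<^sup>2" 0 s]] s by (simp add: mult.commute)
  then have "0 \<le> ?I - 2 * c * (\<phi> s - \<phi> 0) + c\<^sup>2 * s"
  proof (rule has_integral_nonneg)
    fix t
    have "(g t)\<^sup>2 - 2 * c * g t + c\<^sup>2 = (g t - c)\<^sup>2"
      by (simp add: power2_eq_square algebra_simps)
    then show "0 \<le> (g t)\<^sup>2 - 2 * c * g t + c\<^sup>2"
      by simp
  qed
  also have "?I - 2 * c * (\<phi> s - \<phi> 0) + c\<^sup>2 * s = ?I - (\<phi> s - \<phi> 0)\<^sup>2 / s"
    using s by (simp add: c_def power2_eq_square field_simps)
  finally have le: "(\<phi> s - \<phi> 0)\<^sup>2 \<le> s * ?I"
    using s by (simp add: field_simps)
  have "(\<integral>\<^sup>+t. ennreal ((g t)\<^sup>2) * indicator {0..s} t \<partial>lborel) = ennreal ?I"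
    by (rule nn_integral_has_integral_lebesgue'[OF _ integrable_integral[OF g2]]) simp
  then show ?thesis
    using le s by (simp add: ennreal_mult'[symmetric] ennreal_leI)
qed simp

context homogeneous_group
begin

lemma left_field_nth_cong:
  assumes "\<And>i. \<sigma> i < \<sigma> j \<Longrightarrow> x $ i = y $ i"
  shows "left_field v x $ j = left_field v y $ j"
  using DP_cong[of j x y 0 0] assms by (simp add: left_field_def DM_nth)

lemma left_field_mul: "left_field v (mul x y) = DM (x, y) (0, left_field v y)"
  using left_field_left_invariant[of v] by (simp add: left_invariant_fields_def frechet_mul)

lemma left_field_uminus: "left_field (- v) x = - left_field v x"
  using linear_neg[OF linear_DM, of "(x, 0)" "(0, v)"] by (simp add: left_field_def)

lemma continuous_lf: "continuous_on UNIV (left_field v)"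
  by (rule smooth_on_continuous[OF smooth_lf])

text \<open>Only the integral curve through the unit is needed: by left invariance
  \<open>mul x (\<gamma> s)\<close> is the one through \<open>x\<close>, so flowing for time
  \<open>s\<close> is right translation by \<open>\<gamma> s\<close>.\<close>

definition flow_line :: "real^'n \<Rightarrow> (real \<Rightarrow> real^'n) \<Rightarrow> bool" where
  "flow_line v \<gamma> \<longleftrightarrow> \<gamma> 0 = 0 \<and> (\<forall>s. (\<gamma> has_vector_derivative left_field v (\<gamma> s)) (at s))"

text \<open>Since the coefficient of \<open>left_field v\<close> of index \<open>j\<close> depends only on the coordinates of smaller
  weight, the Picard iteration becomes stationary after \<open>r\<close> steps.\<close>

lemma flow_line_exists: "\<exists>\<gamma>. flow_line v \<gamma>"
proof -
  have "\<exists>\<gamma>. \<gamma> 0 = 0 \<and> continuous_on UNIV \<gamma> \<and>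
      (\<forall>j s. \<sigma> j \<le> m \<longrightarrow> ((\<lambda>s. \<gamma> s $ j) has_real_derivative left_field v (\<gamma> s) $ j) (at s))" for m
  proof (induction m)
    case 0
    have nz: "\<sigma> j \<noteq> 0" for j
      using weight_pos[of j] by simp
    show ?case
      by (intro exI[of _ "\<lambda>_. 0"] conjI allI impI) (auto intro: continuous_on_const simp: nz)
  next
    case (Suc m)
    then obtain \<gamma> where \<gamma>: "\<gamma> 0 = 0" "continuous_on UNIV \<gamma>"
      "\<And>j s. \<sigma> j \<le> m \<Longrightarrow> ((\<lambda>s. \<gamma> s $ j) has_real_derivative left_field v (\<gamma> s) $ j) (at s)"
      by blast
    have "isCont (\<lambda>s. left_field v (\<gamma> s)) s" for s
      using continuous_on_compose2[OF continuous_lf \<gamma>(2)] by (simp add: continuous_on_eq_continuous_at)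
    then obtain F where F: "\<And>s. (F has_vector_derivative left_field v (\<gamma> s)) (at s)"
      using einterval_antiderivative[of "-\<infinity>" "\<infinity>" "\<lambda>s. left_field v (\<gamma> s)"] by auto
    define \<delta> where "\<delta> = (\<lambda>s. F s - F 0)"
    have \<delta>: "(\<delta> has_vector_derivative left_field v (\<gamma> s)) (at s)" for s
      unfolding \<delta>_def using F[of s] by (auto intro!: derivative_eq_intros)
    have \<delta>j: "((\<lambda>s. \<delta> s $ j) has_real_derivative left_field v (\<gamma> s) $ j) (at s)" for s j
      using bounded_linear.has_vector_derivative[OF bounded_linear_vec_nth \<delta>[of s]]
      by (simp add: has_real_derivative_iff_has_vector_derivative)
    \<comment> \<open>Integrating once more changes no coordinate of weight at most
      \<open>m\<close>, so the coefficients of weight at most \<open>Suc m\<close> do not notice the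
      replacement of \<open>\<gamma>\<close> by \<open>\<delta>\<close>.\<close>
    have eq: "\<delta> s $ j = \<gamma> s $ j" if "\<sigma> j \<le> m" for s j
    proof -
      have "((\<lambda>s. \<delta> s $ j - \<gamma> s $ j) has_real_derivative 0) (at s)" for s
        using DERIV_diff[OF \<delta>j[of j s] \<gamma>(3)[OF that, of s]] by simp
      then have "\<delta> s $ j - \<gamma> s $ j = \<delta> 0 $ j - \<gamma> 0 $ j"
        by (intro DERIV_isconst_all) auto
      then show ?thesis
        using \<gamma>(1) by (simp add: \<delta>_def)
    qed
    have "left_field v (\<delta> s) $ j = left_field v (\<gamma> s) $ j" if "\<sigma> j \<le> Suc m" for s j
      by (rule left_field_nth_cong) (use that eq in auto)
    moreover have "continuous_on UNIV \<delta>"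
      using \<delta> by (meson continuous_at_imp_continuous_on has_vector_derivative_continuous)
    ultimately show ?case
      using \<delta>j by (intro exI[of _ \<delta>]) (simp add: \<delta>_def)
  qed
  from this[of r] obtain \<gamma> where "\<gamma> 0 = 0"
    "\<And>j s. ((\<lambda>s. \<gamma> s $ j) has_real_derivative left_field v (\<gamma> s) $ j) (at s)"
    using degrees by auto
  then have "flow_line v \<gamma>"
    unfolding flow_line_def has_real_derivative_iff_has_vector_derivative has_vector_derivative_def
    by (subst has_derivative_componentwise_within) (auto simp: Basis_vec_def inner_axis)
  then show ?thesis
    by blast
qed

lemma flow_line_continuous: "flow_line v \<gamma> \<Longrightarrow> continuous_on S \<gamma>"
  unfolding flow_line_def by (meson continuous_at_imp_continuous_on has_vector_derivative_continuous)

text \<open>A coefficient of weight 1 depends on no coordinate at all, hence is constant.\<close>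

lemma flow_line_lay:
  assumes "flow_line v \<gamma>"
  shows "lay \<sigma> 1 (\<gamma> s) = s *\<^sub>R lay \<sigma> 1 v"
proof -
  have "\<gamma> s $ j = s * v $ j" if "\<sigma> j = 1" for j
  proof -
    have "left_field v x $ j = v $ j" for x
      using left_field_nth_cong[of j x 0 v] that weight_pos leD by auto
    then have "((\<lambda>s. \<gamma> s $ j) has_real_derivative v $ j) (at s)" for s
      using assms bounded_linear.has_vector_derivative[OF bounded_linear_vec_nth, of \<gamma> "left_field v (\<gamma> s)" "at s" j]
      by (simp add: flow_line_def has_real_derivative_iff_has_vector_derivative)
    then have "((\<lambda>s. \<gamma> s $ j - s * v $ j) has_real_derivative 0) (at s)" for s
      by (auto intro!: derivative_eq_intros)
    then have "\<gamma> s $ j - s * v $ j = \<gamma> 0 $ j - 0 * v $ j"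
      by (intro DERIV_isconst_all) auto
    then show ?thesis
      using assms by (simp add: flow_line_def)
  qed
  then show ?thesis
    by (simp add: vec_eq_iff)
qed

lemma flow_line_reverse:
  assumes "flow_line v \<gamma>"
  shows "flow_line (- v) (\<lambda>s. \<gamma> (- s))"
proof -
  have "((\<lambda>s. \<gamma> (- s)) has_vector_derivative (- 1) *\<^sub>R left_field v (\<gamma> (- s))) (at s)" for s
    by (rule vector_diff_chain_at[of uminus "- 1" s \<gamma>, unfolded o_def])
      (use assms in \<open>auto simp: flow_line_def intro!: derivative_eq_intros\<close>)
  then show ?thesis
    using assms by (simp add: flow_line_def left_field_uminus)
qed

lemma flow_line_increment:
  assumes "flow_line v \<gamma>" and f: "C1c f"
  shows "((\<lambda>s. f (mul x (\<gamma> s))) has_real_derivative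
    frechet_derivative f (at (mul x (\<gamma> s))) (left_field v (mul x (\<gamma> s)))) (at s)"
proof -
  have "(\<gamma> has_derivative (\<lambda>h. h *\<^sub>R left_field v (\<gamma> s))) (at s)"
    using assms(1) by (simp add: flow_line_def has_vector_derivative_def)
  from has_derivative_compose[OF has_derivative_compose[OF this mul_has_derivative[of x]] C1c_has_derivative[OF f]]
  have "((\<lambda>s. f (mul x (\<gamma> s))) has_derivative
      (\<lambda>h. frechet_derivative f (at (mul x (\<gamma> s))) (DM (x, \<gamma> s) (0, h *\<^sub>R left_field v (\<gamma> s))))) (at s)" .
  moreover have "DM (x, \<gamma> s) (0, h *\<^sub>R left_field v (\<gamma> s)) = h *\<^sub>R left_field v (mul x (\<gamma> s))" for h
    using linear_scale[OF linear_DM, of "(x, \<gamma> s)" h "(0, left_field v (\<gamma> s))"] by (simp add: left_field_mul)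
  ultimately show ?thesis
    using has_derivative_linear[OF C1c_has_derivative[OF f]]
    by (simp add: has_field_derivative_def linear_scale mult_commute_abs)
qed

lemma distr_right_translate: "distr lborel borel (\<lambda>x. mul x h) = lborel"
proof (rule measure_eqI)
  fix A
  assume "A \<in> sets (distr lborel borel (\<lambda>x. mul x h))"
  then have [measurable]: "A \<in> sets borel"
    by simp
  have "emeasure (distr lborel borel (\<lambda>x. mul x h)) A = (\<integral>\<^sup>+x. indicator A x \<partial>distr lborel borel (\<lambda>x. mul x h))"
    by simp
  also have "\<dots> = (\<integral>\<^sup>+x. indicator A (mul x h) \<partial>lborel)"
    by (rule nn_integral_distr) measurable
  also have "\<dots> = emeasure lborel A"
    by (subst nn_integral_right_translate[of "indicator A"]) simp_all
  finally show "emeasure (distr lborel borel (\<lambda>x. mul x h)) A = emeasure lborel A" .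
qed simp

lemma integral_right_translate:
  fixes f :: "real^'n \<Rightarrow> real"
  assumes [measurable]: "f \<in> borel_measurable borel"
  shows "(\<integral>x. f (mul x h) \<partial>lborel) = (\<integral>x. f x \<partial>lborel)"
proof -
  have "(\<integral>x. f x \<partial>distr lborel borel (\<lambda>x. mul x h)) = (\<integral>x. f (mul x h) \<partial>lborel)"
    by (rule integral_distr) measurable
  then show ?thesis
    by (simp add: distr_right_translate)
qed

lemma integrable_right_translate:
  fixes f :: "real^'n \<Rightarrow> real"
  assumes f: "integrable lborel f"
  shows "integrable lborel (\<lambda>x. f (mul x h))"
proof -
  have [measurable]: "f \<in> borel_measurable borel"
    using f by auto
  have "integrable (distr lborel borel (\<lambda>x. mul x h)) f = integrable lborel (\<lambda>x. f (mul x h))"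
    by (rule integrable_distr_eq) measurable
  with f show ?thesis
    by (simp add: distr_right_translate)
qed

text \<open>Cauchy-Schwarz along the flow line gives one factor \<open>s\<close>. The second comes
  from Tonelli: right translation by \<open>\<gamma> t\<close> preserves the measure, so every time
  \<open>t\<close> contributes the same integral.\<close>

lemma flow_line_L2_nonneg:
  assumes \<gamma>: "flow_line v \<gamma>" and f: "C1c f" and s: "0 \<le> s"
  shows "(\<integral>\<^sup>+x. ennreal ((f (mul x (\<gamma> s)) - f x)\<^sup>2) \<partial>lborel)
    \<le> ennreal (s\<^sup>2) * (\<integral>\<^sup>+x. ennreal ((frechet_derivative f (at x) (left_field v x))\<^sup>2) \<partial>lborel)"
proof -
  define g where "g = (\<lambda>x. frechet_derivative f (at x) (left_field v x))"
  have g: "continuous_on S g" for S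
    unfolding g_def using continuous_lf
    by (intro C1c_continuous_derivative[OF f]) (auto intro: continuous_on_id continuous_on_subset)
  have [measurable]: "g \<in> borel_measurable borel" "\<gamma> \<in> borel_measurable borel"
    using g flow_line_continuous[OF \<gamma>] by (auto intro: borel_measurable_continuous_onI)
  have "(\<integral>\<^sup>+x. ennreal ((f (mul x (\<gamma> s)) - f x)\<^sup>2) \<partial>lborel)
      \<le> (\<integral>\<^sup>+x. ennreal s * (\<integral>\<^sup>+t. ennreal ((g (mul x (\<gamma> t)))\<^sup>2) * indicator {0..s} t \<partial>lborel) \<partial>lborel)"
  proof (rule nn_integral_mono)
    fix x
    have "continuous_on UNIV (\<lambda>t. g (mul x (\<gamma> t)))"
      by (rule continuous_on_compose2[OF g]) (auto intro!: continuous_mul flow_line_continuous[OF \<gamma>] continuous_on_const)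
    then show "ennreal ((f (mul x (\<gamma> s)) - f x)\<^sup>2)
      \<le> ennreal s * (\<integral>\<^sup>+t. ennreal ((g (mul x (\<gamma> t)))\<^sup>2) * indicator {0..s} t \<partial>lborel)"
      using square_increment_le_nn_integral[OF s flow_line_increment[OF \<gamma> f], of x] \<gamma>
      by (simp add: g_def flow_line_def)
  qed
  also have "\<dots> = ennreal s * (\<integral>\<^sup>+x. (\<integral>\<^sup>+t. ennreal ((g (mul x (\<gamma> t)))\<^sup>2) * indicator {0..s} t \<partial>lborel) \<partial>lborel)"
    by (rule nn_integral_cmult) measurable
  also have "(\<integral>\<^sup>+x. (\<integral>\<^sup>+t. ennreal ((g (mul x (\<gamma> t)))\<^sup>2) * indicator {0..s} t \<partial>lborel) \<partial>lborel)
      = (\<integral>\<^sup>+t. (\<integral>\<^sup>+x. ennreal ((g (mul x (\<gamma> t)))\<^sup>2) * indicator {0..s} t \<partial>lborel) \<partial>lborel)"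
    by (rule lborel_pair.Fubini'[symmetric]) measurable
  also have "\<dots> = (\<integral>\<^sup>+t. (\<integral>\<^sup>+x. ennreal ((g x)\<^sup>2) \<partial>lborel) * indicator {0..s} t \<partial>lborel)"
    by (intro nn_integral_cong, subst nn_integral_multc)
      (simp_all add: nn_integral_right_translate[of "\<lambda>x. ennreal ((g x)\<^sup>2)"])
  also have "\<dots> = (\<integral>\<^sup>+x. ennreal ((g x)\<^sup>2) \<partial>lborel) * ennreal s"
    by (subst nn_integral_cmult) (simp_all add: s)
  finally show ?thesis
    using s by (simp add: g_def power2_eq_square ennreal_mult' mult_ac)
qed

lemma flow_line_L2:
  assumes \<gamma>: "flow_line v \<gamma>" and f: "C1c f"
  shows "(\<integral>\<^sup>+x. ennreal ((f (mul x (\<gamma> s)) - f x)\<^sup>2) \<partial>lborel)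
    \<le> ennreal (s\<^sup>2) * (\<integral>\<^sup>+x. ennreal ((frechet_derivative f (at x) (left_field v x))\<^sup>2) \<partial>lborel)"
proof (cases "0 \<le> s")
  case False
  have "frechet_derivative f (at x) (- h) = - frechet_derivative f (at x) h" for x h
    using linear_neg[OF has_derivative_linear[OF C1c_has_derivative[OF f]]] .
  with flow_line_L2_nonneg[OF flow_line_reverse[OF \<gamma>] f, of "- s"] False show ?thesis
    by (simp add: left_field_uminus)
qed (rule flow_line_L2_nonneg[OF assms])

text \<open>The divergence of a left invariant field vanishes because right translations preserve
  Lebesgue measure.\<close>

lemma integral_lf_derivative_eq_0:
  assumes f: "C1c f"
  shows "(\<integral>x. frechet_derivative f (at x) (left_field v x) \<partial>lborel) = 0"
proof -
  obtain \<gamma> where \<gamma>: "flow_line v \<gamma>"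
    using flow_line_exists by blast
  obtain R where R: "\<And>x. R < norm x \<Longrightarrow> f x = 0"
    using f by (auto simp: C1c_def)
  define g where "g = (\<lambda>x. frechet_derivative f (at x) (left_field v x))"
  have g: "continuous_on S g" for S
    unfolding g_def using continuous_lf
    by (intro C1c_continuous_derivative[OF f]) (auto intro: continuous_on_id continuous_on_subset)
  have [measurable]: "g \<in> borel_measurable borel" "\<gamma> \<in> borel_measurable borel" "f \<in> borel_measurable borel"
    using g flow_line_continuous[OF \<gamma>] C1c_continuous[OF f] by (auto intro: borel_measurable_continuous_onI)
  have intf: "integrable lborel f"
    by (rule integrable_continuous_bounded_support[OF C1c_continuous[OF f] R])
  have intg: "integrable lborel g"
    by (rule integrable_continuous_bounded_support[OF g, of R]) (simp add: g_def C1c_derivative_eq_0[OF f R])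
  let ?h = "\<lambda>x t. indicator {0..1} t *\<^sub>R g (mul x (\<gamma> t))"
  have 1: "f (mul x (\<gamma> 1)) - f x = (\<integral>t. ?h x t \<partial>lborel)" for x
  proof -
    have "(\<integral>t. ?h x t \<partial>lborel) = f (mul x (\<gamma> 1)) - f (mul x (\<gamma> 0))"
      unfolding g_def
    proof (rule integral_FTC_Icc[of 0 1 "\<lambda>t. f (mul x (\<gamma> t))"], goal_cases)
      case (2 t)
      show ?case
        using flow_line_increment[OF \<gamma> f, of x t]
        by (auto simp flip: has_real_derivative_iff_has_vector_derivative intro: has_field_derivative_at_within)
    next
      case 3
      have "continuous_on {0..1} (\<lambda>t. g (mul x (\<gamma> t)))"
        by (rule continuous_on_compose2[OF g[of UNIV]])
          (auto intro!: continuous_mul flow_line_continuous[OF \<gamma>] continuous_on_const)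
      then show ?case
        by (simp only: g_def)
    qed simp
    then show ?thesis
      using \<gamma> by (simp add: flow_line_def)
  qed
  have int: "integrable (lborel \<Otimes>\<^sub>M lborel) (\<lambda>(x, t). ?h x t)"
  proof (rule integrableI_bounded)
    show "(\<lambda>(x, t). ?h x t) \<in> borel_measurable (lborel \<Otimes>\<^sub>M lborel)"
      by measurable
    have "(\<integral>\<^sup>+z. ennreal (norm (case z of (x, t) \<Rightarrow> ?h x t)) \<partial>(lborel \<Otimes>\<^sub>M lborel))
        = (\<integral>\<^sup>+t. (\<integral>\<^sup>+x. ennreal (norm (?h x t)) \<partial>lborel) \<partial>lborel)"
      by (subst lborel_pair.nn_integral_snd[symmetric]) simp_all
    also have "\<dots> = (\<integral>\<^sup>+t. (\<integral>\<^sup>+x. ennreal \<bar>g x\<bar> \<partial>lborel) * indicator {0..1} (t::real) \<partial>lborel)"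
    proof (rule nn_integral_cong)
      fix t :: real
      have "(\<integral>\<^sup>+x. ennreal (norm (?h x t)) \<partial>lborel)
          = (\<integral>\<^sup>+x. ennreal \<bar>g (mul x (\<gamma> t))\<bar> * indicator {0..1} t \<partial>lborel)"
        by (intro nn_integral_cong) (auto simp: indicator_def)
      also have "\<dots> = (\<integral>\<^sup>+x. ennreal \<bar>g x\<bar> \<partial>lborel) * indicator {0..1} t"
        by (subst nn_integral_multc) (simp_all add: nn_integral_right_translate[of "\<lambda>x. ennreal \<bar>g x\<bar>"])
      finally show "(\<integral>\<^sup>+x. ennreal (norm (?h x t)) \<partial>lborel) = (\<integral>\<^sup>+x. ennreal \<bar>g x\<bar> \<partial>lborel) * indicator {0..1} t" .
    qed
    also have "\<dots> = (\<integral>\<^sup>+x. ennreal \<bar>g x\<bar> \<partial>lborel)"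
      by (subst nn_integral_cmult) simp_all
    also have "\<dots> < \<infinity>"
      using intg by (simp add: integrable_iff_bounded)
    finally show "(\<integral>\<^sup>+z. ennreal (norm (case z of (x, t) \<Rightarrow> ?h x t)) \<partial>(lborel \<Otimes>\<^sub>M lborel)) < \<infinity>" .
  qed
  \<comment> \<open>The translated function has the same integral. Written as a time integral of the
    derivative, the difference is an average of equal slices, each of them the integral of
    \<open>g\<close>.\<close>
  have "0 = (\<integral>x. f (mul x (\<gamma> 1)) - f x \<partial>lborel)"
    by (subst Bochner_Integration.integral_diff)
      (simp_all add: intf integral_right_translate integrable_right_translate)
  also have "\<dots> = (\<integral>x. (\<integral>t. ?h x t \<partial>lborel) \<partial>lborel)"
    by (simp only: 1)
  also have "\<dots> = (\<integral>t. (\<integral>x. ?h x t \<partial>lborel) \<partial>lborel)"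
    by (rule lborel_pair.Fubini_integral[OF int, symmetric])
  also have "\<dots> = (\<integral>t. indicator {0..1} (t::real) *\<^sub>R (\<integral>x. g x \<partial>lborel) \<partial>lborel)"
    by (simp add: integral_right_translate)
  also have "\<dots> = (\<integral>x. g x \<partial>lborel)"
    by simp
  finally show ?thesis
    by (simp add: g_def)
qed

end

section \<open>Translations controlled by the horizontal energy\<close>

locale carnot_basis = carnot_group mul e iv \<sigma> r V
  for mul :: "real^'n \<Rightarrow> real^'n \<Rightarrow> real^'n" and e iv and \<sigma> :: "'n::finite \<Rightarrow> nat" and r V +
  fixes X :: "'m::finite \<Rightarrow> real^'n \<Rightarrow> real^'n"
  assumes basis: "basis_of X (V 1)"
begin

lemma X_eq_lf: "X i = left_field (X i 0)"
proof -
  have "X i \<in> span (range X)"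
    by (rule span_base) simp
  then have "X i \<in> V 1"
    using basis by (simp add: basis_of_def)
  moreover have "1 \<in> {1..r}"
    using degrees[of undefined] by simp
  ultimately show ?thesis
    using V_eq_lf by blast
qed

definition energy :: "(real^'n \<Rightarrow> real) \<Rightarrow> ennreal" where
  "energy f = (\<integral>\<^sup>+x. ennreal ((norm (grad_classical X f x))\<^sup>2) \<partial>lborel)"

text \<open>The constant \<open>K\<close> plays the role of the squared Carnot-Caratheodory distance
  of \<open>h\<close> from the unit: it is \<open>s\<close> squared for a horizontal flow line of
  time \<open>s\<close>, and it is controlled under products and inverses.\<close>

definition admissible :: "real \<Rightarrow> real^'n \<Rightarrow> bool" where
  "admissible K h \<longleftrightarrow> 0 \<le> K \<and> (\<forall>f. C1c f \<longrightarrow>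
     (\<integral>\<^sup>+x. ennreal ((f (mul x h) - f x)\<^sup>2) \<partial>lborel) \<le> ennreal K * energy f)"

lemma C1c_measurable [measurable]: "C1c f \<Longrightarrow> f \<in> borel_measurable borel"
  by (rule borel_measurable_continuous_onI) (rule C1c_continuous)

lemma admissible_mono: "admissible K h \<Longrightarrow> K \<le> L \<Longrightarrow> admissible L h"
  unfolding admissible_def by (meson ennreal_leI mult_right_mono order_trans zero_le)

lemma admissible_0: "0 \<le> K \<Longrightarrow> admissible K 0"
  by (simp add: admissible_def)

text \<open>Pass through the intermediate point \<open>mul x h\<close>; the first of the two
  increments is an increment by \<open>k\<close> taken at translated points. The factor 2 from the
  square of a sum does no harm, as products of bounded length suffice.\<close>

lemma admissible_mul:
  assumes "admissible K h" "admissible L k"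
  shows "admissible (2 * (K + L)) (mul h k)"
  unfolding admissible_def
proof (intro conjI allI impI)
  show "0 \<le> 2 * (K + L)"
    using assms by (simp add: admissible_def)
  fix f :: "real^'n \<Rightarrow> real"
  assume f: "C1c f"
  note [measurable] = C1c_measurable[OF f]
  have sq: "(a + b)\<^sup>2 \<le> 2 * a\<^sup>2 + 2 * b\<^sup>2" for a b :: real
    using sum_squares_bound[of a b] by (simp add: power2_sum)
  have "(\<integral>\<^sup>+x. ennreal ((f (mul x (mul h k)) - f x)\<^sup>2) \<partial>lborel)
      \<le> (\<integral>\<^sup>+x. 2 * ennreal ((f (mul (mul x h) k) - f (mul x h))\<^sup>2) + 2 * ennreal ((f (mul x h) - f x)\<^sup>2) \<partial>lborel)"
  proof (rule nn_integral_mono)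
    fix x
    have "(f (mul x (mul h k)) - f x)\<^sup>2 \<le> 2 * (f (mul (mul x h) k) - f (mul x h))\<^sup>2 + 2 * (f (mul x h) - f x)\<^sup>2"
      using sq[of "f (mul (mul x h) k) - f (mul x h)" "f (mul x h) - f x"] by (simp add: assoc)
    then show "ennreal ((f (mul x (mul h k)) - f x)\<^sup>2)
      \<le> 2 * ennreal ((f (mul (mul x h) k) - f (mul x h))\<^sup>2) + 2 * ennreal ((f (mul x h) - f x)\<^sup>2)"
      by (simp add: ennreal_leI flip: ennreal_plus ennreal_numeral ennreal_mult')
  qed
  also have "\<dots> = 2 * (\<integral>\<^sup>+x. ennreal ((f (mul (mul x h) k) - f (mul x h))\<^sup>2) \<partial>lborel)
      + 2 * (\<integral>\<^sup>+x. ennreal ((f (mul x h) - f x)\<^sup>2) \<partial>lborel)"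
    by (simp add: nn_integral_add nn_integral_cmult)
  also have "(\<integral>\<^sup>+x. ennreal ((f (mul (mul x h) k) - f (mul x h))\<^sup>2) \<partial>lborel)
      = (\<integral>\<^sup>+x. ennreal ((f (mul x k) - f x)\<^sup>2) \<partial>lborel)"
    by (rule nn_integral_right_translate[of "\<lambda>x. ennreal ((f (mul x k) - f x)\<^sup>2)"]) measurable
  also have "2 * \<dots> + 2 * (\<integral>\<^sup>+x. ennreal ((f (mul x h) - f x)\<^sup>2) \<partial>lborel)
      \<le> 2 * (ennreal L * energy f) + 2 * (ennreal K * energy f)"
    using assms f by (intro add_mono mult_left_mono) (auto simp: admissible_def)
  also have "\<dots> = ennreal (2 * (K + L)) * energy f"
    using assms by (simp add: admissible_def ennreal_mult' ring_distribs add.commute mult.assoc)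
  finally show "(\<integral>\<^sup>+x. ennreal ((f (mul x (mul h k)) - f x)\<^sup>2) \<partial>lborel) \<le> ennreal (2 * (K + L)) * energy f" .
qed

text \<open>Substituting \<open>mul x h\<close> for \<open>x\<close> turns the increment by
  \<open>iv h\<close> into minus the increment by \<open>h\<close>.\<close>

lemma admissible_iv:
  assumes "admissible K h"
  shows "admissible K (iv h)"
  unfolding admissible_def
proof (intro conjI allI impI)
  show "0 \<le> K"
    using assms by (simp add: admissible_def)
  fix f :: "real^'n \<Rightarrow> real"
  assume f: "C1c f"
  note [measurable] = C1c_measurable[OF f]
  have "(\<integral>\<^sup>+x. ennreal ((f (mul x (iv h)) - f x)\<^sup>2) \<partial>lborel)
      = (\<integral>\<^sup>+x. ennreal ((f (mul (mul x h) (iv h)) - f (mul x h))\<^sup>2) \<partial>lborel)"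
    by (rule nn_integral_right_translate[of "\<lambda>x. ennreal ((f (mul x (iv h)) - f x)\<^sup>2)", symmetric]) measurable
  also have "\<dots> = (\<integral>\<^sup>+x. ennreal ((f (mul x h) - f x)\<^sup>2) \<partial>lborel)"
    by (simp add: assoc right_inverse power2_commute unit_eq_0)
  also have "\<dots> \<le> ennreal K * energy f"
    using assms f by (simp add: admissible_def)
  finally show "(\<integral>\<^sup>+x. ennreal ((f (mul x (iv h)) - f x)\<^sup>2) \<partial>lborel) \<le> ennreal K * energy f" .
qed

lemma norm_grad_classical: "(norm (grad_classical X f x))\<^sup>2 = (\<Sum>i\<in>UNIV. (frechet_derivative f (at x) (X i x))\<^sup>2)"
  by (simp add: norm_vec_def L2_set_def grad_classical_def sum_nonneg)

lemma admissible_flow_line: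
  assumes "flow_line (X i 0) \<gamma>"
  shows "admissible (s\<^sup>2) (\<gamma> s)"
  unfolding admissible_def
proof (intro conjI allI impI)
  fix f :: "real^'n \<Rightarrow> real"
  assume f: "C1c f"
  have "(\<integral>\<^sup>+x. ennreal ((f (mul x (\<gamma> s)) - f x)\<^sup>2) \<partial>lborel)
    \<le> ennreal (s\<^sup>2) * (\<integral>\<^sup>+x. ennreal ((frechet_derivative f (at x) (left_field (X i 0) x))\<^sup>2) \<partial>lborel)"
    by (rule flow_line_L2[OF assms f])
  also have "\<dots> \<le> ennreal (s\<^sup>2) * energy f"
    unfolding energy_def norm_grad_classical X_eq_lf[of i, symmetric]
    by (intro mult_left_mono nn_integral_mono ennreal_leI member_le_sum) auto
  finally show "(\<integral>\<^sup>+x. ennreal ((f (mul x (\<gamma> s)) - f x)\<^sup>2) \<partial>lborel) \<le> ennreal (s\<^sup>2) * energy f" .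
qed simp

section \<open>Reachable directions in each layer\<close>

abbreviation reach_curve :: "nat \<Rightarrow> real^'n \<Rightarrow> real \<Rightarrow> real \<Rightarrow> (real \<Rightarrow> real^'n) \<Rightarrow> bool" where
  "reach_curve k w K s g \<equiv> g \<in> borel_measurable borel \<and>
     (\<forall>\<tau>. g \<tau> \<in> flt \<sigma> k \<and> lay \<sigma> k (g \<tau>) = \<tau> *\<^sub>R w) \<and> (\<forall>\<tau>. \<bar>\<tau>\<bar> \<le> s \<longrightarrow> admissible K (g \<tau>))"

text \<open>The homogeneous scaling: cost of order \<open>t\<close> squared for displacements up to
  \<open>t ^ k\<close> in weight \<open>k\<close>. \<open>C\<close> is uniform in \<open>t\<close>,
  but the curve may depend on \<open>t\<close>, as it does for commutators.\<close>

definition reach :: "nat \<Rightarrow> real^'n \<Rightarrow> bool" where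
  "reach k w \<longleftrightarrow> (\<exists>C\<ge>0. \<forall>t>0. \<exists>g. reach_curve k w (C * t\<^sup>2) (t ^ k) g)"

lemma lay_mul: "x \<in> flt \<sigma> k \<Longrightarrow> y \<in> flt \<sigma> k \<Longrightarrow> lay \<sigma> k (mul x y) = lay \<sigma> k x + lay \<sigma> k y"
  by (auto simp: vec_eq_iff mul_nth_flt)

lemma reach_0: "reach k 0"
  unfolding reach_def
  by (intro exI[of _ 0] conjI allI impI exI[of _ "\<lambda>_. 0"])
    (auto simp: admissible_0 subspace_0 subspace_flt linear_0[OF linear_lay])

lemma reach_add:
  assumes "reach k v" "reach k w"
  shows "reach k (v + w)"
proof -
  obtain C where C: "C \<ge> 0" "\<And>t. t > 0 \<Longrightarrow> \<exists>g. reach_curve k v (C * t\<^sup>2) (t ^ k) g"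
    using assms(1) by (auto simp: reach_def)
  obtain D where D: "D \<ge> 0" "\<And>t. t > 0 \<Longrightarrow> \<exists>g. reach_curve k w (D * t\<^sup>2) (t ^ k) g"
    using assms(2) by (auto simp: reach_def)
  show ?thesis
    unfolding reach_def
  proof (intro exI[of _ "2 * (C + D)"] conjI allI impI)
    fix t :: real
    assume "t > 0"
    then obtain g h where g: "g \<in> borel_measurable borel" "\<And>\<tau>. g \<tau> \<in> flt \<sigma> k" "\<And>\<tau>. lay \<sigma> k (g \<tau>) = \<tau> *\<^sub>R v"
        "\<And>\<tau>. \<bar>\<tau>\<bar> \<le> t ^ k \<Longrightarrow> admissible (C * t\<^sup>2) (g \<tau>)"
      and h: "h \<in> borel_measurable borel" "\<And>\<tau>. h \<tau> \<in> flt \<sigma> k" "\<And>\<tau>. lay \<sigma> k (h \<tau>) = \<tau> *\<^sub>R w"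
        "\<And>\<tau>. \<bar>\<tau>\<bar> \<le> t ^ k \<Longrightarrow> admissible (D * t\<^sup>2) (h \<tau>)"
      using C(2)[of t] D(2)[of t] by metis
    note [measurable] = g(1) h(1)
    have "admissible (2 * (C + D) * t\<^sup>2) (mul (g \<tau>) (h \<tau>))" if "\<bar>\<tau>\<bar> \<le> t ^ k" for \<tau>
      using admissible_mul[OF g(4)[OF that] h(4)[OF that]] by (simp add: algebra_simps)
    then show "\<exists>g. reach_curve k (v + w) (2 * (C + D) * t\<^sup>2) (t ^ k) g"
      by (intro exI[of _ "\<lambda>\<tau>. mul (g \<tau>) (h \<tau>)"]) (simp add: flt_mul g(2,3) h(2,3) lay_mul scaleR_add_right)
  qed (use C(1) D(1) in simp)
qed

lemma reach_scale:
  assumes "reach k v" "1 \<le> k"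
  shows "reach k (a *\<^sub>R v)"
proof -
  obtain C where C: "C \<ge> 0" "\<And>t. t > 0 \<Longrightarrow> \<exists>g. reach_curve k v (C * t\<^sup>2) (t ^ k) g"
    using assms(1) by (auto simp: reach_def)
  show ?thesis
    unfolding reach_def
  \<comment> \<open>Time is stretched by \<open>1 + \<bar>a\<bar>\<close> rather than
    \<open>\<bar>a\<bar>\<close>: this stays positive for \<open>a = 0\<close>, and its
    \<open>k\<close>-th power dominates \<open>\<bar>a\<bar>\<close>.\<close>
  proof (intro exI[of _ "C * (1 + \<bar>a\<bar>)\<^sup>2"] conjI allI impI)
    fix t :: real
    assume t: "t > 0"
    then have "(1 + \<bar>a\<bar>) * t > 0"
      by simp
    then obtain g where g: "g \<in> borel_measurable borel" "\<And>\<tau>. g \<tau> \<in> flt \<sigma> k" "\<And>\<tau>. lay \<sigma> k (g \<tau>) = \<tau> *\<^sub>R v"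
        "\<And>\<tau>. \<bar>\<tau>\<bar> \<le> ((1 + \<bar>a\<bar>) * t) ^ k \<Longrightarrow> admissible (C * ((1 + \<bar>a\<bar>) * t)\<^sup>2) (g \<tau>)"
      using C(2) by metis
    note [measurable] = g(1)
    have "admissible (C * (1 + \<bar>a\<bar>)\<^sup>2 * t\<^sup>2) (g (\<tau> * a))" if "\<bar>\<tau>\<bar> \<le> t ^ k" for \<tau>
    proof -
      have "\<bar>a\<bar> \<le> (1 + \<bar>a\<bar>) ^ 1"
        by simp
      also have "\<dots> \<le> (1 + \<bar>a\<bar>) ^ k"
        by (rule power_increasing) (use assms(2) in auto)
      finally have "\<bar>\<tau> * a\<bar> \<le> ((1 + \<bar>a\<bar>) * t) ^ k"
        using that mult_mono[of "\<bar>\<tau>\<bar>" "t ^ k" "\<bar>a\<bar>" "(1 + \<bar>a\<bar>) ^ k"] t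
        by (simp add: abs_mult power_mult_distrib mult.commute)
      from g(4)[OF this] show ?thesis
        by (simp add: power_mult_distrib mult.assoc)
    qed
    then show "\<exists>g. reach_curve k (a *\<^sub>R v) (C * (1 + \<bar>a\<bar>)\<^sup>2 * t\<^sup>2) (t ^ k) g"
      by (intro exI[of _ "\<lambda>\<tau>. g (\<tau> * a)"]) (simp add: g(2,3))
  qed (use C(1) in simp)
qed

lemma reach_base: "reach 1 (lay \<sigma> 1 (X i 0))"
proof -
  obtain \<gamma> where \<gamma>: "flow_line (X i 0) \<gamma>"
    using flow_line_exists by blast
  have "\<gamma> \<in> borel_measurable borel"
    using flow_line_continuous[OF \<gamma>] by (rule borel_measurable_continuous_onI)
  moreover have "\<gamma> \<tau> \<in> flt \<sigma> 1" for \<tau>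
    using weight_pos leD by (auto simp: flt_def)
  moreover have "admissible (1 * t\<^sup>2) (\<gamma> \<tau>)" if "\<bar>\<tau>\<bar> \<le> t ^ 1" "t > 0" for t \<tau>
    by (rule admissible_mono[OF admissible_flow_line[OF \<gamma>]]) (use that abs_le_square_iff[of \<tau> t] in auto)
  ultimately show ?thesis
    unfolding reach_def using flow_line_lay[OF \<gamma>] by (intro exI[of _ 1]) auto
qed

text \<open>The commutator of the horizontal flow at time \<open>t\<close> with the curve for
  \<open>w\<close> at parameter \<open>\<tau> / t\<close>: by bilinearity the two factors combine to
  \<open>\<tau>\<close>, and \<open>\<bar>\<tau>\<bar> \<le> t ^ Suc k\<close> keeps
  \<open>\<tau> / t\<close> in the admissible range.\<close>

lemma reach_br:
  assumes k: "1 \<le> k" and w: "w \<in> flt \<sigma> k" "lay \<sigma> k w = w" "reach k w"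
  shows "reach (Suc k) (bracket k (X i 0) w)"
proof -
  obtain C where C: "C \<ge> 0" "\<And>t. t > 0 \<Longrightarrow> \<exists>g. reach_curve k w (C * t\<^sup>2) (t ^ k) g"
    using w(3) by (auto simp: reach_def)
  obtain \<gamma> where \<gamma>: "flow_line (X i 0) \<gamma>"
    using flow_line_exists by blast
  show ?thesis
    unfolding reach_def
  \<comment> \<open>The commutator is a product of two products, so the costs are doubled twice:
    \<open>2 * (2 * (1 + C) + 2 * (C + 1))\<close>.\<close>
  proof (intro exI[of _ "8 * (1 + C)"] conjI allI impI)
    fix t :: real
    assume t: "t > 0"
    then obtain g where g: "g \<in> borel_measurable borel" "\<And>\<tau>. g \<tau> \<in> flt \<sigma> k" "\<And>\<tau>. lay \<sigma> k (g \<tau>) = \<tau> *\<^sub>R w"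
        "\<And>\<tau>. \<bar>\<tau>\<bar> \<le> t ^ k \<Longrightarrow> admissible (C * t\<^sup>2) (g \<tau>)"
      using C(2) by metis
    note [measurable] = g(1)
    define h where "h = (\<lambda>\<tau>. group_comm (\<gamma> t) (g (\<tau> / t)))"
    have "h \<in> borel_measurable borel"
      unfolding h_def group_comm_def by measurable
    moreover have "h \<tau> \<in> flt \<sigma> (Suc k)" for \<tau>
      unfolding h_def by (rule group_comm_flt[OF g(2)])
    moreover have "lay \<sigma> (Suc k) (h \<tau>) = \<tau> *\<^sub>R bracket k (X i 0) w" for \<tau>
    proof -
      have "lay \<sigma> (Suc k) (h \<tau>) = bracket k (t *\<^sub>R lay \<sigma> 1 (X i 0)) ((\<tau> / t) *\<^sub>R w)"
        unfolding h_def group_comm_lay[OF g(2)] bracket_lay[OF g(2), of "\<gamma> t"] flow_line_lay[OF \<gamma>] g(3) ..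
      also have "\<dots> = t *\<^sub>R bracket k (lay \<sigma> 1 (X i 0)) ((\<tau> / t) *\<^sub>R w)"
        by (rule linear_scale[OF bracket_linear_left[OF subspace_scale[OF subspace_flt w(1)]]])
      also have "\<dots> = \<tau> *\<^sub>R bracket k (lay \<sigma> 1 (X i 0)) w"
        using bracket_linear_right(2)[OF w(1) w(1)] t by simp
      also have "bracket k (lay \<sigma> 1 (X i 0)) w = bracket k (X i 0) w"
        using bracket_lay[OF w(1), of "X i 0"] w(2) by simp
      finally show ?thesis .
    qed
    moreover have "admissible (8 * (1 + C) * t\<^sup>2) (h \<tau>)" if "\<bar>\<tau>\<bar> \<le> t ^ Suc k" for \<tau>
    proof -
      have "\<bar>\<tau> / t\<bar> \<le> t ^ k"
        using that t by (simp add: field_simps)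
      note admissible = admissible_flow_line[OF \<gamma>, of t] g(4)[OF this]
      have "2 * (2 * (t\<^sup>2 + C * t\<^sup>2) + 2 * (C * t\<^sup>2 + t\<^sup>2)) = 8 * (1 + C) * t\<^sup>2"
        by (simp add: algebra_simps)
      then show ?thesis
        using admissible_mul[OF admissible_mul[OF admissible(1) admissible(2)] admissible_iv[OF admissible_mul[OF admissible(2) admissible(1)]]]
        by (simp only: h_def group_comm_def)
    qed
    ultimately show "\<exists>g. reach_curve (Suc k) (bracket k (X i 0) w) (8 * (1 + C) * t\<^sup>2) (t ^ Suc k) g"
      by blast
  qed (use C(1) in simp)
qed

lemma reach_axis: "reach (\<sigma> i) (axis i 1)"
proof -
  \<comment> \<open>\<open>layer_generation\<close> asks for a subspace at every index, whereas
    scaling of \<open>reach\<close> is available from weight 1 on; the disjunct settles index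
    0.\<close>
  have "lay \<sigma> (\<sigma> i) (axis i 1) \<in> {w. \<sigma> i = 0 \<or> reach (\<sigma> i) w}"
  proof (rule layer_generation[OF basis])
    show "subspace {w. k = 0 \<or> reach k w}" for k
      by (auto simp: subspace_def reach_0 reach_add reach_scale)
  qed (use degrees[of i] reach_base reach_br in auto)
  moreover have "lay \<sigma> (\<sigma> i) (axis i 1) = axis i (1::real)"
    by (auto simp: vec_eq_iff axis_def)
  ultimately show ?thesis
    using weight_pos[of i] by auto
qed

text \<open>A chart in which only the coordinates of \<open>I\<close> are switched on: triangular
  with diagonal entries 1 on \<open>I\<close> and 0 elsewhere. The full chart is the case of all
  coordinates.\<close>

abbreviation partial_chart :: "'n set \<Rightarrow> real \<Rightarrow> real \<Rightarrow> (real^'n \<Rightarrow> real^'n) \<Rightarrow> bool" where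
  "partial_chart I K t \<Psi> \<equiv> \<Psi> \<in> borel_measurable borel \<and>
     (\<forall>j. tri_dep \<sigma> (\<lambda>u. \<Psi> u $ j - (if j \<in> I then u $ j else 0)) (\<sigma> j)) \<and>
     (\<forall>u. (\<forall>i. \<bar>u $ i\<bar> \<le> t ^ \<sigma> i) \<longrightarrow> admissible K (\<Psi> u))"

text \<open>A product of elements of all layers, one for every coordinate, parametrises a
  neighbourhood of the identity of volume \<open>t\<^sup>Q\<close> by a measure preserving map.\<close>

lemma reach_chart:
  obtains C where "0 \<le> C" "\<And>t. t > 0 \<Longrightarrow> \<exists>\<Psi>. \<Psi> \<in> borel_measurable borel \<and>
     (\<forall>j. tri_dep \<sigma> (\<lambda>u. \<Psi> u $ j - u $ j) (\<sigma> j)) \<and>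
     (\<forall>u. (\<forall>i. \<bar>u $ i\<bar> \<le> t ^ \<sigma> i) \<longrightarrow> admissible (C * t\<^sup>2) (\<Psi> u))"
proof -
  have "\<exists>C\<ge>0. \<forall>t>0. \<exists>\<Psi>. partial_chart I (C * t\<^sup>2) t \<Psi>" for I
    using finite[of I]
  proof (induction I rule: finite_induct)
    case empty
    show ?case
      by (intro exI[of _ 0] conjI allI impI exI[of _ "\<lambda>_. 0"]) (auto simp: tri_dep_def admissible_0)
  next
    case (insert i I)
    then obtain C where C: "C \<ge> 0" "\<And>t. t > 0 \<Longrightarrow> \<exists>\<Psi>. partial_chart I (C * t\<^sup>2) t \<Psi>"
      by auto
    obtain D where D: "D \<ge> 0" "\<And>t. t > 0 \<Longrightarrow> \<exists>g. reach_curve (\<sigma> i) (axis i 1) (D * t\<^sup>2) (t ^ \<sigma> i) g"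
      using reach_axis[of i] by (auto simp: reach_def)
    show ?case
    proof (intro exI[of _ "2 * (C + D)"] conjI allI impI)
      fix t :: real
      assume t: "t > 0"
      obtain \<Psi> where \<Psi>: "\<Psi> \<in> borel_measurable borel"
         "\<And>j. tri_dep \<sigma> (\<lambda>u. \<Psi> u $ j - (if j \<in> I then u $ j else 0)) (\<sigma> j)"
         "\<And>u. (\<forall>i. \<bar>u $ i\<bar> \<le> t ^ \<sigma> i) \<Longrightarrow> admissible (C * t\<^sup>2) (\<Psi> u)"
        using C(2)[OF t] by blast
      obtain g where g: "g \<in> borel_measurable borel" "\<And>\<tau>. g \<tau> \<in> flt \<sigma> (\<sigma> i)"
         "\<And>\<tau>. lay \<sigma> (\<sigma> i) (g \<tau>) = \<tau> *\<^sub>R axis i 1" "\<And>\<tau>. \<bar>\<tau>\<bar> \<le> t ^ \<sigma> i \<Longrightarrow> admissible (D * t\<^sup>2) (g \<tau>)"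
        using D(2)[OF t] by blast
      note [measurable] = g(1) \<Psi>(1)
      \<comment> \<open>Up to weight \<open>\<sigma> i\<close> the curve is known exactly. Its
        unknown components have larger weight, and there a dependence on \<open>u $ i\<close> is a
        dependence on a coordinate of smaller weight.\<close>
      have gj: "g \<tau> $ j = (if j = i then \<tau> else 0)" if "\<sigma> j \<le> \<sigma> i" for \<tau> j
      proof (cases "\<sigma> j = \<sigma> i")
        case True
        then show ?thesis
          using arg_cong[OF g(3)[of \<tau>], of "\<lambda>x. x $ j"] by (auto simp: axis_def)
      next
        case False
        with that show ?thesis
          using g(2)[of \<tau>] by (auto simp: flt_def)
      qed
      let ?\<Phi> = "\<lambda>u. mul (\<Psi> u) (g (u $ i))"
      have "tri_dep \<sigma> (\<lambda>u. ?\<Phi> u $ j - (if j \<in> insert i I then u $ j else 0)) (\<sigma> j)" for j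
        unfolding tri_dep_def
      proof (intro allI impI)
        fix u u' :: "real^'n"
        assume u: "\<forall>l. \<sigma> l < \<sigma> j \<longrightarrow> u $ l = u' $ l"
        have 1: "\<Psi> u $ l - (if l \<in> I then u $ l else 0) = \<Psi> u' $ l - (if l \<in> I then u' $ l else 0)"
          if "\<sigma> l \<le> \<sigma> j" for l
          using \<Psi>(2)[of l] u that by (auto simp: tri_dep_def)
        have 2: "g (u $ i) $ l = g (u' $ i) $ l" if "\<sigma> l < \<sigma> j" for l
        proof (cases "\<sigma> i < \<sigma> j")
          case False
          with that gj[of l] show ?thesis
            by auto
        qed (use u in simp)
        have 3: "g (u $ i) $ j - (if j = i then u $ i else 0) = g (u' $ i) $ j - (if j = i then u' $ i else 0)"
        proof (cases "\<sigma> i < \<sigma> j")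
          case False
          with gj[of j] show ?thesis
            by auto
        qed (use u in auto)
        have "P j (\<Psi> u, g (u $ i)) = P j (\<Psi> u', g (u' $ i))"
        proof (rule P_cong)
          fix l
          assume "\<sigma> l < \<sigma> j"
          then show "\<Psi> u $ l = \<Psi> u' $ l"
            using 1[of l] u by (auto split: if_splits)
        qed (rule 2)
        with 1[of j] 3 insert.hyps show "?\<Phi> u $ j - (if j \<in> insert i I then u $ j else 0)
            = ?\<Phi> u' $ j - (if j \<in> insert i I then u' $ j else 0)"
          by (auto simp: mul_nth split: if_splits)
      qed
      moreover have "admissible (2 * (C + D) * t\<^sup>2) (?\<Phi> u)" if "\<forall>i. \<bar>u $ i\<bar> \<le> t ^ \<sigma> i" for u
        using admissible_mul[OF \<Psi>(3)[OF that] g(4)[of "u $ i"]] that by (simp add: algebra_simps)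
      moreover have "?\<Phi> \<in> borel_measurable borel"
        by measurable
      ultimately show "\<exists>\<Psi>. partial_chart (insert i I) (2 * (C + D) * t\<^sup>2) t \<Psi>"
        by blast
    qed (use C(1) D(1) in simp)
  qed
  from this[of UNIV] that show thesis
    by auto
qed

end

section \<open>The Folland-Stein inequality\<close>

lemma has_real_derivative_max0_square:
  "((\<lambda>y::real. (max 0 y)\<^sup>2) has_real_derivative 2 * max 0 y) (at y)"
proof -
  consider "y < 0" | "y > 0" | "y = 0"
    by linarith
  then show ?thesis
  proof cases
    case 1
    have "((\<lambda>y. 0) has_real_derivative 2 * max 0 y) (at y)"
      using 1 by (auto intro!: derivative_eq_intros)
    then show ?thesis
      by (rule has_field_derivative_transform_within_open[of _ _ _ "{..<0}"]) (use 1 in auto)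
  next
    case 2
    have "((\<lambda>y. y\<^sup>2) has_real_derivative 2 * max 0 y) (at y)"
      using 2 by (auto intro!: derivative_eq_intros)
    then show ?thesis
      by (rule has_field_derivative_transform_within_open[of _ _ _ "{0<..}"]) (use 2 in auto)
  next
    case 3
    have "((\<lambda>h::real. max 0 h) \<longlongrightarrow> max 0 0) (at 0)"
      by (intro tendsto_intros)
    moreover have "(max 0 h)\<^sup>2 / h = max 0 h" for h :: real
      by (simp add: max_def power2_eq_square)
    ultimately have "((\<lambda>h::real. ((max 0 (0 + h))\<^sup>2 - (max 0 0)\<^sup>2) / h) \<longlongrightarrow> 0) (at 0)"
      by simp
    with 3 show ?thesis
      by (simp add: DERIV_def)
  qed
qed

lemma C1c_compose:
  fixes f :: "'a::euclidean_space \<Rightarrow> real"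
  assumes f: "C1c f" and \<phi>: "\<And>s. (\<phi> has_real_derivative \<phi>' s) (at s)" "continuous_on UNIV \<phi>'" "\<phi> 0 = 0"
  shows C1c_comp: "C1c (\<lambda>x. \<phi> (f x))"
    and frechet_derivative_comp: "frechet_derivative (\<lambda>x. \<phi> (f x)) (at x) h = \<phi>' (f x) * frechet_derivative f (at x) h"
proof -
  have d: "((\<lambda>x. \<phi> (f x)) has_derivative (\<lambda>h. \<phi>' (f x) * frechet_derivative f (at x) h)) (at x)" for x
    by (rule has_derivative_compose[OF C1c_has_derivative[OF f] \<phi>(1)[unfolded has_field_derivative_def]])
  then have eq: "frechet_derivative (\<lambda>x. \<phi> (f x)) (at x) = (\<lambda>h. \<phi>' (f x) * frechet_derivative f (at x) h)" for x
    by (rule frechet_derivative_eqI)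
  then show "frechet_derivative (\<lambda>x. \<phi> (f x)) (at x) h = \<phi>' (f x) * frechet_derivative f (at x) h"
    by simp
  have "continuous_on UNIV (\<lambda>x. \<phi>' (f x) * frechet_derivative f (at x) h)" for h
    by (intro continuous_intros continuous_on_compose2[OF \<phi>(2) C1c_continuous[OF f]]
        C1c_continuous_derivative[OF f]) auto
  moreover obtain R where "\<forall>x. R < norm x \<longrightarrow> f x = 0"
    using f by (auto simp: C1c_def)
  ultimately show "C1c (\<lambda>x. \<phi> (f x))"
    using d \<phi>(3) by (auto simp: C1c_def eq differentiable_def intro!: exI[of _ R])
qed

text \<open>A smoothed indicator of \<open>\<bar>s\<bar> \<ge> 2 * l\<close>, vanishing for \<open>\<bar>s\<bar> \<le> l\<close>.\<close>

definition cutoff :: "real \<Rightarrow> real \<Rightarrow> real" where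
  "cutoff l s = 1 - (max 0 (1 - (max 0 ((s\<^sup>2 / l\<^sup>2 - 1) / 3))\<^sup>2))\<^sup>2"

text \<open>The inner quantity \<open>y\<close> runs from 0 to 1 as \<open>\<bar>s\<bar>\<close>
  runs from \<open>l\<close> to \<open>2 * l\<close>. One squared positive part flattens the cutoff
  at \<open>l\<close>, the other at \<open>2 * l\<close>, and using the square of \<open>s\<close>
  avoids the corner of the modulus.\<close>

definition cutoff' :: "real \<Rightarrow> real \<Rightarrow> real" where
  "cutoff' l s = (let y = (s\<^sup>2 / l\<^sup>2 - 1) / 3 in
     2 * max 0 (1 - (max 0 y)\<^sup>2) * (2 * max 0 y) * (2 * s / (3 * l\<^sup>2)))"

lemma cutoff_derivative: "(cutoff l has_real_derivative cutoff' l s) (at s)"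
proof -
  let ?y = "\<lambda>s. (s\<^sup>2 / l\<^sup>2 - 1) / 3"
  have 1: "(?y has_real_derivative 2 * s / (3 * l\<^sup>2)) (at s)"
  proof -
    have "((\<lambda>s. s\<^sup>2) has_real_derivative 2 * s) (at s)"
      by (auto intro!: derivative_eq_intros)
    from DERIV_cdivide[OF DERIV_diff[OF DERIV_cdivide[OF this, of "l\<^sup>2"] DERIV_const[of 1]], of 3]
    show ?thesis
      by (simp add: mult.commute)
  qed
  have 2: "((\<lambda>s. (max 0 (?y s))\<^sup>2) has_real_derivative 2 * max 0 (?y s) * (2 * s / (3 * l\<^sup>2))) (at s)"
    by (rule DERIV_chain2[OF has_real_derivative_max0_square 1])
  have 3: "((\<lambda>s. 1 - (max 0 (?y s))\<^sup>2) has_real_derivative - (2 * max 0 (?y s) * (2 * s / (3 * l\<^sup>2)))) (at s)"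
    using DERIV_diff[OF DERIV_const 2] by simp
  show ?thesis
    unfolding cutoff_def
    using DERIV_diff[OF DERIV_const[of 1] DERIV_chain2[OF has_real_derivative_max0_square 3]]
    by (simp add: cutoff'_def Let_def mult_ac)
qed

lemma cutoff_continuous: "continuous_on UNIV (cutoff' l)"
  unfolding cutoff'_def Let_def by (cases "l = 0") (auto intro!: continuous_intros)

lemma cutoff_values:
  assumes l: "l > 0"
  shows cutoff_low: "\<bar>s\<bar> \<le> l \<Longrightarrow> cutoff l s = 0" and cutoff_high: "2 * l \<le> \<bar>s\<bar> \<Longrightarrow> cutoff l s = 1"
    and cutoff'_bound: "(cutoff' l s)\<^sup>2 \<le> (6 / l)\<^sup>2 * indicator {l<..<2 * l} \<bar>s\<bar>"
proof -
  let ?y = "(s\<^sup>2 / l\<^sup>2 - 1) / 3"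
  have low: "?y \<le> 0" if "\<bar>s\<bar> \<le> l"
    using that l abs_le_square_iff[of s l] by (simp add: field_simps)
  have high: "1 \<le> ?y" if "2 * l \<le> \<bar>s\<bar>"
    using that l abs_le_square_iff[of "2 * l" s] by (simp add: field_simps)
  show "cutoff l s = 0" if "\<bar>s\<bar> \<le> l"
    using low[OF that] by (simp add: cutoff_def max_def)
  show "cutoff l s = 1" if "2 * l \<le> \<bar>s\<bar>"
  proof -
    have "1 \<le> (max 0 ?y)\<^sup>2"
      using high[OF that] by (intro one_le_power) simp
    then show ?thesis
      by (simp add: cutoff_def)
  qed
  show "(cutoff' l s)\<^sup>2 \<le> (6 / l)\<^sup>2 * indicator {l<..<2 * l} \<bar>s\<bar>"
  proof (cases "l < \<bar>s\<bar> \<and> \<bar>s\<bar> < 2 * l")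
    case False
    then consider "\<bar>s\<bar> \<le> l" | "2 * l \<le> \<bar>s\<bar>"
      by linarith
    then have "cutoff' l s = 0"
    proof cases
      case 1
      have "max 0 ?y = 0"
        using low[OF 1] by simp
      then show ?thesis
        by (simp add: cutoff'_def Let_def)
    next
      case 2
      have "1 \<le> (max 0 ?y)\<^sup>2"
        using high[OF 2] by (intro one_le_power) simp
      then show ?thesis
        by (simp add: cutoff'_def Let_def)
    qed
    with False show ?thesis
      by simp
  next
    case True
    have y: "max 0 ?y \<le> 1"
      using True l abs_le_square_iff[of s "2 * l"] by (simp add: field_simps)
    have "\<bar>cutoff' l s\<bar> = (max 0 (1 - (max 0 ?y)\<^sup>2)) * max 0 ?y * (8 * \<bar>s\<bar> / (3 * l\<^sup>2))"
      using l by (simp add: cutoff'_def Let_def abs_mult)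
    \<comment> \<open>The bound is \<open>16 / (3 * l)\<close>, rounded up to
      \<open>6 / l\<close>.\<close>
    also have "\<dots> \<le> 1 * 1 * (8 * (2 * l) / (3 * l\<^sup>2))"
      by (intro mult_mono divide_right_mono mult_left_mono y) (use True l in auto)
    also have "\<dots> \<le> 6 / l"
      using l by (simp add: field_simps power2_eq_square)
    finally have "\<bar>cutoff' l s\<bar>\<^sup>2 \<le> (6 / l)\<^sup>2"
      by (rule power_mono) simp
    with True show ?thesis
      by simp
  qed
qed

section \<open>From level sets to the strong inequality\<close>

context carnot_basis
begin

lemma grad_classical_continuous:
  assumes "C1c f"
  shows "continuous_on S (grad_classical X f)"
  unfolding grad_classical_def
proof (intro continuous_on_vec_lambda C1c_continuous_derivative assms continuous_on_id)
  fix i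
  show "continuous_on S (X i)"
    using continuous_lf[of "X i 0"] X_eq_lf[of i] by (auto intro: continuous_on_subset)
qed

lemma grad_classical_measurable [measurable]:
  "C1c f \<Longrightarrow> grad_classical X f \<in> borel_measurable borel"
  by (rule borel_measurable_continuous_onI) (rule grad_classical_continuous)

lemma energy_finite:
  assumes f: "C1c f"
  shows "energy f < \<infinity>"
proof -
  obtain R where R: "\<And>x. R < norm x \<Longrightarrow> f x = 0"
    using f by (auto simp: C1c_def)
  have "integrable lborel (\<lambda>x. (norm (grad_classical X f x))\<^sup>2)"
  proof (rule integrable_continuous_bounded_support)
    show "continuous_on UNIV (\<lambda>x. (norm (grad_classical X f x))\<^sup>2)"
      by (intro continuous_intros grad_classical_continuous f)
    show "(norm (grad_classical X f x))\<^sup>2 = 0" if "R < norm x" for x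
      unfolding norm_grad_classical by (simp add: C1c_derivative_eq_0[OF f R that])
  qed
  then show ?thesis
    by (simp add: energy_def integrable_iff_bounded)
qed

definition Q :: nat where "Q = (\<Sum>i\<in>UNIV. \<sigma> i)"

lemma hom_dim_eq_Q: "hom_dim \<sigma> r = Q"
proof -
  have "Q = (\<Sum>k\<in>{1..r}. \<Sum>i\<in>{i\<in>UNIV. \<sigma> i = k}. \<sigma> i)"
    unfolding Q_def by (rule sum.group[symmetric]) (use degrees in auto)
  also have "\<dots> = hom_dim \<sigma> r"
    unfolding hom_dim_def block_dim_def by (intro sum.cong) (auto simp: mult.commute)
  finally show ?thesis
    by simp
qed

text \<open>If \<open>f x \<ge> 1\<close>, then of the volume \<open>2 * m\<close> of admissible
  translations at most \<open>m\<close> lead to a point with \<open>f \<ge> 1 / 2\<close>; on the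
  rest \<open>f\<close> changes by more than one half. Integrating this over \<open>x\<close> and
  exchanging the integrals bounds the level set by the energy.\<close>

lemma level_estimate:
  obtains K where "0 \<le> K"
    "\<And>f m. C1c f \<Longrightarrow> 0 < m \<Longrightarrow> emeasure lborel {x. 1 / 2 \<le> f x} \<le> ennreal m \<Longrightarrow>
       emeasure lborel {x. 1 \<le> f x} \<le> ennreal (K * m powr (2 / real Q)) * energy f"
proof -
  obtain C where C: "0 \<le> C" "\<And>t. t > 0 \<Longrightarrow> \<exists>\<Psi>. \<Psi> \<in> borel_measurable borel \<and>
     (\<forall>j. tri_dep \<sigma> (\<lambda>u. \<Psi> u $ j - u $ j) (\<sigma> j)) \<and>
     (\<forall>u. (\<forall>i. \<bar>u $ i\<bar> \<le> t ^ \<sigma> i) \<longrightarrow> admissible (C * t\<^sup>2) (\<Psi> u))"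
    by (rule reach_chart) blast
  have "1 \<le> Q"
    using member_le_sum[of undefined UNIV \<sigma>] weight_pos[of undefined] by (simp add: Q_def)
  \<comment> \<open>The factor 8 is 4, from the squared jump of one half, times 2, the ratio of the
    box volume \<open>2 * m\<close> to \<open>m\<close>; the remaining power of 2 comes from
    \<open>t\<close> squared.\<close>
  define K where "K = 8 * C * 2 powr (2 / real Q)"
  show thesis
  proof (rule that[of K])
    show "0 \<le> K"
      using C(1) by (simp add: K_def)
  next
    fix f :: "real^'n \<Rightarrow> real" and m :: real
    assume f: "C1c f" and m: "0 < m" and half: "emeasure lborel {x. 1 / 2 \<le> f x} \<le> ennreal m"
    note [measurable] = C1c_measurable[OF f]
    \<comment> \<open>Chosen so that the box of parameters has volume \<open>t ^ Q = 2 * m\<close>,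
      twice the bound for the set where \<open>f \<ge> 1 / 2\<close>.\<close>
    define t where "t = (2 * m) powr (1 / real Q)"
    have t: "t > 0"
      using m by (simp add: t_def)
    have tQ: "t ^ Q = 2 * m"
      using m \<open>1 \<le> Q\<close> by (simp add: t_def powr_realpow[symmetric] powr_powr)
    obtain \<Psi> where \<Psi>[measurable]: "\<Psi> \<in> borel_measurable borel"
      and tri: "\<And>j. tri_dep \<sigma> (\<lambda>u. \<Psi> u $ j - u $ j) (\<sigma> j)"
      and admissible: "\<And>u. (\<forall>i. \<bar>u $ i\<bar> \<le> t ^ \<sigma> i) \<Longrightarrow> admissible (C * t\<^sup>2) (\<Psi> u)"
      using C(2)[OF t] by blast
    define B where "B = cbox (0::real^'n) (\<chi> i. t ^ \<sigma> i)"
    have B[measurable]: "B \<in> sets borel"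
      by (simp add: B_def)
    have "emeasure lborel B = ennreal (\<Prod>b\<in>Basis. ((\<chi> i. t ^ \<sigma> i) - (0::real^'n)) \<bullet> b)"
      unfolding B_def using t
      by (intro emeasure_lborel_cbox) (auto simp: Basis_vec_def inner_axis)
    also have "(\<Prod>b\<in>Basis. ((\<chi> i. t ^ \<sigma> i) - (0::real^'n)) \<bullet> b) = (\<Prod>i\<in>UNIV. t ^ \<sigma> i)"
      unfolding Basis_vec_def
      by (simp add: prod.UNION_disjoint inner_axis axis_eq_axis)
    also have "\<dots> = 2 * m"
      using tQ by (simp add: Q_def power_sum)
    finally have volB: "emeasure lborel B = ennreal (2 * m)" .
    have admB: "admissible (C * t\<^sup>2) (\<Psi> u)" if "u \<in> B" for u
      using that by (intro admissible) (auto simp: B_def mem_box_cart)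
    let ?d = "\<lambda>x u. ennreal ((f (mul x (\<Psi> u)) - f x)\<^sup>2)"
    have pt: "ennreal m * indicator {x. 1 \<le> f x} x \<le> 4 * (\<integral>\<^sup>+u. ?d x u * indicator B u \<partial>lborel)" for x
    proof (cases "1 \<le> f x")
      case True
      \<comment> \<open>Both the chart and left translation by \<open>x\<close> preserve the
        measure, so the bad parameters have at most the volume of the superlevel set.\<close>
      have "(\<integral>\<^sup>+u. indicator {y. 1 / 2 \<le> f y} (mul x (\<Psi> u)) \<partial>lborel)
          = (\<integral>\<^sup>+u. indicator {y. 1 / 2 \<le> f y} (mul x u) \<partial>lborel)"
        by (rule nn_integral_lborel_triangular[OF \<Psi> _ tri]) measurable
      also have "\<dots> = (\<integral>\<^sup>+u. indicator {y. 1 / 2 \<le> f y} u \<partial>lborel)"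
        by (rule nn_integral_left_translate) measurable
      also have "\<dots> \<le> ennreal m"
        using half by simp
      finally have le: "(\<integral>\<^sup>+u. indicator {y. 1 / 2 \<le> f y} (mul x (\<Psi> u)) \<partial>lborel) \<le> ennreal m" .
      have "ennreal m + ennreal m = (\<integral>\<^sup>+u. indicator B u \<partial>lborel)"
        using m volB by (simp flip: ennreal_plus)
      \<comment> \<open>Each parameter in the box is either bad or has increment at least one half,
        whence the factor 4.\<close>
      also have "\<dots> \<le> (\<integral>\<^sup>+u. indicator {y. 1 / 2 \<le> f y} (mul x (\<Psi> u)) + 4 * (?d x u * indicator B u) \<partial>lborel)"
      proof (rule nn_integral_mono)
        fix u
        show "indicator B u \<le> indicator {y. 1 / 2 \<le> f y} (mul x (\<Psi> u)) + 4 * (?d x u * indicator B u)"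
        proof (cases "1 / 2 \<le> f (mul x (\<Psi> u))")
          case False
          have "(1 / 2)\<^sup>2 \<le> (f (mul x (\<Psi> u)) - f x)\<^sup>2"
            using False True by (subst abs_le_square_iff[symmetric]) auto
          then have "1 \<le> 4 * (f (mul x (\<Psi> u)) - f x)\<^sup>2"
            by (simp add: power2_eq_square)
          then have "(1::ennreal) \<le> 4 * ?d x u"
            by (simp flip: ennreal_1 ennreal_numeral ennreal_mult')
          then show ?thesis
            by (auto simp: indicator_def)
        qed (auto simp: indicator_def)
      qed
      also have "\<dots> = (\<integral>\<^sup>+u. indicator {y. 1 / 2 \<le> f y} (mul x (\<Psi> u)) \<partial>lborel)
          + 4 * (\<integral>\<^sup>+u. ?d x u * indicator B u \<partial>lborel)"
        by (simp add: nn_integral_add nn_integral_cmult)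
      also have "\<dots> \<le> ennreal m + 4 * (\<integral>\<^sup>+u. ?d x u * indicator B u \<partial>lborel)"
        by (intro add_right_mono le)
      finally have "ennreal m \<le> 4 * (\<integral>\<^sup>+u. ?d x u * indicator B u \<partial>lborel)"
        by (simp add: ennreal_add_left_cancel_le)
      with True show ?thesis
        by simp
    qed simp
    have "ennreal m * emeasure lborel {x. 1 \<le> f x}
        = (\<integral>\<^sup>+x. ennreal m * indicator {x. 1 \<le> f x} x \<partial>lborel)"
      by (subst nn_integral_cmult) simp_all
    also have "\<dots> \<le> (\<integral>\<^sup>+x. 4 * (\<integral>\<^sup>+u. ?d x u * indicator B u \<partial>lborel) \<partial>lborel)"
      by (intro nn_integral_mono pt)
    also have "\<dots> = 4 * (\<integral>\<^sup>+x. (\<integral>\<^sup>+u. ?d x u * indicator B u \<partial>lborel) \<partial>lborel)"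
      by (rule nn_integral_cmult) measurable
    also have "(\<integral>\<^sup>+x. (\<integral>\<^sup>+u. ?d x u * indicator B u \<partial>lborel) \<partial>lborel)
        = (\<integral>\<^sup>+u. (\<integral>\<^sup>+x. ?d x u * indicator B u \<partial>lborel) \<partial>lborel)"
      by (rule lborel_pair.Fubini'[symmetric]) measurable
    also have "\<dots> \<le> (\<integral>\<^sup>+u. ennreal (C * t\<^sup>2) * energy f * indicator B u \<partial>lborel)"
    proof (rule nn_integral_mono)
      fix u
      show "(\<integral>\<^sup>+x. ?d x u * indicator B u \<partial>lborel) \<le> ennreal (C * t\<^sup>2) * energy f * indicator B u"
        using admB[of u] f by (auto simp: indicator_def admissible_def)
    qed
    also have "\<dots> = ennreal (C * t\<^sup>2) * energy f * ennreal (2 * m)"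
      by (subst nn_integral_cmult) (simp_all add: volB)
    also have "4 * \<dots> = ennreal m * (ennreal (8 * C * t\<^sup>2) * energy f)"
    proof -
      have 8: "ennreal (8 * C * t\<^sup>2) = (4 * 2) * ennreal (C * t\<^sup>2)" "ennreal (2 * m) = 2 * ennreal m"
        using ennreal_mult'[of 8 "C * t\<^sup>2"] ennreal_mult'[of 2 m] by (simp_all add: mult.assoc)
      show ?thesis
        unfolding 8 by (simp only: mult_ac)
    qed
    finally have "ennreal m * emeasure lborel {x. 1 \<le> f x} \<le> ennreal m * (ennreal (8 * C * t\<^sup>2) * energy f)"
      by (simp add: mult_left_mono)
    then have "emeasure lborel {x. 1 \<le> f x} \<le> ennreal (8 * C * t\<^sup>2) * energy f"
      using m by (subst (asm) ennreal_mult_le_mult_iff) auto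
    also have "8 * C * t\<^sup>2 = K * m powr (2 / real Q)"
    proof -
      have "t\<^sup>2 = (2 * m) powr (2 / real Q)"
        using m by (simp add: t_def powr_powr flip: powr_realpow)
      then show ?thesis
        using m by (simp add: K_def powr_mult)
    qed
    finally show "emeasure lborel {x. 1 \<le> f x} \<le> ennreal (K * m powr (2 / real Q)) * energy f" .
  qed
qed

lemma energy_cutoff:
  assumes f: "C1c f" and l: "l > 0"
  shows "energy (\<lambda>x. cutoff l (f x))
    \<le> ennreal ((6 / l)\<^sup>2) * (\<integral>\<^sup>+x. ennreal ((norm (grad_classical X f x))\<^sup>2) * indicator {l<..<2 * l} \<bar>f x\<bar> \<partial>lborel)"
proof -
  note [measurable] = C1c_measurable[OF f] grad_classical_measurable[OF f]
  have cutoff0: "cutoff l 0 = 0"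
    using cutoff_low[OF l] l by simp
  have grad: "grad_classical X (\<lambda>x. cutoff l (f x)) x = cutoff' l (f x) *\<^sub>R grad_classical X f x" for x
    by (simp add: grad_classical_def vec_eq_iff frechet_derivative_comp[OF f cutoff_derivative cutoff_continuous cutoff0])
  have "energy (\<lambda>x. cutoff l (f x))
      \<le> (\<integral>\<^sup>+x. ennreal ((6 / l)\<^sup>2) * (ennreal ((norm (grad_classical X f x))\<^sup>2) * indicator {l<..<2 * l} \<bar>f x\<bar>) \<partial>lborel)"
    unfolding energy_def grad
  proof (rule nn_integral_mono)
    fix x
    have "(norm (cutoff' l (f x) *\<^sub>R grad_classical X f x))\<^sup>2 = (cutoff' l (f x))\<^sup>2 * (norm (grad_classical X f x))\<^sup>2"
      by (simp add: power_mult_distrib)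
    also have "\<dots> \<le> ((6 / l)\<^sup>2 * indicator {l<..<2 * l} \<bar>f x\<bar>) * (norm (grad_classical X f x))\<^sup>2"
      by (intro mult_right_mono cutoff'_bound l) simp
    finally have "ennreal ((norm (cutoff' l (f x) *\<^sub>R grad_classical X f x))\<^sup>2)
      \<le> ennreal (((6 / l)\<^sup>2 * indicator {l<..<2 * l} \<bar>f x\<bar>) * (norm (grad_classical X f x))\<^sup>2)"
      by (rule ennreal_leI)
    also have "\<dots> = ennreal ((6 / l)\<^sup>2) * (ennreal ((norm (grad_classical X f x))\<^sup>2) * indicator {l<..<2 * l} \<bar>f x\<bar>)"
      by (auto simp: indicator_def ennreal_mult')
    finally show "ennreal ((norm (cutoff' l (f x) *\<^sub>R grad_classical X f x))\<^sup>2)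
      \<le> ennreal ((6 / l)\<^sup>2) * (ennreal ((norm (grad_classical X f x))\<^sup>2) * indicator {l<..<2 * l} \<bar>f x\<bar>)" .
  qed
  also have "\<dots> = ennreal ((6 / l)\<^sup>2) * (\<integral>\<^sup>+x. ennreal ((norm (grad_classical X f x))\<^sup>2) * indicator {l<..<2 * l} \<bar>f x\<bar> \<partial>lborel)"
    by (rule nn_integral_cmult) measurable
  finally show ?thesis .
qed

lemma Lp_finite:
  assumes f: "C1c f" and p: "0 < p"
  shows "(\<integral>\<^sup>+x. ennreal (\<bar>f x\<bar> powr p) \<partial>lborel) < \<infinity>"
proof -
  obtain R where R: "\<And>x. R < norm x \<Longrightarrow> f x = 0"
    using f by (auto simp: C1c_def)
  have "integrable lborel (\<lambda>x. \<bar>f x\<bar> powr p)"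
  proof (rule integrable_continuous_bounded_support)
    show "continuous_on UNIV (\<lambda>x. \<bar>f x\<bar> powr p)"
      using p by (intro continuous_on_powr' continuous_intros C1c_continuous f) auto
    show "\<bar>f x\<bar> powr p = 0" if "R < norm x" for x
      using R[OF that] by simp
  qed
  then show ?thesis
    by (simp add: integrable_iff_bounded)
qed

lemma C1c_bounded:
  assumes f: "C1c f"
  obtains B where "0 < B" "\<And>x. \<bar>f x\<bar> < B"
proof -
  obtain R where R: "\<And>x. R < norm x \<Longrightarrow> f x = 0"
    using f by (auto simp: C1c_def)
  have "compact (f ` cball 0 R)"
    by (intro compact_continuous_image C1c_continuous f compact_cball)
  then obtain b where b: "\<And>x. norm x \<le> R \<Longrightarrow> \<bar>f x\<bar> \<le> b"
    by (force dest!: compact_imp_bounded simp: bounded_iff)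
  show thesis
  proof (rule that[of "\<bar>b\<bar> + 1"])
    show "\<bar>f x\<bar> < \<bar>b\<bar> + 1" for x
      using R[of x] b[of x] by (cases "R < norm x") auto
  qed simp
qed

text \<open>The Folland-Stein inequality: the level estimate is applied to the truncations of \<open>f\<close> at
  the dyadic levels, whose gradients live on disjoint sets.\<close>

lemma sobolev:
  assumes Q: "3 \<le> Q" and p: "p = critical_exponent Q"
  obtains C where "0 \<le> C"
    "\<And>f. C1c f \<Longrightarrow> (\<integral>\<^sup>+x. ennreal (\<bar>f x\<bar> powr p) \<partial>lborel) \<le> ennreal (C * enn2real (energy f) powr (p / 2))"
proof -
  obtain K where K: "0 \<le> K" "\<And>f m. C1c f \<Longrightarrow> 0 < m \<Longrightarrow> emeasure lborel {x. 1 / 2 \<le> f x} \<le> ennreal m \<Longrightarrow>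
       emeasure lborel {x. 1 \<le> f x} \<le> ennreal (K * m powr (2 / real Q)) * energy f"
    by (rule level_estimate) blast
  have p2: "p > 2" and pQ: "1 - 2 / real Q = 2 / p"
    using Q by (simp_all add: p critical_exponent_def field_simps)
  have pQ': "p - p * (2 / real Q) = 2"
  proof -
    have "p - p * (2 / real Q) = p * (1 - 2 / real Q)"
      by (simp only: right_diff_distrib mult_1_right)
    then show ?thesis
      unfolding pQ using p2 by simp
  qed
  \<comment> \<open>\<open>4 powr p\<close> comes from comparing \<open>\<bar>f x\<bar>\<close> with
    \<open>4 * l j\<close>, and 36 is the square of the constant in the bound for
    \<open>cutoff'\<close>.\<close>
  define C1 where "C1 = 4 powr p * (36 * K)"
  have C1: "0 \<le> C1"
    using K(1) by (simp add: C1_def)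
  show thesis
  proof (rule that[of "C1 powr (p / 2)"])
    fix f :: "real^'n \<Rightarrow> real"
    assume f: "C1c f"
    note [measurable] = C1c_measurable[OF f] grad_classical_measurable[OF f]
    define I where "I = enn2real (\<integral>\<^sup>+x. ennreal (\<bar>f x\<bar> powr p) \<partial>lborel)"
    define N where "N = enn2real (energy f)"
    have I: "(\<integral>\<^sup>+x. ennreal (\<bar>f x\<bar> powr p) \<partial>lborel) = ennreal I" "0 \<le> I"
      using Lp_finite[OF f, of p] p2 by (simp_all add: I_def)
    have N: "energy f = ennreal N" "0 \<le> N"
      using energy_finite[OF f] by (simp_all add: N_def)
    have "I \<le> C1 powr (p / 2) * N powr (p / 2)"
    proof (cases "I = 0")
      case False
      with I have Ipos: "0 < I"
        by simp
      obtain b where b: "0 < b" "\<And>x. \<bar>f x\<bar> < b"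
        by (rule C1c_bounded[OF f]) blast
      \<comment> \<open>The top level satisfies \<open>4 * l 0 = b\<close>, an upper bound for
        \<open>\<bar>f\<bar>\<close>, so levels going downwards only are enough.\<close>
      define l where "l = (\<lambda>j::nat. b / 4 / 2 ^ j)"
      have l: "l j > 0" for j
        using b(1) by (simp add: l_def)
      define a where "a = (\<lambda>j. \<integral>\<^sup>+x. ennreal ((norm (grad_classical X f x))\<^sup>2) * indicator {l j<..<2 * l j} \<bar>f x\<bar> \<partial>lborel)"
      have level: "ennreal ((4 * l j) powr p) * emeasure lborel {x. 2 * l j \<le> \<bar>f x\<bar>} \<le> ennreal (C1 * I powr (2 / real Q)) * a j" for j
      proof -
        \<comment> \<open>Chebyshev's bound for the measure of the set where
          \<open>\<bar>f x\<bar> \<ge> l j\<close>.\<close>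
        define m where "m = I / l j powr p"
        have m: "m > 0"
          using Ipos l[of j] by (simp add: m_def)
        have g: "C1c (\<lambda>x. cutoff (l j) (f x))"
          using cutoff_low[OF l[of j], of 0] l[of j]
          by (intro C1c_comp[OF f cutoff_derivative cutoff_continuous]) simp
        have "ennreal (l j powr p) * emeasure lborel {x. 1 / 2 \<le> cutoff (l j) (f x)}
            \<le> ennreal (l j powr p) * emeasure lborel {x. l j \<le> \<bar>f x\<bar>}"
        proof (intro mult_left_mono emeasure_mono)
          show "{x. 1 / 2 \<le> cutoff (l j) (f x)} \<subseteq> {x. l j \<le> \<bar>f x\<bar>}"
          proof
            fix x
            assume "x \<in> {x. 1 / 2 \<le> cutoff (l j) (f x)}"
            then have "cutoff (l j) (f x) \<noteq> 0"
              by auto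
            then have "\<not> \<bar>f x\<bar> \<le> l j"
              using cutoff_low[OF l[of j]] by blast
            then show "x \<in> {x. l j \<le> \<bar>f x\<bar>}"
              by simp
          qed
        qed simp_all
        also have "\<dots> = (\<integral>\<^sup>+x. ennreal (l j powr p) * indicator {x. l j \<le> \<bar>f x\<bar>} x \<partial>lborel)"
          by (subst nn_integral_cmult) simp_all
        also have "\<dots> \<le> (\<integral>\<^sup>+x. ennreal (\<bar>f x\<bar> powr p) \<partial>lborel)"
          using l[of j] p2 by (intro nn_integral_mono) (auto simp: indicator_def intro!: ennreal_leI powr_mono2)
        also have "\<dots> = ennreal (l j powr p) * ennreal m"
          using l[of j] I(2) by (simp add: I(1) m_def flip: ennreal_mult)
        finally have "emeasure lborel {x. 1 / 2 \<le> cutoff (l j) (f x)} \<le> ennreal m"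
          using l[of j] by (subst (asm) ennreal_mult_le_mult_iff) auto
        from K(2)[OF g m this]
        have "emeasure lborel {x. 1 \<le> cutoff (l j) (f x)} \<le> ennreal (K * m powr (2 / real Q)) * energy (\<lambda>x. cutoff (l j) (f x))" .
        also have "\<dots> \<le> ennreal (K * m powr (2 / real Q)) * (ennreal ((6 / l j)\<^sup>2) * a j)"
          unfolding a_def by (intro mult_left_mono energy_cutoff f l) simp
        finally have est: "emeasure lborel {x. 1 \<le> cutoff (l j) (f x)} \<le> ennreal (K * m powr (2 / real Q)) * (ennreal ((6 / l j)\<^sup>2) * a j)" .
        have "emeasure lborel {x. 2 * l j \<le> \<bar>f x\<bar>} \<le> emeasure lborel {x. 1 \<le> cutoff (l j) (f x)}"
          using cutoff_high[OF l[of j]] C1c_measurable[OF g] by (intro emeasure_mono) auto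
        with est have "emeasure lborel {x. 2 * l j \<le> \<bar>f x\<bar>} \<le> ennreal (K * m powr (2 / real Q)) * (ennreal ((6 / l j)\<^sup>2) * a j)"
          by (rule order_trans[rotated])
        then have "ennreal ((4 * l j) powr p) * emeasure lborel {x. 2 * l j \<le> \<bar>f x\<bar>}
            \<le> ennreal ((4 * l j) powr p) * (ennreal (K * m powr (2 / real Q)) * (ennreal ((6 / l j)\<^sup>2) * a j))"
          by (rule mult_left_mono) simp
        also have "\<dots> = ennreal ((4 * l j) powr p * (K * m powr (2 / real Q)) * (6 / l j)\<^sup>2) * a j"
          using K(1) by (simp add: ennreal_mult mult.assoc)
        also have "(4 * l j) powr p * (K * m powr (2 / real Q)) * (6 / l j)\<^sup>2 = C1 * I powr (2 / real Q)"
        proof -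
          have 1: "m powr (2 / real Q) = I powr (2 / real Q) / l j powr (p * (2 / real Q))"
            using I(2) by (simp add: m_def powr_divide powr_powr)
          \<comment> \<open>Criticality of the exponent: all powers of \<open>l j\<close> cancel, so
            the bound is the same at every level and can be summed.\<close>
          have "p = p * (2 / real Q) + 2"
            using pQ' by simp
          then have 2: "l j powr p = l j powr (p * (2 / real Q)) * l j powr 2"
            by (metis powr_add)
          have "(4 * l j) powr p * (K * m powr (2 / real Q)) * (6 / l j)\<^sup>2
              = 4 powr p * (l j powr (p * (2 / real Q)) * (l j)\<^sup>2)
                * (K * (I powr (2 / real Q) / l j powr (p * (2 / real Q)))) * (36 / (l j)\<^sup>2)"
            using l[of j] by (simp only: 1 powr_mult 2) (simp add: power_divide)
          also have "\<dots> = C1 * I powr (2 / real Q)"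
            using l[of j] by (simp add: C1_def)
          finally show ?thesis .
        qed
        finally show ?thesis .
      qed
      \<comment> \<open>The term of the least \<open>j\<close> with
        \<open>2 * l j \<le> \<bar>f x\<bar>\<close> dominates on its own: minimality, or the bound
        \<open>b\<close> when \<open>j = 0\<close>, gives
        \<open>\<bar>f x\<bar> \<le> 4 * l j\<close>.\<close>
      have pt: "ennreal (\<bar>f x\<bar> powr p) \<le> (\<Sum>j. ennreal ((4 * l j) powr p) * indicator {x. 2 * l j \<le> \<bar>f x\<bar>} x)" for x
      proof (cases "f x = 0")
        case False
        have "\<exists>j. 2 * l j \<le> \<bar>f x\<bar>"
        proof -
          obtain j where "b / \<bar>f x\<bar> < 2 ^ j"
            using real_arch_pow[of 2 "b / \<bar>f x\<bar>"] by auto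
          then have "b / 2 ^ j < \<bar>f x\<bar>"
            using False by (simp add: field_simps)
          moreover have "2 * l j \<le> b / 2 ^ j"
            using b(1) by (simp add: l_def field_simps)
          ultimately show ?thesis
            by (intro exI[of _ j]) simp
        qed
        define j where "j = (LEAST j. 2 * l j \<le> \<bar>f x\<bar>)"
        have j: "2 * l j \<le> \<bar>f x\<bar>"
          unfolding j_def by (rule LeastI_ex) fact
        have "\<bar>f x\<bar> \<le> 4 * l j"
        proof (cases j)
          case 0
          then show ?thesis
            using b(2)[of x] by (simp add: l_def)
        next
          case (Suc i)
          then have "\<not> 2 * l i \<le> \<bar>f x\<bar>"
            using not_less_Least[of i "\<lambda>j. 2 * l j \<le> \<bar>f x\<bar>"] by (simp add: j_def)
          then show ?thesis
            using Suc by (simp add: l_def)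
        qed
        then have "ennreal (\<bar>f x\<bar> powr p) \<le> ennreal ((4 * l j) powr p) * indicator {x. 2 * l j \<le> \<bar>f x\<bar>} x"
          using j p2 by (auto intro!: ennreal_leI powr_mono2)
        also have "\<dots> \<le> (\<Sum>j. ennreal ((4 * l j) powr p) * indicator {x. 2 * l j \<le> \<bar>f x\<bar>} x)"
        proof -
          have "F j \<le> suminf F" for F :: "nat \<Rightarrow> ennreal"
            using sum_le_suminf[of F "{j}"] by simp
          then show ?thesis .
        qed
        finally show ?thesis .
      qed simp
      \<comment> \<open>Consecutive dyadic shells meet only in endpoints, and the shells are open;
        hence the truncated energies add up to at most one copy of the energy.\<close>
      have disj: "(\<Sum>j. indicator {l j<..<2 * l j} s) \<le> (1::ennreal)" for s
      proof -
        have "disjoint_family (\<lambda>j. {l j<..<2 * l j})"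
        proof -
          have "{l i<..<2 * l i} \<inter> {l j<..<2 * l j} = {}" if "i < j" for i j
          proof -
            have "2 * l j \<le> l i"
              using power_increasing[of "Suc i" j "2::real"] that b(1) by (simp add: l_def field_simps)
            then show ?thesis
              by auto
          qed
          then have "{l i<..<2 * l i} \<inter> {l j<..<2 * l j} = {}" if "i \<noteq> j" for i j
            using that by (cases "i < j") (simp, metis Int_commute linorder_neqE_nat)
          then show ?thesis
            by (simp only: disjoint_family_on_def) blast
        qed
        then have "(\<Sum>j. indicator {l j<..<2 * l j} s) = (indicator (\<Union>j. {l j<..<2 * l j}) s :: ennreal)"
          by (rule suminf_indicator)
        then show ?thesis
          by (simp add: indicator_def)
      qed
      have "ennreal I \<le> (\<integral>\<^sup>+x. (\<Sum>j. ennreal ((4 * l j) powr p) * indicator {x. 2 * l j \<le> \<bar>f x\<bar>} x) \<partial>lborel)"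
        unfolding I(1)[symmetric] by (intro nn_integral_mono pt)
      also have "\<dots> = (\<Sum>j. \<integral>\<^sup>+x. ennreal ((4 * l j) powr p) * indicator {x. 2 * l j \<le> \<bar>f x\<bar>} x \<partial>lborel)"
        by (rule nn_integral_suminf) measurable
      also have "\<dots> = (\<Sum>j. ennreal ((4 * l j) powr p) * emeasure lborel {x. 2 * l j \<le> \<bar>f x\<bar>})"
        by (simp add: nn_integral_cmult)
      also have "\<dots> \<le> (\<Sum>j. ennreal (C1 * I powr (2 / real Q)) * a j)"
        by (intro suminf_le level summableI)
      also have "\<dots> = ennreal (C1 * I powr (2 / real Q)) * (\<Sum>j. a j)"
        by (rule ennreal_suminf_cmult)
      also have "(\<Sum>j. a j) = (\<integral>\<^sup>+x. (\<Sum>j. ennreal ((norm (grad_classical X f x))\<^sup>2) * indicator {l j<..<2 * l j} \<bar>f x\<bar>) \<partial>lborel)"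
        unfolding a_def by (rule nn_integral_suminf[symmetric]) measurable
      also have "\<dots> \<le> energy f"
        unfolding energy_def
      proof (rule nn_integral_mono)
        fix x
        show "(\<Sum>j. ennreal ((norm (grad_classical X f x))\<^sup>2) * indicator {l j<..<2 * l j} \<bar>f x\<bar>)
            \<le> ennreal ((norm (grad_classical X f x))\<^sup>2)"
          unfolding ennreal_suminf_cmult
          using mult_left_mono[OF disj[of "\<bar>f x\<bar>"], of "ennreal ((norm (grad_classical X f x))\<^sup>2)"] by simp
      qed
      finally have "ennreal I \<le> ennreal (C1 * I powr (2 / real Q)) * ennreal N"
        by (simp add: mult_left_mono N(1))
      then have "I \<le> C1 * I powr (2 / real Q) * N"
        using C1 N(2) by (simp flip: ennreal_mult)
      \<comment> \<open>The exponents \<open>2 / p\<close> and \<open>2 / Q\<close> add up to 1, so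
        the power of \<open>I\<close> on the right can be cancelled; this needs \<open>I\<close> to
        be positive and finite.\<close>
      moreover have "I = I powr (2 / p) * I powr (2 / real Q)"
        using Ipos by (simp flip: powr_add pQ)
      ultimately have "I powr (2 / p) * I powr (2 / real Q) \<le> (C1 * N) * I powr (2 / real Q)"
        by (simp add: mult_ac)
      then have "I powr (2 / p) \<le> C1 * N"
        using Ipos by (simp add: mult_le_cancel_right)
      then have "(I powr (2 / p)) powr (p / 2) \<le> (C1 * N) powr (p / 2)"
        using p2 by (intro powr_mono2) auto
      then show ?thesis
        using p2 C1 N(2) Ipos by (simp add: powr_powr powr_mult)
    qed simp
    then show "(\<integral>\<^sup>+x. ennreal (\<bar>f x\<bar> powr p) \<partial>lborel) \<le> ennreal (C1 powr (p / 2) * enn2real (energy f) powr (p / 2))"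
      unfolding I(1) N_def by (rule ennreal_leI)
  qed simp
qed

end

section \<open>Integration\<close>

text \<open>Riesz-Fischer, stated with nonnegative integrals. A rapidly converging subsequence
  converges almost everywhere, and Fatou's lemma turns the Cauchy bounds into bounds for the
  distance to its limit.\<close>

lemma L2_complete:
  fixes g :: "nat \<Rightarrow> 'a \<Rightarrow> 'b::euclidean_space"
  assumes "finite_measure M" and g[measurable]: "\<And>j. g j \<in> borel_measurable M"
    and cauchy: "\<And>\<epsilon>. \<epsilon> > 0 \<Longrightarrow> \<exists>N. \<forall>j\<ge>N. \<forall>k\<ge>N. (\<integral>\<^sup>+x. ennreal ((norm (g j x - g k x))\<^sup>2) \<partial>M) \<le> ennreal \<epsilon>"
  obtains G where "G \<in> borel_measurable M" "(\<lambda>j. \<integral>\<^sup>+x. ennreal ((norm (g j x - G x))\<^sup>2) \<partial>M) \<longlonglongrightarrow> 0"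
proof -
  interpret finite_measure M by fact
  have "\<exists>n. \<forall>k. \<forall>i\<ge>n k. \<forall>j\<ge>n k. (\<integral>\<^sup>+x. ennreal ((norm (g i x - g j x))\<^sup>2) \<partial>M) \<le> ennreal ((1/4) ^ k)"
    by (intro choice allI cauchy) simp
  then obtain n where n: "\<And>k i j. n k \<le> i \<Longrightarrow> n k \<le> j \<Longrightarrow> (\<integral>\<^sup>+x. ennreal ((norm (g i x - g j x))\<^sup>2) \<partial>M) \<le> ennreal ((1/4) ^ k)"
    by blast
  \<comment> \<open>Partial sums make the indices monotone while still dominating each
    \<open>n k\<close>.\<close>
  define m where "m = (\<lambda>k. \<Sum>i\<le>k. n i)"
  have m: "n k \<le> m k" "m k \<le> m (Suc k)" "n k \<le> m l" if "k \<le> l" for k l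
  proof -
    show "n k \<le> m k"
      unfolding m_def by (rule member_le_sum) auto
    show "m k \<le> m (Suc k)"
      by (simp add: m_def)
    show "n k \<le> m l"
      unfolding m_def using that by (intro member_le_sum) auto
  qed
  define h where "h = (\<lambda>k x. norm (g (m (Suc k)) x - g (m k) x))"
  have [measurable]: "h k \<in> borel_measurable M" for k
    unfolding h_def by measurable
  have h2: "(\<integral>\<^sup>+x. ennreal ((h k x)\<^sup>2) \<partial>M) \<le> ennreal ((1/4) ^ k)" for k
    unfolding h_def by (rule n) (use m[of k k] in auto)
  have h1: "(\<integral>\<^sup>+x. ennreal (h k x) \<partial>M) \<le> ennreal ((measure M (space M) + 1) * (1/2) ^ k)" for k
  proof -
    have "(\<integral>\<^sup>+x. ennreal (h k x) \<partial>M) \<le> (\<integral>\<^sup>+x. ennreal ((1/2) ^ k) + ennreal (2 ^ k) * ennreal ((h k x)\<^sup>2) \<partial>M)"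
    proof (rule nn_integral_mono)
      fix x
      \<comment> \<open>This square bounds \<open>h k x\<close> by \<open>(1/2) ^ k\<close> plus
        \<open>2 ^ k\<close> times its square, so that the squared bound of order
        \<open>(1/4) ^ k\<close> becomes an integral bound of order \<open>(1/2) ^ k\<close> on a
        finite measure space.\<close>
      have "0 \<le> (1 - 2 ^ k * h k x)\<^sup>2"
        by simp
      then have "2 * (2 ^ k * h k x) \<le> 1 + (2 ^ k * h k x)\<^sup>2"
        by (simp add: power2_diff)
      moreover have "0 \<le> 2 ^ k * h k x"
        by (simp add: h_def)
      ultimately have "2 ^ k * h k x \<le> 1 + 2 ^ k * (2 ^ k * (h k x)\<^sup>2)"
        by (simp add: power_mult_distrib power2_eq_square mult_ac)
      then have "h k x \<le> (1 + 2 ^ k * (2 ^ k * (h k x)\<^sup>2)) / 2 ^ k"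
        by (simp add: pos_le_divide_eq mult.commute)
      then have "h k x \<le> (1/2) ^ k + 2 ^ k * (h k x)\<^sup>2"
        by (simp add: add_divide_distrib power_divide)
      then show "ennreal (h k x) \<le> ennreal ((1/2) ^ k) + ennreal (2 ^ k) * ennreal ((h k x)\<^sup>2)"
        by (simp add: ennreal_leI flip: ennreal_plus ennreal_mult)
    qed
    also have "\<dots> = ennreal ((1/2) ^ k) * emeasure M (space M) + ennreal (2 ^ k) * (\<integral>\<^sup>+x. ennreal ((h k x)\<^sup>2) \<partial>M)"
      by (simp add: nn_integral_add nn_integral_cmult)
    also have "\<dots> \<le> ennreal ((1/2) ^ k) * emeasure M (space M) + ennreal (2 ^ k) * ennreal ((1/4) ^ k)"
      by (intro add_left_mono mult_left_mono h2) simp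
    also have "\<dots> = ennreal ((1/2) ^ k * measure M (space M) + 2 ^ k * (1/4) ^ k)"
      by (simp add: emeasure_eq_measure ennreal_mult)
    also have "(1/2) ^ k * measure M (space M) + 2 ^ k * (1/4) ^ k = (measure M (space M) + 1) * (1/2 :: real) ^ k"
      by (simp add: algebra_simps flip: power_mult_distrib)
    finally show ?thesis .
  qed
  have "(\<integral>\<^sup>+x. (\<Sum>k. ennreal (h k x)) \<partial>M) = (\<Sum>k. \<integral>\<^sup>+x. ennreal (h k x) \<partial>M)"
    by (rule nn_integral_suminf) measurable
  also have "\<dots> \<le> (\<Sum>k. ennreal ((measure M (space M) + 1) * (1/2) ^ k))"
    by (intro suminf_le h1 summableI)
  also have "\<dots> < \<infinity>"
  proof -
    have "summable (\<lambda>k. (measure M (space M) + 1) * (1/2) ^ k)"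
      by (intro summable_mult summable_geometric) simp
    then show ?thesis
      by (subst suminf_ennreal2) auto
  qed
  finally have "AE x in M. (\<Sum>k. ennreal (h k x)) \<noteq> \<infinity>"
    by (intro nn_integral_PInf_AE) auto
  then have conv: "AE x in M. convergent (\<lambda>k. g (m k) x)"
  proof eventually_elim
    case (elim x)
    then have "summable (\<lambda>k. norm (g (m (Suc k)) x - g (m k) x))"
      using summable_suminf_not_top[of "\<lambda>k. h k x"] by (simp add: h_def)
    then have "summable (\<lambda>k. g (m (Suc k)) x - g (m k) x)"
      by (rule summable_norm_cancel)
    then have "convergent (\<lambda>N. \<Sum>k<N. g (m (Suc k)) x - g (m k) x)"
      by (simp add: summable_iff_convergent)
    then have "convergent (\<lambda>N. g (m N) x - g (m 0) x)"
      by (simp add: sum_lessThan_telescope[of "\<lambda>k. g (m k) x"])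
    then have "convergent (\<lambda>N. (g (m N) x - g (m 0) x) + g (m 0) x)"
      by (intro convergent_add convergent_const)
    then show ?case
      by simp
  qed
  define G where "G = (\<lambda>x. lim (\<lambda>k. g (m k) x))"
  have G[measurable]: "G \<in> borel_measurable M"
    unfolding G_def by (rule borel_measurable_lim_metric) measurable
  have bound: "(\<integral>\<^sup>+x. ennreal ((norm (g j x - G x))\<^sup>2) \<partial>M) \<le> ennreal ((1/4) ^ k)" if "n k \<le> j" for j k
  proof -
    have "(\<integral>\<^sup>+x. ennreal ((norm (g j x - G x))\<^sup>2) \<partial>M)
        \<le> (\<integral>\<^sup>+x. liminf (\<lambda>l. ennreal ((norm (g j x - g (m l) x))\<^sup>2)) \<partial>M)"
    proof (rule nn_integral_mono_AE, use conv in eventually_elim)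
      case (elim x)
      then have "(\<lambda>l. g (m l) x) \<longlonglongrightarrow> G x"
        by (simp add: G_def convergent_LIMSEQ_iff)
      then have "(\<lambda>l. ennreal ((norm (g j x - g (m l) x))\<^sup>2)) \<longlonglongrightarrow> ennreal ((norm (g j x - G x))\<^sup>2)"
        by (intro tendsto_intros)
      from lim_imp_Liminf[OF sequentially_bot this] show ?case
        by simp
    qed
    also have "\<dots> \<le> liminf (\<lambda>l. \<integral>\<^sup>+x. ennreal ((norm (g j x - g (m l) x))\<^sup>2) \<partial>M)"
      by (rule nn_integral_liminf) measurable
    also have "\<dots> \<le> ennreal ((1/4) ^ k)"
    proof -
      have "\<forall>\<^sub>F l in sequentially. (\<integral>\<^sup>+x. ennreal ((norm (g j x - g (m l) x))\<^sup>2) \<partial>M) \<le> ennreal ((1/4) ^ k)"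
        using eventually_ge_at_top[of k] by eventually_elim (intro n that m)
      then show ?thesis
        by (rule Liminf_le[rotated]) simp
    qed
    finally show ?thesis .
  qed
  have "(\<lambda>j. \<integral>\<^sup>+x. ennreal ((norm (g j x - G x))\<^sup>2) \<partial>M) \<longlonglongrightarrow> 0"
  proof (rule order_tendstoI)
    fix a :: ennreal
    assume "0 < a"
    have "(\<lambda>k. ennreal ((1/4) ^ k)) \<longlonglongrightarrow> ennreal 0"
      by (intro tendsto_ennrealI LIMSEQ_power_zero) simp
    then have "\<forall>\<^sub>F k in sequentially. ennreal ((1/4) ^ k) < a"
      using \<open>0 < a\<close> by (intro order_tendstoD) auto
    then obtain k where k: "ennreal ((1/4) ^ k) < a"
      by (auto simp: eventually_sequentially)
    show "\<forall>\<^sub>F j in sequentially. (\<integral>\<^sup>+x. ennreal ((norm (g j x - G x))\<^sup>2) \<partial>M) < a"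
      using eventually_ge_at_top[of "n k"] by eventually_elim (use bound k in \<open>auto intro: le_less_trans\<close>)
  qed simp
  with G that show thesis
    by blast
qed

text \<open>Young's inequality applied after dividing both functions by their integrals; if one
  integral is 0, the product vanishes almost everywhere. Exponents with sum 1 on integrable
  functions fit the weighted integrals used later.\<close>

lemma Hoelder:
  fixes f g :: "'a \<Rightarrow> real"
  assumes f: "integrable M f" "\<And>x. 0 \<le> f x" and g: "integrable M g" "\<And>x. 0 \<le> g x"
    and ab: "0 < a" "0 < b" "a + b = 1"
  shows Hoelder_integrable: "integrable M (\<lambda>x. f x powr a * g x powr b)"
    and Hoelder_le: "(\<integral>x. f x powr a * g x powr b \<partial>M) \<le> (\<integral>x. f x \<partial>M) powr a * (\<integral>x. g x \<partial>M) powr b"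
proof -
  note [measurable] = borel_measurable_integrable[OF f(1)] borel_measurable_integrable[OF g(1)]
  have young: "s powr a * t powr b \<le> a * s + b * t" if "0 \<le> s" "0 \<le> t" for s t
  proof (cases "s = 0 \<or> t = 0")
    case False
    with that ab show ?thesis
      by (intro Youngs_inequality_0) auto
  qed (use that ab in auto)
  show int: "integrable M (\<lambda>x. f x powr a * g x powr b)"
  proof (rule Bochner_Integration.integrable_bound)
    show "integrable M (\<lambda>x. a * f x + b * g x)"
      using f g by simp
    show "AE x in M. norm (f x powr a * g x powr b) \<le> norm (a * f x + b * g x)"
      using young f(2) g(2) ab by (auto intro!: AE_I2)
  qed measurable
  let ?F = "\<integral>x. f x \<partial>M" and ?G = "\<integral>x. g x \<partial>M"
  show "(\<integral>x. f x powr a * g x powr b \<partial>M) \<le> ?F powr a * ?G powr b"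
  proof (cases "?F = 0 \<or> ?G = 0")
    case True
    then have "AE x in M. f x = 0 \<or> g x = 0"
    proof
      assume "?F = 0"
      then have "AE x in M. f x = 0"
        using integral_nonneg_eq_0_iff_AE[OF f(1)] f(2) by auto
      then show ?thesis
        by eventually_elim simp
    next
      assume "?G = 0"
      then have "AE x in M. g x = 0"
        using integral_nonneg_eq_0_iff_AE[OF g(1)] g(2) by auto
      then show ?thesis
        by eventually_elim simp
    qed
    then have "AE x in M. f x powr a * g x powr b = 0"
      by eventually_elim auto
    then have "(\<integral>x. f x powr a * g x powr b \<partial>M) = 0"
      by (rule integral_eq_zero_AE)
    then show ?thesis
      by simp
  next
    case False
    then have pos: "?F > 0" "?G > 0"
      using f g by (simp_all add: less_le)
    have "(\<integral>x. f x powr a * g x powr b \<partial>M) \<le> (\<integral>x. ?F powr a * ?G powr b * (a / ?F * f x + b / ?G * g x) \<partial>M)"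
    proof (rule integral_mono[OF int])
      show "integrable M (\<lambda>x. ?F powr a * ?G powr b * (a / ?F * f x + b / ?G * g x))"
        using f g by simp
      fix x
      have "f x powr a * g x powr b = ?F powr a * ?G powr b * ((f x / ?F) powr a * (g x / ?G) powr b)"
        using pos f(2) g(2) by (simp add: powr_divide)
      also have "\<dots> \<le> ?F powr a * ?G powr b * (a * (f x / ?F) + b * (g x / ?G))"
        using pos f(2) g(2) by (intro mult_left_mono young) auto
      finally show "f x powr a * g x powr b \<le> ?F powr a * ?G powr b * (a / ?F * f x + b / ?G * g x)"
        by simp
    qed
    also have "\<dots> = ?F powr a * ?G powr b * (a / ?F * ?F + b / ?G * ?G)"
      using f g by simp
    also have "\<dots> = ?F powr a * ?G powr b"
      using pos ab by simp
    finally show ?thesis .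
  qed
qed

section \<open>Taylor remainder of a power\<close>

lemma powr_mean_value:
  fixes x y q :: real
  assumes "0 < x" "0 < y"
  obtains c where "min x y \<le> c" "c \<le> max x y" "y powr q - x powr q = q * c powr (q - 1) * (y - x)"
proof -
  have d: "((\<lambda>t. t powr q) has_real_derivative q * t powr (q - 1)) (at t)" if "0 < t" for t
    using that by (rule has_real_derivative_powr)
  consider "x < y" | "y < x" | "x = y"
    by linarith
  then show thesis
  proof cases
    case 1
    obtain c where "x < c" "c < y" "y powr q - x powr q = (y - x) * (q * c powr (q - 1))"
      using MVT2[OF 1, of "\<lambda>t. t powr q" "\<lambda>t. q * t powr (q - 1)"] d assms by fastforce
    then show thesis
      by (intro that[of c]) (auto simp: mult_ac)
  next
    case 2
    obtain c where "y < c" "c < x" "x powr q - y powr q = (x - y) * (q * c powr (q - 1))"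
      using MVT2[OF 2, of "\<lambda>t. t powr q" "\<lambda>t. q * t powr (q - 1)"] d assms by fastforce
    then show thesis
      by (intro that[of c]) (auto simp: algebra_simps)
  next
    case 3
    then show thesis
      by (intro that[of x]) auto
  qed
qed

text \<open>Two applications of the mean value theorem, to the power and to its derivative. The
  intermediate point \<open>c\<close> lies between \<open>x\<close> and \<open>y\<close>, so
  \<open>(c - x) * (y - x)\<close> is nonnegative and at most the square of
  \<open>y - x\<close>.\<close>

lemma powr_taylor_pos:
  fixes x y p :: real
  assumes p: "2 < p" and xy: "0 < x" "0 < y"
  shows "y powr p - x powr p - p * x powr (p - 1) * (y - x)
    \<le> p * (p - 1) * (x powr (p - 2) + y powr (p - 2)) * (y - x)\<^sup>2"
proof -
  obtain c where c: "min x y \<le> c" "c \<le> max x y" "y powr p - x powr p = p * c powr (p - 1) * (y - x)"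
    by (rule powr_mean_value[OF xy])
  have "0 < c"
    using c(1) xy by linarith
  obtain d where d: "min x c \<le> d" "d \<le> max x c" "c powr (p - 1) - x powr (p - 1) = (p - 1) * d powr (p - 1 - 1) * (c - x)"
    by (rule powr_mean_value[OF xy(1) \<open>0 < c\<close>])
  have "0 < d" "d \<le> max x y"
    using c d xy by linarith+
  then have "d powr (p - 2) \<le> (max x y) powr (p - 2)"
    using p by (intro powr_mono2) auto
  also have "\<dots> \<le> x powr (p - 2) + y powr (p - 2)"
    by (simp add: max_def)
  finally have dle: "d powr (p - 2) \<le> x powr (p - 2) + y powr (p - 2)" .
  have cx: "(c - x) * (y - x) \<le> (y - x)\<^sup>2" "0 \<le> (c - x) * (y - x)"
  proof -
    have "0 \<le> (y - c) * (y - x)" "0 \<le> (c - x) * (y - x)"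
      using c(1,2) by (cases "x \<le> y"; auto simp: zero_le_mult_iff)+
    then show "(c - x) * (y - x) \<le> (y - x)\<^sup>2" "0 \<le> (c - x) * (y - x)"
      by (auto simp: power2_eq_square algebra_simps)
  qed
  have "y powr p - x powr p - p * x powr (p - 1) * (y - x) = p * (c powr (p - 1) - x powr (p - 1)) * (y - x)"
    unfolding c(3) by (simp add: algebra_simps)
  also have "\<dots> = p * (p - 1) * d powr (p - 2) * ((c - x) * (y - x))"
    unfolding d(3) by (simp add: algebra_simps)
  also have "\<dots> \<le> p * (p - 1) * (x powr (p - 2) + y powr (p - 2)) * (y - x)\<^sup>2"
    by (rule mult_mono[OF mult_left_mono[OF dle] cx(1)]) (use p cx(2) in auto)
  finally show ?thesis .
qed

lemma powr_taylor:
  fixes x y p :: real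
  assumes p: "2 < p"
  shows "\<bar>y\<bar> powr p - \<bar>x\<bar> powr p - p * (\<bar>x\<bar> powr (p - 2) * x) * (y - x)
    \<le> p * (p - 1) * (\<bar>x\<bar> powr (p - 2) + \<bar>y\<bar> powr (p - 2)) * (y - x)\<^sup>2"
proof -
  have split: "\<bar>s\<bar> powr p = \<bar>s\<bar> powr (p - 2) * s\<^sup>2" for s :: real
    using powr_add[of "\<bar>s\<bar>" "p - 2" 2] by (cases "s = 0") simp_all
  have split1: "s powr (p - 1) = s powr (p - 2) * s" if "0 < s" for s :: real
    using powr_add[of s "p - 2" 1] that by simp
  consider "x * y \<le> 0" | "0 < x" "0 < y" | "x < 0" "y < 0"
    by (metis linorder_not_less mult_le_0_iff less_eq_real_def)
  then show ?thesis
  proof cases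
    case 1
    have "p * (\<bar>x\<bar> powr (p - 2) * x) * (x - y) = p * \<bar>x\<bar> powr (p - 2) * (x\<^sup>2 - x * y)"
      by (simp add: algebra_simps power2_eq_square)
    also have "\<dots> \<le> p * \<bar>x\<bar> powr (p - 2) * (y - x)\<^sup>2"
    proof (rule mult_left_mono)
      have "x * y \<le> y * y"
        using 1 zero_le_square[of y] by linarith
      then show "x\<^sup>2 - x * y \<le> (y - x)\<^sup>2"
        by (simp add: power2_eq_square algebra_simps)
    qed (use p in simp)
    finally have a: "p * (\<bar>x\<bar> powr (p - 2) * x) * (x - y) \<le> p * \<bar>x\<bar> powr (p - 2) * (y - x)\<^sup>2" .
    have "2 * (x * y) \<le> x * x"
      using 1 zero_le_square[of x] by linarith
    then have "y\<^sup>2 \<le> (y - x)\<^sup>2"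
      by (simp add: power2_eq_square algebra_simps)
    then have b: "\<bar>y\<bar> powr p \<le> \<bar>y\<bar> powr (p - 2) * (y - x)\<^sup>2"
      unfolding split[of y] by (intro mult_left_mono) auto
    have "1 * p \<le> (p - 1) * p"
      using p by (intro mult_right_mono) auto
    then have "p \<le> p * (p - 1)"
      by (simp add: mult.commute)
    then have pp: "p \<le> p * (p - 1)" "1 \<le> p * (p - 1)"
      using p by linarith+
    have "\<bar>y\<bar> powr p - \<bar>x\<bar> powr p - p * (\<bar>x\<bar> powr (p - 2) * x) * (y - x)
        \<le> \<bar>y\<bar> powr p + p * (\<bar>x\<bar> powr (p - 2) * x) * (x - y)"
      by (simp add: algebra_simps)
    also have "\<dots> \<le> 1 * (\<bar>y\<bar> powr (p - 2) * (y - x)\<^sup>2) + p * (\<bar>x\<bar> powr (p - 2) * (y - x)\<^sup>2)"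
      using a b by simp
    also have "\<dots> \<le> p * (p - 1) * (\<bar>y\<bar> powr (p - 2) * (y - x)\<^sup>2) + p * (p - 1) * (\<bar>x\<bar> powr (p - 2) * (y - x)\<^sup>2)"
      by (intro add_mono mult_right_mono pp) auto
    finally show ?thesis
      by (simp add: algebra_simps)
  next
    case 2
    then show ?thesis
      using powr_taylor_pos[OF p 2] by (simp add: split1)
  next
    case 3
    then have "0 < - x" "0 < - y"
      by auto
    from powr_taylor_pos[OF p this] 3 show ?thesis
      by (simp add: split1 power2_commute algebra_simps)
  qed
qed

section \<open>Quasi-triangle inequality and convergence in the mean\<close>

lemma powr_add_le:
  fixes a b s :: real
  assumes "0 < s" "0 \<le> a" "0 \<le> b"
  shows "(a + b) powr s \<le> 2 powr s * (a powr s + b powr s)"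
proof -
  have "(a + b) powr s \<le> (2 * max a b) powr s"
    using assms by (intro powr_mono2) auto
  also have "\<dots> = 2 powr s * (max a b) powr s"
    using assms by (simp add: powr_mult)
  also have "\<dots> \<le> 2 powr s * (a powr s + b powr s)"
    by (intro mult_left_mono) (auto simp: max_def)
  finally show ?thesis .
qed

lemma nn_integral_powr_add_le:
  fixes f g :: "'a \<Rightarrow> 'b::euclidean_space"
  assumes s: "0 < s" and [measurable]: "f \<in> borel_measurable M" "g \<in> borel_measurable M"
  shows "(\<integral>\<^sup>+x. ennreal (norm (f x + g x) powr s) \<partial>M)
    \<le> ennreal (2 powr s) * ((\<integral>\<^sup>+x. ennreal (norm (f x) powr s) \<partial>M) + (\<integral>\<^sup>+x. ennreal (norm (g x) powr s) \<partial>M))"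
proof -
  have "(\<integral>\<^sup>+x. ennreal (norm (f x + g x) powr s) \<partial>M)
      \<le> (\<integral>\<^sup>+x. ennreal (2 powr s) * (ennreal (norm (f x) powr s) + ennreal (norm (g x) powr s)) \<partial>M)"
  proof (rule nn_integral_mono)
    fix x
    have "norm (f x + g x) powr s \<le> (norm (f x) + norm (g x)) powr s"
      using s by (intro powr_mono2 norm_triangle_ineq) auto
    also have "\<dots> \<le> 2 powr s * (norm (f x) powr s + norm (g x) powr s)"
      by (rule powr_add_le) (use s in auto)
    finally show "ennreal (norm (f x + g x) powr s) \<le> ennreal (2 powr s) * (ennreal (norm (f x) powr s) + ennreal (norm (g x) powr s))"
      by (simp add: ennreal_leI flip: ennreal_plus ennreal_mult)
  qed
  also have "\<dots> = ennreal (2 powr s) * ((\<integral>\<^sup>+x. ennreal (norm (f x) powr s) \<partial>M) + (\<integral>\<^sup>+x. ennreal (norm (g x) powr s) \<partial>M))"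
    by (simp add: nn_integral_add nn_integral_cmult)
  finally show ?thesis .
qed

lemma Lp_converges_add:
  assumes s: "0 < s" and f: "Lp_converges s D f g" "\<And>j. f j \<in> borel_measurable (lebesgue_on D)"
    and f': "Lp_converges s D f' g'" "\<And>j. f' j \<in> borel_measurable (lebesgue_on D)"
  shows "Lp_converges s D (\<lambda>j x. f j x + f' j x) (\<lambda>x. g x + g' x)"
  unfolding Lp_converges_def
proof
  note [measurable] = f(2) f'(2)
  have g[measurable]: "g \<in> borel_measurable (lebesgue_on D)" "g' \<in> borel_measurable (lebesgue_on D)"
    using f f' by (auto simp: Lp_converges_def)
  show "(\<lambda>x. g x + g' x) \<in> borel_measurable (lebesgue_on D)"
    by measurable
  let ?I = "\<lambda>f. \<integral>\<^sup>+x. ennreal (norm (f x) powr s) \<partial>lebesgue_on D"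
  have "(\<lambda>j. ennreal (2 powr s) * (?I (\<lambda>x. f j x - g x) + ?I (\<lambda>x. f' j x - g' x))) \<longlonglongrightarrow> ennreal (2 powr s) * (0 + 0)"
    using f(1) f'(1) unfolding Lp_converges_def by (intro ennreal_tendsto_cmult tendsto_add) auto
  then have lim: "(\<lambda>j. ennreal (2 powr s) * (?I (\<lambda>x. f j x - g x) + ?I (\<lambda>x. f' j x - g' x))) \<longlonglongrightarrow> 0"
    by simp
  show "(\<lambda>j. ?I (\<lambda>x. f j x + f' j x - (g x + g' x))) \<longlonglongrightarrow> 0"
  proof (rule tendsto_sandwich[OF _ _ tendsto_const lim])
    show "\<forall>\<^sub>F j in sequentially. ?I (\<lambda>x. f j x + f' j x - (g x + g' x))
      \<le> ennreal (2 powr s) * (?I (\<lambda>x. f j x - g x) + ?I (\<lambda>x. f' j x - g' x))"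
      using nn_integral_powr_add_le[OF s, of "\<lambda>x. f _ x - g x" "lebesgue_on D" "\<lambda>x. f' _ x - g' x"]
      by (intro always_eventually allI) (simp add: add_diff_add)
  qed simp
qed

lemma Lp_converges_scale:
  assumes f: "Lp_converges s D f g" "\<And>j. f j \<in> borel_measurable (lebesgue_on D)"
  shows "Lp_converges s D (\<lambda>j x. c *\<^sub>R f j x) (\<lambda>x. c *\<^sub>R g x)"
  unfolding Lp_converges_def
proof
  note [measurable] = f(2)
  have g[measurable]: "g \<in> borel_measurable (lebesgue_on D)"
    using f by (auto simp: Lp_converges_def)
  show "(\<lambda>x. c *\<^sub>R g x) \<in> borel_measurable (lebesgue_on D)"
    by measurable
  have "(\<integral>\<^sup>+x. ennreal (norm (c *\<^sub>R f j x - c *\<^sub>R g x) powr s) \<partial>lebesgue_on D)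
      = ennreal (\<bar>c\<bar> powr s) * (\<integral>\<^sup>+x. ennreal (norm (f j x - g x) powr s) \<partial>lebesgue_on D)" for j
  proof -
    have "norm (c *\<^sub>R f j x - c *\<^sub>R g x) powr s = \<bar>c\<bar> powr s * norm (f j x - g x) powr s" for x
      by (simp add: powr_mult flip: scaleR_diff_right)
    then show ?thesis
      by (simp add: ennreal_mult nn_integral_cmult)
  qed
  moreover have "(\<lambda>j. ennreal (\<bar>c\<bar> powr s) * (\<integral>\<^sup>+x. ennreal (norm (f j x - g x) powr s) \<partial>lebesgue_on D))
      \<longlonglongrightarrow> ennreal (\<bar>c\<bar> powr s) * 0"
    using f(1) unfolding Lp_converges_def by (intro ennreal_tendsto_cmult) auto
  ultimately show "(\<lambda>j. \<integral>\<^sup>+x. ennreal (norm (c *\<^sub>R f j x - c *\<^sub>R g x) powr s) \<partial>lebesgue_on D) \<longlonglongrightarrow> 0"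
    by simp
qed

lemma tendsto_0_if_le_arbitrary:
  fixes f :: "'a \<Rightarrow> ennreal"
  assumes "\<And>\<delta>::real. 0 < \<delta> \<Longrightarrow> \<forall>\<^sub>F x in F. f x \<le> ennreal \<delta>"
  shows "(f \<longlongrightarrow> 0) F"
proof (rule order_tendstoI)
  fix a :: ennreal
  assume "0 < a"
  then obtain b where b: "0 < b" "b < a"
    using dense by blast
  then have "b < top"
    using less_le_trans top_greatest by blast
  then have "b = ennreal (enn2real b)" "0 < enn2real b"
    using b by (simp_all add: enn2real_positive_iff)
  with assms[of "enn2real b"] show "\<forall>\<^sub>F x in F. f x < a"
    using b(2) by (auto elim!: eventually_mono intro: le_less_trans)
qed simp

text \<open>Split at height \<open>\<epsilon>\<close>: above it \<open>\<bar>a j x\<bar>\<close> is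
  at most \<open>\<epsilon> powr (1 - s)\<close> times its \<open>s\<close>-th power, below it
  finiteness of the measure suffices.\<close>

lemma L1_tendsto_if_Lp:
  fixes a :: "nat \<Rightarrow> 'a \<Rightarrow> real"
  assumes "finite_measure M" and [measurable]: "\<And>j. a j \<in> borel_measurable M" and s: "1 \<le> s"
    and lim: "(\<lambda>j. \<integral>\<^sup>+x. ennreal (\<bar>a j x\<bar> powr s) \<partial>M) \<longlonglongrightarrow> 0"
  shows "(\<lambda>j. \<integral>\<^sup>+x. ennreal \<bar>a j x\<bar> \<partial>M) \<longlonglongrightarrow> 0"
proof -
  interpret finite_measure M by fact
  have bound: "(\<integral>\<^sup>+x. ennreal \<bar>a j x\<bar> \<partial>M) \<le> ennreal (\<epsilon> * measure M (space M))
      + ennreal (\<epsilon> powr (1 - s)) * (\<integral>\<^sup>+x. ennreal (\<bar>a j x\<bar> powr s) \<partial>M)" if \<epsilon>: "0 < \<epsilon>" for j \<epsilon>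
  proof -
    have "(\<integral>\<^sup>+x. ennreal \<bar>a j x\<bar> \<partial>M) \<le> (\<integral>\<^sup>+x. ennreal \<epsilon> + ennreal (\<epsilon> powr (1 - s)) * ennreal (\<bar>a j x\<bar> powr s) \<partial>M)"
    proof (rule nn_integral_mono)
      fix x
      have "\<bar>a j x\<bar> \<le> \<epsilon> + \<epsilon> powr (1 - s) * \<bar>a j x\<bar> powr s"
      proof (cases "\<bar>a j x\<bar> \<le> \<epsilon>")
        case False
        then have "\<bar>a j x\<bar> = \<bar>a j x\<bar> powr (1 - s) * \<bar>a j x\<bar> powr s"
          using \<epsilon> by (simp flip: powr_add)
        also have "\<dots> \<le> \<epsilon> powr (1 - s) * \<bar>a j x\<bar> powr s"
          using False \<epsilon> s by (intro mult_right_mono powr_mono2') auto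
        finally show ?thesis
          using \<epsilon> by simp
      qed (use \<epsilon> in \<open>simp add: add_increasing2\<close>)
      then show "ennreal \<bar>a j x\<bar> \<le> ennreal \<epsilon> + ennreal (\<epsilon> powr (1 - s)) * ennreal (\<bar>a j x\<bar> powr s)"
        using \<epsilon> by (simp add: ennreal_leI flip: ennreal_plus ennreal_mult)
    qed
    also have "\<dots> = ennreal (\<epsilon> * measure M (space M))
      + ennreal (\<epsilon> powr (1 - s)) * (\<integral>\<^sup>+x. ennreal (\<bar>a j x\<bar> powr s) \<partial>M)"
      using \<epsilon> by (simp add: nn_integral_add nn_integral_cmult emeasure_eq_measure ennreal_mult)
    finally show ?thesis .
  qed
  show ?thesis
  proof (rule tendsto_0_if_le_arbitrary)
    fix \<delta> :: real
    assume \<delta>: "0 < \<delta>"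
    define \<epsilon> where "\<epsilon> = \<delta> / (measure M (space M) + 1)"
    have m: "0 \<le> measure M (space M)"
      by simp
    have \<epsilon>: "0 < \<epsilon>" "\<epsilon> * measure M (space M) < \<delta>"
      using \<delta> m by (auto simp: \<epsilon>_def field_simps add_pos_nonneg)
    have "(\<lambda>j. ennreal (\<epsilon> * measure M (space M)) + ennreal (\<epsilon> powr (1 - s)) * (\<integral>\<^sup>+x. ennreal (\<bar>a j x\<bar> powr s) \<partial>M))
        \<longlonglongrightarrow> ennreal (\<epsilon> * measure M (space M)) + ennreal (\<epsilon> powr (1 - s)) * 0"
      by (intro tendsto_intros ennreal_tendsto_cmult lim) auto
    then have "\<forall>\<^sub>F j in sequentially. ennreal (\<epsilon> * measure M (space M))
        + ennreal (\<epsilon> powr (1 - s)) * (\<integral>\<^sup>+x. ennreal (\<bar>a j x\<bar> powr s) \<partial>M) < ennreal \<delta>"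
      using \<epsilon> \<delta> by (intro order_tendstoD) (auto simp: ennreal_less_iff)
    then show "\<forall>\<^sub>F j in sequentially. (\<integral>\<^sup>+x. ennreal \<bar>a j x\<bar> \<partial>M) \<le> ennreal \<delta>"
      by eventually_elim (use bound[OF \<epsilon>(1)] in \<open>meson less_imp_le order_trans\<close>)
  qed
qed

text \<open>Polynomials are dense among the continuous functions on the compact closure, hence
  \<open>h\<close> integrates to 0 over every closed set, and inner regularity finishes. They
  suffice as test functions because the approximants of \<open>u\<close> already carry the compact
  support.\<close>

lemma AE_eq_0_if_orthogonal_polynomials:
  fixes h :: "'a::euclidean_space \<Rightarrow> real"
  assumes D: "open D" "bounded D" and h: "integrable (lebesgue_on D) h"
    and orth: "\<And>q. real_polynomial_function q \<Longrightarrow> (\<integral>x. h x * q x \<partial>lebesgue_on D) = 0"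
  shows "AE x in lebesgue_on D. h x = 0"
proof -
  have Dsets: "D \<in> sets lebesgue"
    by (intro sets_completionI_sets) (simp add: D(1))
  have closed0: "(\<integral>x. h x * indicator T x \<partial>lebesgue_on D) = 0" if T: "closed T" "T \<noteq> {}" for T
  proof -
    \<comment> \<open>Continuous functions with values between 0 and 1 that converge pointwise to
      the indicator of \<open>T\<close>; the polynomial \<open>q k\<close> follows them
      uniformly.\<close>
    define \<psi> where "\<psi> = (\<lambda>k::nat. \<lambda>x. max 0 (1 - real k * infdist x T))"
    have "\<exists>q. real_polynomial_function q \<and> (\<forall>x\<in>closure D. \<bar>\<psi> k x - q x\<bar> < 1 / (real k + 1))" for k
    proof -
      have "continuous_on (closure D) (\<psi> k)"
        unfolding \<psi>_def by (intro continuous_intros)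
      then obtain q where "polynomial_function q" "\<And>x. x \<in> closure D \<Longrightarrow> norm (\<psi> k x - q x) < 1 / (real k + 1)"
        using Stone_Weierstrass_polynomial_function[of "closure D" "\<psi> k" "1 / (real k + 1)"] D(2)
        by (auto simp: compact_closure)
      then show ?thesis
        by (auto simp: real_polynomial_function_eq)
    qed
    then obtain q where q: "\<And>k. real_polynomial_function (q k)"
      "\<And>k x. x \<in> closure D \<Longrightarrow> \<bar>\<psi> k x - q k x\<bar> < 1 / (real k + 1)"
      by metis
    have lim\<psi>: "(\<lambda>k. \<psi> k x) \<longlonglongrightarrow> indicator T x" for x
    proof (cases "x \<in> T")
      case True
      then show ?thesis
        by (simp add: \<psi>_def)
    next
      case False
      then have pos: "0 < infdist x T"
        using T by (simp add: infdist_pos_not_in_closed)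
      obtain N where N: "1 / infdist x T < real N"
        using reals_Archimedean2 by blast
      have "\<psi> k x = 0" if "N \<le> k" for k
      proof -
        have "1 < real N * infdist x T"
          using N pos by (simp add: field_simps)
        also have "\<dots> \<le> real k * infdist x T"
          using that pos by (intro mult_right_mono) auto
        finally have "1 < real k * infdist x T" .
        then show ?thesis
          by (simp add: \<psi>_def)
      qed
      then have "\<forall>\<^sub>F k in sequentially. \<psi> k x = indicator T x"
        using False by (auto simp: eventually_sequentially)
      then show ?thesis
        by (rule tendsto_eventually)
    qed
    have limq: "(\<lambda>k. q k x) \<longlonglongrightarrow> indicator T x" if "x \<in> D" for x
    proof -
      have "(\<lambda>k. \<psi> k x - q k x) \<longlonglongrightarrow> 0"
      proof (rule Lim_null_comparison)
        have "x \<in> closure D"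
          using that closure_subset by blast
        then show "\<forall>\<^sub>F k in sequentially. norm (\<psi> k x - q k x) \<le> 1 / (real k + 1)"
          using q(2) by (auto intro!: always_eventually less_imp_le)
        show "(\<lambda>k. 1 / (real k + 1)) \<longlonglongrightarrow> 0"
          using LIMSEQ_inverse_real_of_nat by (simp add: inverse_eq_divide add.commute)
      qed
      from tendsto_diff[OF lim\<psi>[of x] this] show ?thesis
        by simp
    qed
    have [measurable]: "q k \<in> borel_measurable (lebesgue_on D)" for k
    proof -
      have "continuous_on UNIV (q k)"
        using q(1) by (simp add: continuous_on_polymonial_function real_polynomial_function_eq)
      then show ?thesis
        by (simp add: borel_measurable_continuous_onI measurable_completion measurable_restrict_space1)
    qed
    note [measurable] = borel_measurable_integrable[OF h]
    have [measurable]: "indicator T \<in> borel_measurable (lebesgue_on D)"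
      using T(1) by (intro measurable_restrict_space1 borel_measurable_indicator sets_completionI_sets) (simp add: borel_closed)
    have "(\<lambda>k. \<integral>x. h x * q k x \<partial>lebesgue_on D) \<longlonglongrightarrow> (\<integral>x. h x * indicator T x \<partial>lebesgue_on D)"
    proof (rule integral_dominated_convergence)
      show "integrable (lebesgue_on D) (\<lambda>x. 2 * \<bar>h x\<bar>)"
        using h by simp
      show "AE x in lebesgue_on D. (\<lambda>k. h x * q k x) \<longlonglongrightarrow> h x * indicator T x"
        by (intro AE_I2 tendsto_mult tendsto_const limq) simp
      show "AE x in lebesgue_on D. norm (h x * q k x) \<le> 2 * \<bar>h x\<bar>" for k
      proof (rule AE_I2)
        fix x
        assume "x \<in> space (lebesgue_on D)"
        then have "x \<in> closure D"
          using closure_subset by auto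
        from q(2)[OF this, of k] have "\<bar>\<psi> k x - q k x\<bar> < 1"
          by (rule less_le_trans) simp
        moreover have "0 \<le> \<psi> k x" "\<psi> k x \<le> 1"
          by (auto simp: \<psi>_def infdist_nonneg)
        ultimately have "\<bar>q k x\<bar> \<le> 2"
          by linarith
        then show "norm (h x * q k x) \<le> 2 * \<bar>h x\<bar>"
          using mult_left_mono[of "\<bar>q k x\<bar>" 2 "\<bar>h x\<bar>"] by (simp add: abs_mult mult.commute)
      qed
    qed measurable
    then show ?thesis
      using orth[OF q(1)] by (simp add: LIMSEQ_const_iff)
  qed
  \<comment> \<open>A closed subset of the positivity set carries a vanishing integral of a positive
    function, hence is null. Used for \<open>h\<close> and for \<open>- h\<close>.\<close>
  have null: "{x \<in> D. 0 < g x} \<in> null_sets lebesgue"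
    if g: "integrable (lebesgue_on D) g"
      "\<And>T. closed T \<Longrightarrow> T \<noteq> {} \<Longrightarrow> (\<integral>x. g x * indicator T x \<partial>lebesgue_on D) = 0" for g :: "'a \<Rightarrow> real"
  proof -
    note [measurable] = borel_measurable_integrable[OF g(1)]
    have "{x \<in> space (lebesgue_on D). 0 < g x} \<in> sets (lebesgue_on D)"
      by measurable
    then have S: "{x \<in> D. 0 < g x} \<in> sets lebesgue"
      using Dsets by (simp add: sets_restrict_space_iff)
    have "emeasure lebesgue {x \<in> D. 0 < g x} \<le> 0 + ennreal \<epsilon>" if \<epsilon>: "0 < \<epsilon>" for \<epsilon>
    proof -
      obtain T where T: "closed T" "T \<subseteq> {x \<in> D. 0 < g x}" "emeasure lebesgue ({x \<in> D. 0 < g x} - T) < ennreal \<epsilon>"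
        by (rule sets_lebesgue_inner_closed[OF S \<epsilon>])
      have [measurable]: "T \<in> sets lebesgue"
        by (intro sets_completionI_sets) (simp add: T(1) borel_closed)
      have [measurable]: "(indicator T :: 'a \<Rightarrow> real) \<in> borel_measurable (lebesgue_on D)"
        by (intro measurable_restrict_space1 borel_measurable_indicator) fact
      have "emeasure lebesgue T = 0"
      proof (cases "T = {}")
        case False
        have int: "integrable (lebesgue_on D) (\<lambda>x. g x * indicator T x)"
        proof (rule Bochner_Integration.integrable_bound[OF g(1)])
          show "(\<lambda>x. g x * indicator T x) \<in> borel_measurable (lebesgue_on D)"
            by measurable
        qed (auto simp: indicator_def)
        have nonneg: "AE x in lebesgue_on D. 0 \<le> g x * indicator T x"
          using T(2) by (intro AE_I2) (auto simp: indicator_def)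
        have "AE x in lebesgue_on D. g x * indicator T x = 0"
          using integral_nonneg_eq_0_iff_AE[OF int nonneg] g(2)[OF T(1) False] by blast
        then have "AE x in lebesgue. x \<in> D \<longrightarrow> g x * indicator T x = 0"
          using Dsets by (simp add: AE_restrict_space_iff)
        then have "AE x in lebesgue. x \<notin> T"
          by eventually_elim (use T(2) in \<open>auto simp: indicator_def\<close>)
        then show ?thesis
          using AE_iff_null_sets[of T lebesgue] by (auto dest: null_setsD1)
      qed simp
      moreover have "emeasure lebesgue {x \<in> D. 0 < g x} \<le> emeasure lebesgue T + emeasure lebesgue ({x \<in> D. 0 < g x} - T)"
      proof -
        have "emeasure lebesgue {x \<in> D. 0 < g x} \<le> emeasure lebesgue (T \<union> ({x \<in> D. 0 < g x} - T))"
          using T(2) S by (intro emeasure_mono) auto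
        also have "\<dots> \<le> emeasure lebesgue T + emeasure lebesgue ({x \<in> D. 0 < g x} - T)"
          using S by (intro emeasure_subadditive) auto
        finally show ?thesis .
      qed
      ultimately show ?thesis
        using T(3) by simp
    qed
    then have "emeasure lebesgue {x \<in> D. 0 < g x} \<le> 0"
      by (rule ennreal_le_epsilon)
    with S show ?thesis
      by (auto intro: null_setsI)
  qed
  have "{x \<in> D. 0 < h x} \<union> {x \<in> D. 0 < - h x} \<in> null_sets lebesgue"
    by (intro null_sets.Un null) (use h closed0 in auto)
  then have "AE x in lebesgue. x \<notin> {x \<in> D. 0 < h x} \<union> {x \<in> D. 0 < - h x}"
    by (rule AE_not_in)
  then have "AE x in lebesgue. x \<in> D \<longrightarrow> h x = 0"
    by eventually_elim auto
  then show ?thesis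
    using Dsets by (simp add: AE_restrict_space_iff)
qed

section \<open>The Folland-Stein space\<close>

lemma ennreal_tendsto_0_mono:
  fixes f g :: "nat \<Rightarrow> ennreal"
  assumes "\<And>j. f j \<le> g j" "g \<longlonglongrightarrow> 0"
  shows "f \<longlonglongrightarrow> 0"
  by (rule tendsto_sandwich[OF _ _ tendsto_const assms(2)]) (simp_all add: assms(1))

lemma Ck_1_mult:
  fixes f g :: "'a::euclidean_space \<Rightarrow> real"
  assumes f: "Ck_on 1 UNIV f" and g: "Ck_on 1 UNIV g"
  shows Ck_1_mult_Ck: "Ck_on 1 UNIV (\<lambda>x. f x * g x)"
    and Ck_1_mult_derivative: "frechet_derivative (\<lambda>x. f x * g x) (at x) h
      = f x * frechet_derivative g (at x) h + frechet_derivative f (at x) h * g x"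
proof -
  have d: "((\<lambda>x. f x * g x) has_derivative
      (\<lambda>h. f x * frechet_derivative g (at x) h + frechet_derivative f (at x) h * g x)) (at x)" for x
    using f g by (intro has_derivative_mult) (simp_all add: frechet_derivative_works)
  then have eq: "frechet_derivative (\<lambda>x. f x * g x) (at x)
      = (\<lambda>h. f x * frechet_derivative g (at x) h + frechet_derivative f (at x) h * g x)" for x
    by (rule frechet_derivative_eqI)
  then show "frechet_derivative (\<lambda>x. f x * g x) (at x) h
      = f x * frechet_derivative g (at x) h + frechet_derivative f (at x) h * g x"
    by simp
  have "continuous_on UNIV f" "continuous_on UNIV g"
    using f g by (auto intro!: continuous_at_imp_continuous_on differentiable_imp_continuous_within)
  then have "continuous_on UNIV (\<lambda>x. f x * frechet_derivative g (at x) v + frechet_derivative f (at x) v * g x)" for v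
    using f g by (intro continuous_intros) simp_all
  then show "Ck_on 1 UNIV (\<lambda>x. f x * g x)"
    using d by (auto simp: eq differentiable_def)
qed

lemma Ck_1_polynomial:
  fixes q :: "'a::euclidean_space \<Rightarrow> real"
  assumes "real_polynomial_function q"
  shows "Ck_on 1 UNIV q"
  using assms
proof induction
  case (linear f)
  show ?case
    using smooth_on_linear[OF linear] by (simp only: smooth_on_def)
next
  case (mult f g)
  then show ?case
    using Ck_1_mult_Ck by blast
qed (simp_all only: Ck_on_const Ck_on_add)

lemma Ck_1_has_derivative: "Ck_on 1 UNIV f \<Longrightarrow> (f has_derivative frechet_derivative f (at x)) (at x)"
  by (simp add: frechet_derivative_works)

lemma C1c_mult:
  assumes "C1c f" "Ck_on 1 UNIV q"
  shows "C1c (\<lambda>x. f x * q x)"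
proof -
  obtain R where "\<forall>x. R < norm x \<longrightarrow> f x = 0"
    using assms(1) by (auto simp: C1c_def)
  then have "\<exists>R. \<forall>x. R < norm x \<longrightarrow> f x * q x = 0"
    by (intro exI[of _ R]) simp
  moreover have "Ck_on 1 UNIV (\<lambda>x. f x * q x)"
    using assms by (intro Ck_1_mult_Ck) (auto simp only: C1c_def)
  ultimately show ?thesis
    by (simp only: C1c_def)
qed

section \<open>Test functions\<close>

lemma borel_measurable_lebesgue_on:
  "f \<in> borel_measurable borel \<Longrightarrow> f \<in> borel_measurable (lebesgue_on D)"
  by (simp add: measurable_completion measurable_restrict_space1)

lemma test_functions_smooth: "\<phi> \<in> test_functions D \<Longrightarrow> smooth_on UNIV \<phi>"
  by (simp add: test_functions_def)

lemma test_functions_C1c: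
  assumes "\<phi> \<in> test_functions D"
  shows "C1c \<phi>"
proof -
  have "bounded (closure {x. \<phi> x \<noteq> 0})"
    using assms by (simp add: test_functions_def compact_imp_bounded)
  then obtain R where R: "\<And>x. x \<in> closure {x. \<phi> x \<noteq> 0} \<Longrightarrow> norm x \<le> R"
    by (auto simp: bounded_iff)
  have "\<phi> x = 0" if "R < norm x" for x
  proof (rule ccontr)
    assume "\<phi> x \<noteq> 0"
    then have "x \<in> closure {x. \<phi> x \<noteq> 0}"
      using closure_subset[of "{x. \<phi> x \<noteq> 0}"] by blast
    from R[OF this] that show False
      by simp
  qed
  then show ?thesis
    using test_functions_smooth[OF assms] unfolding C1c_def smooth_on_def by blast
qed

lemma test_functions_outside:
  assumes \<phi>: "\<phi> \<in> test_functions D" and x: "x \<notin> D"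
  shows "\<phi> x = 0" "frechet_derivative \<phi> (at x) h = 0"
proof -
  have x': "x \<in> - closure {x. \<phi> x \<noteq> 0}"
    using \<phi> x by (auto simp: test_functions_def)
  have zero: "\<phi> y = 0" if "y \<in> - closure {x. \<phi> x \<noteq> 0}" for y
    using that closure_subset[of "{x. \<phi> x \<noteq> 0}"] by auto
  then show "\<phi> x = 0"
    using x' by blast
  have "((\<lambda>x. 0) has_derivative frechet_derivative \<phi> (at x)) (at x)"
    by (rule has_derivative_transform_within_open[OF C1c_has_derivative[OF test_functions_C1c[OF \<phi>]] _ x' zero])
      (rule open_Compl[OF closed_closure])
  then have "frechet_derivative \<phi> (at x) = (\<lambda>h. 0)"
    using has_derivative_unique[OF _ has_derivative_const] by blast
  then show "frechet_derivative \<phi> (at x) h = 0"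
    by simp
qed

lemma test_functions_support_subset:
  assumes "smooth_on UNIV \<phi>" "compact K" "K \<subseteq> D" "\<And>x. x \<notin> K \<Longrightarrow> \<phi> x = 0"
  shows "\<phi> \<in> test_functions D"
proof -
  have "closure {x. \<phi> x \<noteq> 0} \<subseteq> K"
    using assms by (intro closure_minimal) (auto simp: compact_imp_closed)
  then show ?thesis
    using assms compact_Int_closed[OF assms(2) closed_closure, of "{x. \<phi> x \<noteq> 0}"]
    by (auto simp: test_functions_def Int_absorb1)
qed

lemma test_functions_add:
  assumes "\<phi> \<in> test_functions D" "\<psi> \<in> test_functions D"
  shows "(\<lambda>x. \<phi> x + \<psi> x) \<in> test_functions D"
proof (rule test_functions_support_subset)
  show "smooth_on UNIV (\<lambda>x. \<phi> x + \<psi> x)"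
    using assms by (intro smooth_on_add test_functions_smooth)
  show "compact (closure {x. \<phi> x \<noteq> 0} \<union> closure {x. \<psi> x \<noteq> 0})"
    using assms by (simp add: test_functions_def compact_Un)
  show "closure {x. \<phi> x \<noteq> 0} \<union> closure {x. \<psi> x \<noteq> 0} \<subseteq> D"
    using assms by (simp add: test_functions_def)
  show "\<phi> x + \<psi> x = 0" if "x \<notin> closure {x. \<phi> x \<noteq> 0} \<union> closure {x. \<psi> x \<noteq> 0}" for x
  proof -
    have "\<phi> x = 0" "\<psi> x = 0"
      using that closure_subset[of "{x. \<phi> x \<noteq> 0}"] closure_subset[of "{x. \<psi> x \<noteq> 0}"] by blast+
    then show ?thesis
      by simp
  qed
qed

lemma test_functions_scale:
  assumes "\<phi> \<in> test_functions D"
  shows "(\<lambda>x. c *\<^sub>R \<phi> x) \<in> test_functions D"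
proof (rule test_functions_support_subset)
  show "smooth_on UNIV (\<lambda>x. c *\<^sub>R \<phi> x)"
    by (rule smooth_on_linear_left[OF bounded_linear_scaleR_right test_functions_smooth[OF assms]])
  show "compact (closure {x. \<phi> x \<noteq> 0})" "closure {x. \<phi> x \<noteq> 0} \<subseteq> D"
    using assms by (simp_all add: test_functions_def)
  show "c *\<^sub>R \<phi> x = 0" if "x \<notin> closure {x. \<phi> x \<noteq> 0}" for x
    using that closure_subset[of "{x. \<phi> x \<noteq> 0}"] by auto
qed

lemma grad_classical_add:
  assumes "C1c f" "C1c g"
  shows "grad_classical X (\<lambda>x. f x + g x) x = grad_classical X f x + grad_classical X g x"
proof -
  have "frechet_derivative (\<lambda>x. f x + g x) (at x) = (\<lambda>h. frechet_derivative f (at x) h + frechet_derivative g (at x) h)"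
    by (intro frechet_derivative_eqI has_derivative_add C1c_has_derivative assms)
  then show ?thesis
    by (simp add: grad_classical_def vec_eq_iff)
qed

lemma grad_classical_scale:
  assumes "C1c f"
  shows "grad_classical X (\<lambda>x. c *\<^sub>R f x) x = c *\<^sub>R grad_classical X f x"
proof -
  have "frechet_derivative (\<lambda>x. c *\<^sub>R f x) (at x) = (\<lambda>h. c *\<^sub>R frechet_derivative f (at x) h)"
    by (intro frechet_derivative_eqI has_derivative_scaleR_right C1c_has_derivative assms)
  then show ?thesis
    by (simp add: grad_classical_def vec_eq_iff)
qed

section \<open>Horizontal gradients on the completion\<close>

locale fs_space = carnot_basis mul e iv \<sigma> r V X
  for mul :: "real^'n \<Rightarrow> real^'n \<Rightarrow> real^'n" and e iv and \<sigma> :: "'n::finite \<Rightarrow> nat" and r V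
    and X :: "'m::finite \<Rightarrow> real^'n \<Rightarrow> real^'n" +
  fixes D :: "(real^'n) set" and p :: real
  assumes open_D: "open D" and bounded_D: "bounded D" and Q_ge_3: "3 \<le> Q" and p_eq: "p = critical_exponent Q"
begin

abbreviation MD where "MD \<equiv> lebesgue_on D"
abbreviation grad where "grad \<equiv> grad_classical X"

lemma p_gt_2: "2 < p"
  using Q_ge_3 by (simp add: p_eq critical_exponent_def field_simps)

lemma D_lmeasurable: "D \<in> lmeasurable"
  by (rule lmeasurable_open[OF bounded_D open_D])

lemma finite_MD: "finite_measure MD"
  by (rule finite_measure_lebesgue_on[OF D_lmeasurable])

lemma D_sets: "D \<in> sets lebesgue"
  using D_lmeasurable by (rule fmeasurableD)

lemma nn_integral_MD:
  assumes "f \<in> borel_measurable borel" "\<And>x. x \<notin> D \<Longrightarrow> f x = 0"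
  shows "(\<integral>\<^sup>+x. f x \<partial>MD) = (\<integral>\<^sup>+x. f x \<partial>lborel)"
proof -
  have "(\<integral>\<^sup>+x. f x \<partial>MD) = (\<integral>\<^sup>+x. f x * indicator D x \<partial>lebesgue)"
    by (rule nn_integral_restrict_space) (simp add: D_sets)
  also have "\<dots> = (\<integral>\<^sup>+x. f x \<partial>lebesgue)"
    using assms(2) by (intro nn_integral_cong) (auto simp: indicator_def)
  also have "\<dots> = (\<integral>\<^sup>+x. f x \<partial>lborel)"
    by (rule nn_integral_completion)
  finally show ?thesis .
qed

lemma integral_MD:
  fixes f :: "real^'n \<Rightarrow> real"
  assumes "f \<in> borel_measurable borel" "\<And>x. x \<notin> D \<Longrightarrow> f x = 0"
  shows "(\<integral>x. f x \<partial>MD) = (\<integral>x. f x \<partial>lborel)"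
proof -
  have "(\<integral>x. f x \<partial>MD) = (\<integral>x. indicator D x *\<^sub>R f x \<partial>lebesgue)"
    by (rule integral_restrict_space) (simp add: D_sets)
  also have "\<dots> = (\<integral>x. f x \<partial>lebesgue)"
    using assms(2) by (intro Bochner_Integration.integral_cong) (auto simp: indicator_def)
  also have "\<dots> = (\<integral>x. f x \<partial>lborel)"
    by (rule integral_completion) (simp add: assms)
  finally show ?thesis .
qed

lemma test_measurable [measurable]:
  "\<phi> \<in> test_functions D \<Longrightarrow> \<phi> \<in> borel_measurable MD"
  "\<phi> \<in> test_functions D \<Longrightarrow> grad \<phi> \<in> borel_measurable MD"
  by (auto intro: borel_measurable_lebesgue_on C1c_measurable grad_classical_measurable test_functions_C1c)

lemma grad_outside: "\<phi> \<in> test_functions D \<Longrightarrow> x \<notin> D \<Longrightarrow> grad \<phi> x = 0"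
  by (simp add: grad_classical_def vec_eq_iff test_functions_outside)

lemma energy_MD:
  assumes "\<phi> \<in> test_functions D"
  shows "(\<integral>\<^sup>+x. ennreal ((norm (grad \<phi> x))\<^sup>2) \<partial>MD) = energy \<phi>"
  unfolding energy_def using grad_classical_measurable[OF test_functions_C1c[OF assms]]
  by (intro nn_integral_MD) (auto simp: grad_outside[OF assms])

lemma energy_norm_classical:
  assumes "\<phi> \<in> test_functions D"
  shows "energy \<phi> = ennreal ((norm_classical X D \<phi>)\<^sup>2)"
proof -
  have "(\<integral>\<^sup>+x. ennreal ((norm (grad \<phi> x))\<^sup>2) \<partial>MD) = ennreal (\<integral>x. (norm (grad \<phi> x))\<^sup>2 \<partial>MD)"
  proof (rule nn_integral_eq_integral)
    show "integrable MD (\<lambda>x. (norm (grad \<phi> x))\<^sup>2)"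
      using energy_finite[OF test_functions_C1c[OF assms]] test_measurable(2)[OF assms]
      by (intro integrableI_bounded) (auto simp: energy_MD[OF assms])
  qed simp
  then show ?thesis
    by (simp add: energy_MD[OF assms] norm_classical_def)
qed

text \<open>The relation from which \<open>hgrad\<close> selects by Hilbert choice. Linear structure
  and estimates are proved for arbitrary related pairs, independently of the selection.\<close>

definition has_hgrad :: "(real^'n \<Rightarrow> real) \<Rightarrow> (real^'n \<Rightarrow> real^'m) \<Rightarrow> bool" where
  "has_hgrad u G \<longleftrightarrow> (\<exists>\<phi>. (\<forall>j. \<phi> j \<in> test_functions D) \<and> Lp_converges p D \<phi> u \<and>
     Lp_converges 2 D (\<lambda>j. grad (\<phi> j)) G)"

lemma has_hgrad_measurable:
  assumes "has_hgrad u G"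
  shows "u \<in> borel_measurable MD" "G \<in> borel_measurable MD"
  using assms by (auto simp: has_hgrad_def Lp_converges_def)

lemma has_hgrad_add:
  assumes "has_hgrad u G" "has_hgrad v H"
  shows "has_hgrad (\<lambda>x. u x + v x) (\<lambda>x. G x + H x)"
proof -
  obtain \<phi> where \<phi>: "\<And>j. \<phi> j \<in> test_functions D" "Lp_converges p D \<phi> u" "Lp_converges 2 D (\<lambda>j. grad (\<phi> j)) G"
    using assms(1) by (auto simp: has_hgrad_def)
  obtain \<psi> where \<psi>: "\<And>j. \<psi> j \<in> test_functions D" "Lp_converges p D \<psi> v" "Lp_converges 2 D (\<lambda>j. grad (\<psi> j)) H"
    using assms(2) by (auto simp: has_hgrad_def)
  have "Lp_converges p D (\<lambda>j x. \<phi> j x + \<psi> j x) (\<lambda>x. u x + v x)"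
    using p_gt_2 \<phi> \<psi> by (intro Lp_converges_add test_measurable) auto
  moreover have "Lp_converges 2 D (\<lambda>j x. grad (\<phi> j) x + grad (\<psi> j) x) (\<lambda>x. G x + H x)"
    using \<phi> \<psi> by (intro Lp_converges_add test_measurable) auto
  moreover have "grad (\<lambda>x. \<phi> j x + \<psi> j x) = (\<lambda>x. grad (\<phi> j) x + grad (\<psi> j) x)" for j
    using grad_classical_add[OF test_functions_C1c test_functions_C1c] \<phi>(1) \<psi>(1) by blast
  ultimately show ?thesis
    unfolding has_hgrad_def using \<phi>(1) \<psi>(1)
    by (intro exI[of _ "\<lambda>j x. \<phi> j x + \<psi> j x"]) (simp add: test_functions_add)
qed

lemma has_hgrad_scale:
  assumes "has_hgrad u G"
  shows "has_hgrad (\<lambda>x. c *\<^sub>R u x) (\<lambda>x. c *\<^sub>R G x)"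
proof -
  obtain \<phi> where \<phi>: "\<And>j. \<phi> j \<in> test_functions D" "Lp_converges p D \<phi> u" "Lp_converges 2 D (\<lambda>j. grad (\<phi> j)) G"
    using assms(1) by (auto simp: has_hgrad_def)
  have "Lp_converges p D (\<lambda>j x. c *\<^sub>R \<phi> j x) (\<lambda>x. c *\<^sub>R u x)"
    using \<phi> by (intro Lp_converges_scale test_measurable) auto
  moreover have "Lp_converges 2 D (\<lambda>j x. c *\<^sub>R grad (\<phi> j) x) (\<lambda>x. c *\<^sub>R G x)"
    using \<phi> by (intro Lp_converges_scale test_measurable) auto
  moreover have "grad (\<lambda>x. c *\<^sub>R \<phi> j x) = (\<lambda>x. c *\<^sub>R grad (\<phi> j) x)" for j
    using grad_classical_scale[OF test_functions_C1c] \<phi>(1) by blast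
  ultimately show ?thesis
    unfolding has_hgrad_def
    by (intro exI[of _ "\<lambda>j x. c *\<^sub>R \<phi> j x"] conjI allI test_functions_scale \<phi>(1)) (simp_all only:)
qed

lemma has_hgrad_diff:
  assumes "has_hgrad u G" "has_hgrad v H"
  shows "has_hgrad (\<lambda>x. u x - v x) (\<lambda>x. G x - H x)"
  using has_hgrad_add[OF assms(1) has_hgrad_scale[OF assms(2), of "- 1"]] by simp

lemma has_hgrad_hgrad:
  assumes "has_hgrad u G"
  shows "has_hgrad u (hgrad X p D u)"
proof -
  have "has_hgrad u (SOME G. has_hgrad u G)"
    using assms by (rule someI[of "has_hgrad u"])
  then show ?thesis
    by (simp add: hgrad_def has_hgrad_def)
qed

text \<open>The gradients of an approximating sequence are Cauchy in the mean square and so have a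
  limit, which shows that the choice behind \<open>hgrad\<close> has something to select.\<close>

lemma folland_stein_has_hgrad:
  assumes "u \<in> folland_stein X p D"
  shows "has_hgrad u (hgrad X p D u)"
proof -
  obtain \<phi> where \<phi>: "\<And>j. \<phi> j \<in> test_functions D"
    and cauchy: "\<And>\<epsilon>. \<epsilon> > 0 \<Longrightarrow> \<exists>N. \<forall>j\<ge>N. \<forall>k\<ge>N. norm_classical X D (\<phi> j - \<phi> k) < \<epsilon>"
    and lim: "Lp_converges p D \<phi> u"
    using assms unfolding folland_stein_def by blast
  have diff: "\<phi> j - \<phi> k \<in> test_functions D" "grad (\<phi> j - \<phi> k) x = grad (\<phi> j) x - grad (\<phi> k) x" for j k x
  proof -
    have eq: "\<phi> j - \<phi> k = (\<lambda>x. \<phi> j x + (- 1) *\<^sub>R \<phi> k x)"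
      by (simp add: fun_eq_iff)
    show "\<phi> j - \<phi> k \<in> test_functions D"
      unfolding eq by (intro test_functions_add test_functions_scale \<phi>)
    show "grad (\<phi> j - \<phi> k) x = grad (\<phi> j) x - grad (\<phi> k) x"
      unfolding eq
        grad_classical_add[OF test_functions_C1c[OF \<phi>] test_functions_C1c[OF test_functions_scale[OF \<phi>]]]
        grad_classical_scale[OF test_functions_C1c[OF \<phi>]]
      by simp
  qed
  obtain G where G: "G \<in> borel_measurable MD"
    "(\<lambda>j. \<integral>\<^sup>+x. ennreal ((norm (grad (\<phi> j) x - G x))\<^sup>2) \<partial>MD) \<longlonglongrightarrow> 0"
  proof (rule L2_complete[OF finite_MD])
    show "grad (\<phi> j) \<in> borel_measurable MD" for j
      using \<phi> by (rule test_measurable)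
    fix \<epsilon> :: real
    assume \<epsilon>: "0 < \<epsilon>"
    then obtain N where N: "\<And>j k. N \<le> j \<Longrightarrow> N \<le> k \<Longrightarrow> norm_classical X D (\<phi> j - \<phi> k) < sqrt \<epsilon>"
      using cauchy[of "sqrt \<epsilon>"] by auto
    have "(\<integral>\<^sup>+x. ennreal ((norm (grad (\<phi> j) x - grad (\<phi> k) x))\<^sup>2) \<partial>MD) \<le> ennreal \<epsilon>" if "N \<le> j" "N \<le> k" for j k
    proof -
      have "0 \<le> norm_classical X D (\<phi> j - \<phi> k)"
        by (simp add: norm_classical_def)
      then have "(norm_classical X D (\<phi> j - \<phi> k))\<^sup>2 \<le> (sqrt \<epsilon>)\<^sup>2"
        using N[OF that] by (intro power_mono) auto
      then show ?thesis
        using energy_MD[OF diff(1)[of j k]] energy_norm_classical[OF diff(1)[of j k]] \<epsilon>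
        by (simp add: diff(2) ennreal_leI)
    qed
    then show "\<exists>N. \<forall>j\<ge>N. \<forall>k\<ge>N. (\<integral>\<^sup>+x. ennreal ((norm (grad (\<phi> j) x - grad (\<phi> k) x))\<^sup>2) \<partial>MD) \<le> ennreal \<epsilon>"
      by blast
  qed blast
  then have "has_hgrad u G"
    unfolding has_hgrad_def using \<phi> lim by (intro exI[of _ \<phi>]) (simp add: Lp_converges_def)
  then show ?thesis
    by (rule has_hgrad_hgrad)
qed

text \<open>The divergence theorem for \<open>X i\<close> applied to \<open>\<phi> x * q x\<close>.
  There is no boundary term, whatever \<open>q\<close> is, since \<open>\<phi>\<close> has compact
  support in \<open>D\<close>.\<close>

lemma integration_by_parts:
  assumes \<phi>: "\<phi> \<in> test_functions D" and q: "Ck_on 1 UNIV q"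
  shows "(\<integral>x. grad \<phi> x $ i * q x \<partial>MD) = - (\<integral>x. \<phi> x * frechet_derivative q (at x) (X i x) \<partial>MD)"
proof -
  note C = test_functions_C1c[OF \<phi>]
  have contX: "continuous_on UNIV (X i)"
    using continuous_lf[of "X i 0"] X_eq_lf[of i] by simp
  have contq: "continuous_on UNIV q"
    using Ck_1_has_derivative[OF q] by (auto intro!: continuous_at_imp_continuous_on has_derivative_continuous)
  have contDq: "continuous_on UNIV (\<lambda>x. frechet_derivative q (at x) (X i x))"
    unfolding continuous_on_def
  proof
    fix x
    show "((\<lambda>x. frechet_derivative q (at x) (X i x)) \<longlongrightarrow> frechet_derivative q (at x) (X i x)) (at x)"
      by (rule derivative_tendsto[where f'="\<lambda>x. frechet_derivative q (at x)",
          OF has_derivative_linear[OF Ck_1_has_derivative[OF q]]])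
        (use q contX in \<open>auto simp: continuous_on_def\<close>)
  qed
  have contg: "continuous_on UNIV (\<lambda>x. grad \<phi> x $ i)"
    by (intro continuous_intros grad_classical_continuous C)
  obtain R where R: "\<And>x. R < norm x \<Longrightarrow> \<phi> x = 0"
    using C by (auto simp: C1c_def)
  have gi: "grad \<phi> x $ i = frechet_derivative \<phi> (at x) (X i x)" for x
    by (simp add: grad_classical_def)
  have 1: "integrable lborel (\<lambda>x. grad \<phi> x $ i * q x)"
    by (rule integrable_continuous_bounded_support[of _ R])
      (auto intro!: continuous_intros contg[unfolded gi] contq simp: gi C1c_derivative_eq_0[OF C R])
  have 2: "integrable lborel (\<lambda>x. \<phi> x * frechet_derivative q (at x) (X i x))"
    by (rule integrable_continuous_bounded_support[of _ R])
      (auto intro!: continuous_intros contDq C1c_continuous[OF C] simp: R)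
  have "0 = (\<integral>x. frechet_derivative (\<lambda>x. \<phi> x * q x) (at x) (X i x) \<partial>lborel)"
    using integral_lf_derivative_eq_0[OF C1c_mult[OF C q], of "X i 0"] X_eq_lf[of i] by simp
  also have "\<dots> = (\<integral>x. \<phi> x * frechet_derivative q (at x) (X i x) + grad \<phi> x $ i * q x \<partial>lborel)"
    using C unfolding gi by (subst Ck_1_mult_derivative[OF _ q]) (simp_all only: C1c_def)
  also have "\<dots> = (\<integral>x. \<phi> x * frechet_derivative q (at x) (X i x) \<partial>lborel) + (\<integral>x. grad \<phi> x $ i * q x \<partial>lborel)"
    by (rule Bochner_Integration.integral_add[OF 2 1])
  finally have "(\<integral>x. grad \<phi> x $ i * q x \<partial>lborel) = - (\<integral>x. \<phi> x * frechet_derivative q (at x) (X i x) \<partial>lborel)"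
    by linarith
  moreover have "(\<integral>x. grad \<phi> x $ i * q x \<partial>MD) = (\<integral>x. grad \<phi> x $ i * q x \<partial>lborel)"
    using borel_measurable_integrable[OF 1] by (intro integral_MD) (auto simp: grad_outside[OF \<phi>])
  moreover have "(\<integral>x. \<phi> x * frechet_derivative q (at x) (X i x) \<partial>MD) = (\<integral>x. \<phi> x * frechet_derivative q (at x) (X i x) \<partial>lborel)"
    using borel_measurable_integrable[OF 2] by (intro integral_MD) (auto simp: test_functions_outside[OF \<phi>])
  ultimately show ?thesis
    by simp
qed

lemma integral_mult_tendsto_0:
  fixes a :: "nat \<Rightarrow> real^'n \<Rightarrow> real" and b :: "real^'n \<Rightarrow> real"
  assumes a: "\<And>j. a j \<in> borel_measurable MD" and b: "continuous_on UNIV b"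
    and lim: "(\<lambda>j. \<integral>\<^sup>+x. ennreal \<bar>a j x\<bar> \<partial>MD) \<longlonglongrightarrow> 0"
  shows "(\<lambda>j. \<integral>x. a j x * b x \<partial>MD) \<longlonglongrightarrow> 0"
proof -
  note [measurable] = a borel_measurable_lebesgue_on[OF borel_measurable_continuous_onI[OF b], of D]
  have "compact (b ` closure D)"
    using b bounded_D by (intro compact_continuous_image) (auto simp: compact_closure intro: continuous_on_subset)
  then obtain B where B: "\<And>x. x \<in> closure D \<Longrightarrow> \<bar>b x\<bar> \<le> B"
    by (force dest!: compact_imp_bounded simp: bounded_iff)
  \<comment> \<open>If the product is not integrable, its integral is 0 by convention and the bound
    is trivial.\<close>
  have bound: "ennreal \<bar>\<integral>x. a j x * b x \<partial>MD\<bar> \<le> ennreal \<bar>B\<bar> * (\<integral>\<^sup>+x. ennreal \<bar>a j x\<bar> \<partial>MD)" for j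
  proof (cases "integrable MD (\<lambda>x. a j x * b x)")
    case True
    have "ennreal \<bar>\<integral>x. a j x * b x \<partial>MD\<bar> \<le> (\<integral>\<^sup>+x. ennreal \<bar>a j x * b x\<bar> \<partial>MD)"
      using integral_norm_bound_ennreal[OF True] by simp
    also have "\<dots> \<le> (\<integral>\<^sup>+x. ennreal \<bar>B\<bar> * ennreal \<bar>a j x\<bar> \<partial>MD)"
    proof (rule nn_integral_mono)
      fix x
      assume "x \<in> space MD"
      then have "\<bar>b x\<bar> \<le> \<bar>B\<bar>"
        using B[of x] closure_subset[of D] by auto
      then have "\<bar>a j x * b x\<bar> \<le> \<bar>B\<bar> * \<bar>a j x\<bar>"
        using mult_right_mono[of "\<bar>b x\<bar>" "\<bar>B\<bar>" "\<bar>a j x\<bar>"] by (simp add: abs_mult mult.commute)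
      then show "ennreal \<bar>a j x * b x\<bar> \<le> ennreal \<bar>B\<bar> * ennreal \<bar>a j x\<bar>"
        by (simp add: ennreal_leI flip: ennreal_mult)
    qed
    also have "\<dots> = ennreal \<bar>B\<bar> * (\<integral>\<^sup>+x. ennreal \<bar>a j x\<bar> \<partial>MD)"
      by (rule nn_integral_cmult) measurable
    finally show ?thesis .
  qed (simp add: not_integrable_integral_eq)
  have "(\<lambda>j. ennreal \<bar>B\<bar> * (\<integral>\<^sup>+x. ennreal \<bar>a j x\<bar> \<partial>MD)) \<longlonglongrightarrow> ennreal \<bar>B\<bar> * 0"
    by (intro ennreal_tendsto_cmult lim) simp
  then have "(\<lambda>j. ennreal \<bar>\<integral>x. a j x * b x \<partial>MD\<bar>) \<longlonglongrightarrow> ennreal 0"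
    using ennreal_tendsto_0_mono[OF bound] by simp
  then have "(\<lambda>j. enn2real (ennreal \<bar>\<integral>x. a j x * b x \<partial>MD\<bar>)) \<longlonglongrightarrow> 0"
    by (rule tendsto_enn2real) simp
  then show ?thesis
    by (simp add: tendsto_rabs_zero_iff)
qed

text \<open>Closability of the horizontal gradient, by integration by parts against polynomials.\<close>

lemma has_hgrad_0:
  assumes "has_hgrad (\<lambda>x. 0) G"
  shows "AE x in MD. G x = 0"
proof -
  obtain \<phi> where \<phi>: "\<And>j. \<phi> j \<in> test_functions D" "Lp_converges p D \<phi> (\<lambda>x. 0)" "Lp_converges 2 D (\<lambda>j. grad (\<phi> j)) G"
    using assms by (auto simp: has_hgrad_def)
  have G[measurable]: "G \<in> borel_measurable MD"
    using has_hgrad_measurable[OF assms] by simp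
  note [measurable] = test_measurable[OF \<phi>(1)]
  have "AE x in MD. G x $ i = 0" for i
  proof -
    have lim\<phi>: "(\<lambda>j. \<integral>\<^sup>+x. ennreal \<bar>\<phi> j x\<bar> \<partial>MD) \<longlonglongrightarrow> 0"
      by (rule L1_tendsto_if_Lp[OF finite_MD, of _ p])
        (use \<phi>(2) p_gt_2 in \<open>auto simp: Lp_converges_def intro: test_measurable \<phi>\<close>)
    have limg: "(\<lambda>j. \<integral>\<^sup>+x. ennreal \<bar>grad (\<phi> j) x $ i - G x $ i\<bar> \<partial>MD) \<longlonglongrightarrow> 0"
    proof (rule L1_tendsto_if_Lp[OF finite_MD, of _ 2])
      have le: "(\<integral>\<^sup>+x. ennreal (\<bar>grad (\<phi> j) x $ i - G x $ i\<bar> powr 2) \<partial>MD) \<le> (\<integral>\<^sup>+x. ennreal (norm (grad (\<phi> j) x - G x) powr 2) \<partial>MD)" for j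
        using component_le_norm_cart[of "grad (\<phi> j) _ - G _" i]
        by (intro nn_integral_mono ennreal_leI powr_mono2) auto
      show "(\<lambda>j. \<integral>\<^sup>+x. ennreal (\<bar>grad (\<phi> j) x $ i - G x $ i\<bar> powr 2) \<partial>MD) \<longlonglongrightarrow> 0"
        by (rule ennreal_tendsto_0_mono[OF le]) (use \<phi>(3) in \<open>simp add: Lp_converges_def\<close>)
      show "(\<lambda>x. grad (\<phi> j) x $ i - G x $ i) \<in> borel_measurable MD" for j
        by (intro borel_measurable_diff borel_measurable_vec_nth' G test_measurable \<phi>(1))
    qed simp
    have intg: "integrable MD (\<lambda>x. grad (\<phi> j) x $ i * q x)" if "continuous_on UNIV q" for j q
    proof -
      have "integrable lborel (\<lambda>x. grad (\<phi> j) x $ i * q x)"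
      proof -
        obtain R where R: "\<And>x. R < norm x \<Longrightarrow> \<phi> j x = 0"
          using test_functions_C1c[OF \<phi>(1)[of j]] by (auto simp: C1c_def)
        show ?thesis
        proof (rule integrable_continuous_bounded_support[of _ R])
          show "continuous_on UNIV (\<lambda>x. grad (\<phi> j) x $ i * q x)"
            by (intro continuous_intros grad_classical_continuous test_functions_C1c[OF \<phi>(1)] that)
          show "grad (\<phi> j) x $ i * q x = 0" if "R < norm x" for x
            using C1c_derivative_eq_0[OF test_functions_C1c[OF \<phi>(1)] R that] by (simp add: grad_classical_def)
        qed
      qed
      then have "integrable lebesgue (\<lambda>x. grad (\<phi> j) x $ i * q x)"
        by (simp add: integrable_completion)
      then have "integrable lebesgue (\<lambda>x. indicator D x *\<^sub>R (grad (\<phi> j) x $ i * q x))"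
        by (rule integrable_mult_indicator[OF D_sets])
      then show ?thesis
        by (subst integrable_restrict_space) (simp_all add: D_sets)
    qed
    have intG: "integrable MD (\<lambda>x. G x $ i)"
    proof -
      have "\<forall>\<^sub>F j in sequentially. (\<integral>\<^sup>+x. ennreal \<bar>grad (\<phi> j) x $ i - G x $ i\<bar> \<partial>MD) < 1"
        using limg by (rule order_tendstoD) simp
      then obtain j where "(\<integral>\<^sup>+x. ennreal \<bar>grad (\<phi> j) x $ i - G x $ i\<bar> \<partial>MD) < 1"
        by (auto simp: eventually_sequentially)
      then have "integrable MD (\<lambda>x. grad (\<phi> j) x $ i - G x $ i)"
        by (intro integrableI_bounded) (auto intro: less_trans)
      from Bochner_Integration.integrable_diff[OF intg[of "\<lambda>x. 1" j] this] show ?thesis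
        by simp
    qed
    show ?thesis
    proof (rule AE_eq_0_if_orthogonal_polynomials[OF open_D bounded_D intG])
      fix q :: "real^'n \<Rightarrow> real"
      assume q: "real_polynomial_function q"
      note Cq = Ck_1_polynomial[OF q]
      have contq: "continuous_on UNIV q"
        using Ck_1_has_derivative[OF Cq] by (auto intro!: continuous_at_imp_continuous_on has_derivative_continuous)
      have contDq: "continuous_on UNIV (\<lambda>x. frechet_derivative q (at x) (X i x))"
        unfolding continuous_on_def
      proof
        fix x
        have "continuous_on UNIV (X i)"
          using continuous_lf[of "X i 0"] X_eq_lf[of i] by simp
        then show "((\<lambda>x. frechet_derivative q (at x) (X i x)) \<longlongrightarrow> frechet_derivative q (at x) (X i x)) (at x)"
          by (intro derivative_tendsto[where f'="\<lambda>x. frechet_derivative q (at x)",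
              OF has_derivative_linear[OF Ck_1_has_derivative[OF Cq]]])
            (use Cq in \<open>auto simp: continuous_on_def\<close>)
      qed
      have "(\<lambda>j. \<integral>x. (grad (\<phi> j) x $ i - G x $ i) * q x \<partial>MD) \<longlonglongrightarrow> 0"
        by (rule integral_mult_tendsto_0[OF _ contq limg]) measurable
      moreover have "(\<lambda>j. \<integral>x. \<phi> j x * frechet_derivative q (at x) (X i x) \<partial>MD) \<longlonglongrightarrow> 0"
        by (rule integral_mult_tendsto_0[OF _ contDq lim\<phi>]) measurable
      moreover have "integrable MD (\<lambda>x. G x $ i * q x)"
      proof -
        have "compact (q ` closure D)"
          using contq bounded_D by (intro compact_continuous_image) (auto simp: compact_closure intro: continuous_on_subset)
        then obtain B where B: "\<And>x. x \<in> closure D \<Longrightarrow> \<bar>q x\<bar> \<le> B"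
          by (force dest!: compact_imp_bounded simp: bounded_iff)
        note [measurable] = borel_measurable_lebesgue_on[OF borel_measurable_continuous_onI[OF contq], of D]
        show ?thesis
        proof (rule Bochner_Integration.integrable_bound)
          show "integrable MD (\<lambda>x. B * G x $ i)"
            using intG by simp
          show "(\<lambda>x. G x $ i * q x) \<in> borel_measurable MD"
            by measurable
          show "AE x in MD. norm (G x $ i * q x) \<le> norm (B * G x $ i)"
          proof (rule AE_I2)
            fix x
            assume "x \<in> space MD"
            then have "\<bar>q x\<bar> \<le> \<bar>B\<bar>"
              using B[of x] closure_subset[of D] by auto
            then show "norm (G x $ i * q x) \<le> norm (B * G x $ i)"
              using mult_right_mono[of "\<bar>q x\<bar>" "\<bar>B\<bar>" "\<bar>G x $ i\<bar>"] by (simp add: abs_mult mult.commute)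
          qed
        qed
      qed
      \<comment> \<open>In the limit the left side and the first term on the right disappear, the
        latter because \<open>\<phi> j\<close> tends to 0; only the integral of \<open>G\<close>
        against \<open>q\<close> is left.\<close>
      then have "(\<integral>x. (grad (\<phi> j) x $ i - G x $ i) * q x \<partial>MD)
          = - (\<integral>x. \<phi> j x * frechet_derivative q (at x) (X i x) \<partial>MD) - (\<integral>x. G x $ i * q x \<partial>MD)" for j
        unfolding integration_by_parts[OF \<phi>(1) Cq, symmetric]
        by (simp add: left_diff_distrib intg[OF contq])
      ultimately have "(\<lambda>j. - (\<integral>x. G x $ i * q x \<partial>MD)) \<longlonglongrightarrow> 0 + 0"
        using tendsto_add[of "\<lambda>j. \<integral>x. (grad (\<phi> j) x $ i - G x $ i) * q x \<partial>MD" 0 sequentially] by fastforce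
      then show "(\<integral>x. G x $ i * q x \<partial>MD) = 0"
        by (simp add: LIMSEQ_const_iff)
    qed
  qed
  then have "AE x in MD. \<forall>i. G x $ i = 0"
    by (simp add: AE_all_countable)
  then show ?thesis
    by eventually_elim (simp add: vec_eq_iff)
qed

lemma has_hgrad_unique:
  assumes "has_hgrad u G" "has_hgrad u H"
  shows "AE x in MD. G x = H x"
proof -
  have "AE x in MD. G x - H x = 0"
    using has_hgrad_diff[OF assms] by (intro has_hgrad_0) simp
  then show ?thesis
    by eventually_elim simp
qed

end

section \<open>Convexity on small balls\<close>

context fs_space
begin

text \<open>One test function within distance 1 is enough: it has finite norms, and the
  quasi-triangle inequality passes this on.\<close>

lemma has_hgrad_integrable:
  assumes h: "has_hgrad u G"
  shows hgrad_sq_integrable: "integrable MD (\<lambda>x. (norm (G x))\<^sup>2)"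
    and Lp_integrable: "integrable MD (\<lambda>x. \<bar>u x\<bar> powr p)"
proof -
  obtain \<phi> where \<phi>: "\<And>j. \<phi> j \<in> test_functions D" "Lp_converges p D \<phi> u" "Lp_converges 2 D (\<lambda>j. grad (\<phi> j)) G"
    using h by (auto simp: has_hgrad_def)
  note [measurable] = test_measurable[OF \<phi>(1)] has_hgrad_measurable[OF h]
  have "\<forall>\<^sub>F j in sequentially. (\<integral>\<^sup>+x. ennreal (norm (grad (\<phi> j) x - G x) powr 2) \<partial>MD) < 1"
    using \<phi>(3) unfolding Lp_converges_def by (intro order_tendstoD) auto
  moreover have "\<forall>\<^sub>F j in sequentially. (\<integral>\<^sup>+x. ennreal (norm (\<phi> j x - u x) powr p) \<partial>MD) < 1"
    using \<phi>(2) unfolding Lp_converges_def by (intro order_tendstoD) auto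
  ultimately have "\<forall>\<^sub>F j in sequentially. (\<integral>\<^sup>+x. ennreal (norm (grad (\<phi> j) x - G x) powr 2) \<partial>MD) < 1 \<and>
      (\<integral>\<^sup>+x. ennreal (norm (\<phi> j x - u x) powr p) \<partial>MD) < 1"
    by eventually_elim simp
  then obtain j where j: "(\<integral>\<^sup>+x. ennreal (norm (grad (\<phi> j) x - G x) powr 2) \<partial>MD) < 1"
      "(\<integral>\<^sup>+x. ennreal (norm (\<phi> j x - u x) powr p) \<partial>MD) < 1"
    by (auto simp: eventually_sequentially)
  have "(\<integral>\<^sup>+x. ennreal (norm (grad (\<phi> j) x) powr 2) \<partial>MD) < \<infinity>"
    using energy_MD[OF \<phi>(1)[of j]] energy_finite[OF test_functions_C1c[OF \<phi>(1)[of j]]] by simp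
  then have "ennreal (2 powr 2) * ((\<integral>\<^sup>+x. ennreal (norm (grad (\<phi> j) x) powr 2) \<partial>MD)
      + (\<integral>\<^sup>+x. ennreal (norm (G x - grad (\<phi> j) x) powr 2) \<partial>MD)) < \<infinity>"
    using j(1) by (auto simp: norm_minus_commute ennreal_mult_less_top intro: less_trans)
  then have "(\<integral>\<^sup>+x. ennreal (norm (G x) powr 2) \<partial>MD) < \<infinity>"
    using nn_integral_powr_add_le[of 2 "grad (\<phi> j)" MD "\<lambda>x. G x - grad (\<phi> j) x"] by (auto intro: le_less_trans)
  then show "integrable MD (\<lambda>x. (norm (G x))\<^sup>2)"
    by (intro integrableI_bounded) simp_all
  have "(\<integral>\<^sup>+x. ennreal (norm (\<phi> j x) powr p) \<partial>MD) < \<infinity>"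
  proof -
    have "(\<integral>\<^sup>+x. ennreal (norm (\<phi> j x) powr p) \<partial>MD) = (\<integral>\<^sup>+x. ennreal (\<bar>\<phi> j x\<bar> powr p) \<partial>lborel)"
      using C1c_measurable[OF test_functions_C1c[OF \<phi>(1)[of j]]]
      by (subst nn_integral_MD) (auto simp: test_functions_outside[OF \<phi>(1)])
    then show ?thesis
      using Lp_finite[OF test_functions_C1c[OF \<phi>(1)[of j]], of p] p_gt_2 by simp
  qed
  then have "ennreal (2 powr p) * ((\<integral>\<^sup>+x. ennreal (norm (\<phi> j x) powr p) \<partial>MD)
      + (\<integral>\<^sup>+x. ennreal (norm (u x - \<phi> j x) powr p) \<partial>MD)) < \<infinity>"
    using j(2) by (auto simp: norm_minus_commute abs_minus_commute ennreal_mult_less_top intro: less_trans)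
  then have "(\<integral>\<^sup>+x. ennreal (norm (u x) powr p) \<partial>MD) < \<infinity>"
    using nn_integral_powr_add_le[of p "\<phi> j" MD "\<lambda>x. u x - \<phi> j x"] p_gt_2 by (auto intro: le_less_trans)
  then show "integrable MD (\<lambda>x. \<bar>u x\<bar> powr p)"
    by (intro integrableI_bounded) simp_all
qed

text \<open>The inequality survives approximation through quasi-triangle inequalities for the
  function and for its gradient. The error \<open>\<eta>\<close> tends to 0 at the end and only the
  constant has grown.\<close>

lemma sobolev_completion:
  obtains C where "0 < C"
    "\<And>u G. has_hgrad u G \<Longrightarrow> (\<integral>x. \<bar>u x\<bar> powr p \<partial>MD) \<le> C * (\<integral>x. (norm (G x))\<^sup>2 \<partial>MD) powr (p / 2)"
proof -
  obtain K where K: "0 \<le> K"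
    "\<And>f. C1c f \<Longrightarrow> (\<integral>\<^sup>+x. ennreal (\<bar>f x\<bar> powr p) \<partial>lborel) \<le> ennreal (K * enn2real (energy f) powr (p / 2))"
    by (rule sobolev[OF Q_ge_3 p_eq]) blast
  \<comment> \<open>\<open>2 powr p\<close> stems from splitting \<open>u\<close> and the 4 from
    splitting its gradient; adding 1 makes \<open>C\<close> positive, since the radius is obtained
    by dividing by \<open>C\<close>.\<close>
  define C where "C = 2 powr p * (K * 4 powr (p / 2)) + 1"
  show thesis
  proof (rule that[of C])
    show "0 < C"
      using K(1) by (simp add: C_def add_nonneg_pos)
    fix u G
    assume h: "has_hgrad u G"
    obtain \<phi> where \<phi>: "\<And>j. \<phi> j \<in> test_functions D" "Lp_converges p D \<phi> u" "Lp_converges 2 D (\<lambda>j. grad (\<phi> j)) G"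
      using h by (auto simp: has_hgrad_def)
    note [measurable] = test_measurable[OF \<phi>(1)] has_hgrad_measurable[OF h]
    define A where "A = (\<integral>x. (norm (G x))\<^sup>2 \<partial>MD)"
    define I where "I = (\<integral>x. \<bar>u x\<bar> powr p \<partial>MD)"
    have A: "(\<integral>\<^sup>+x. ennreal (norm (G x) powr 2) \<partial>MD) = ennreal A" "0 \<le> A"
      using nn_integral_eq_integral[OF hgrad_sq_integrable[OF h]] by (simp_all add: A_def)
    have I: "(\<integral>\<^sup>+x. ennreal (norm (u x) powr p) \<partial>MD) = ennreal I" "0 \<le> I"
      using nn_integral_eq_integral[OF Lp_integrable[OF h]] by (simp_all add: I_def)
    have bound: "I \<le> 2 powr p * (K * (4 * (A + \<eta>)) powr (p / 2) + \<eta>)" if \<eta>: "0 < \<eta>" for \<eta>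
    proof -
      have "\<forall>\<^sub>F j in sequentially. (\<integral>\<^sup>+x. ennreal (norm (grad (\<phi> j) x - G x) powr 2) \<partial>MD) < ennreal \<eta>"
        using \<phi>(3) \<eta> unfolding Lp_converges_def by (intro order_tendstoD) auto
      moreover have "\<forall>\<^sub>F j in sequentially. (\<integral>\<^sup>+x. ennreal (norm (\<phi> j x - u x) powr p) \<partial>MD) < ennreal \<eta>"
        using \<phi>(2) \<eta> unfolding Lp_converges_def by (intro order_tendstoD) auto
      ultimately have "\<forall>\<^sub>F j in sequentially. (\<integral>\<^sup>+x. ennreal (norm (grad (\<phi> j) x - G x) powr 2) \<partial>MD) < ennreal \<eta> \<and>
          (\<integral>\<^sup>+x. ennreal (norm (\<phi> j x - u x) powr p) \<partial>MD) < ennreal \<eta>"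
        by eventually_elim simp
      then obtain j where j: "(\<integral>\<^sup>+x. ennreal (norm (grad (\<phi> j) x - G x) powr 2) \<partial>MD) < ennreal \<eta>"
          "(\<integral>\<^sup>+x. ennreal (norm (\<phi> j x - u x) powr p) \<partial>MD) < ennreal \<eta>"
        by (auto simp: eventually_sequentially)
      note C = test_functions_C1c[OF \<phi>(1)[of j]]
      have "energy (\<phi> j) = (\<integral>\<^sup>+x. ennreal (norm (G x + (grad (\<phi> j) x - G x)) powr 2) \<partial>MD)"
        by (simp add: energy_MD[OF \<phi>(1)])
      also have "\<dots> \<le> ennreal (2 powr 2) * ((\<integral>\<^sup>+x. ennreal (norm (G x) powr 2) \<partial>MD)
          + (\<integral>\<^sup>+x. ennreal (norm (grad (\<phi> j) x - G x) powr 2) \<partial>MD))"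
        by (rule nn_integral_powr_add_le) auto
      also have "\<dots> \<le> ennreal (2 powr 2) * (ennreal A + ennreal \<eta>)"
        unfolding A(1) using j(1) by (intro mult_left_mono add_left_mono) auto
      also have "\<dots> = ennreal (4 * (A + \<eta>))"
        using A(2) \<eta> by (simp add: ennreal_mult)
      finally have E: "enn2real (energy (\<phi> j)) \<le> 4 * (A + \<eta>)"
        using A(2) \<eta> by (intro enn2real_leI) auto
      have "ennreal I = (\<integral>\<^sup>+x. ennreal (norm (\<phi> j x + (u x - \<phi> j x)) powr p) \<partial>MD)"
        by (simp flip: I(1))
      also have "\<dots> \<le> ennreal (2 powr p) * ((\<integral>\<^sup>+x. ennreal (norm (\<phi> j x) powr p) \<partial>MD)
          + (\<integral>\<^sup>+x. ennreal (norm (u x - \<phi> j x) powr p) \<partial>MD))"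
        using p_gt_2 by (intro nn_integral_powr_add_le) auto
      also have "\<dots> \<le> ennreal (2 powr p) * (ennreal (K * (4 * (A + \<eta>)) powr (p / 2)) + ennreal \<eta>)"
      proof (intro mult_left_mono add_mono)
        have "(\<integral>\<^sup>+x. ennreal (norm (\<phi> j x) powr p) \<partial>MD) = (\<integral>\<^sup>+x. ennreal (\<bar>\<phi> j x\<bar> powr p) \<partial>lborel)"
          using C1c_measurable[OF C] by (subst nn_integral_MD) (auto simp: test_functions_outside[OF \<phi>(1)])
        also have "\<dots> \<le> ennreal (K * enn2real (energy (\<phi> j)) powr (p / 2))"
          by (rule K(2)[OF C])
        also have "\<dots> \<le> ennreal (K * (4 * (A + \<eta>)) powr (p / 2))"
          using K(1) p_gt_2 E by (intro ennreal_leI mult_left_mono powr_mono2) auto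
        finally show "(\<integral>\<^sup>+x. ennreal (norm (\<phi> j x) powr p) \<partial>MD) \<le> ennreal (K * (4 * (A + \<eta>)) powr (p / 2))" .
        show "(\<integral>\<^sup>+x. ennreal (norm (u x - \<phi> j x) powr p) \<partial>MD) \<le> ennreal \<eta>"
          using j(2) by (simp add: norm_minus_commute abs_minus_commute less_imp_le)
      qed simp
      also have "\<dots> = ennreal (2 powr p * (K * (4 * (A + \<eta>)) powr (p / 2) + \<eta>))"
        using K(1) \<eta> by (simp add: ennreal_mult)
      finally show ?thesis
        using K(1) \<eta> by (subst (asm) ennreal_le_iff) auto
    qed
    have "((\<lambda>\<eta>. 2 powr p * (K * (4 * (A + \<eta>)) powr (p / 2) + \<eta>)) \<longlongrightarrow> 2 powr p * (K * (4 * (A + 0)) powr (p / 2) + 0)) (at_right 0)"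
      using p_gt_2 A(2)
      by (intro tendsto_intros tendsto_powr') (auto intro!: eventually_at_rightI[of 0 1])
    moreover have "\<forall>\<^sub>F \<eta> in at_right 0. I \<le> 2 powr p * (K * (4 * (A + \<eta>)) powr (p / 2) + \<eta>)"
      by (rule eventually_at_rightI[of 0 1], rule bound) simp_all
    ultimately have "I \<le> 2 powr p * (K * (4 * (A + 0)) powr (p / 2) + 0)"
      by (rule tendsto_lowerbound) simp
    also have "\<dots> = 2 powr p * (K * 4 powr (p / 2)) * A powr (p / 2)"
      using A(2) by (simp add: powr_mult)
    also have "\<dots> \<le> C * A powr (p / 2)"
      by (intro mult_right_mono) (auto simp: C_def)
    finally show "(\<integral>x. \<bar>u x\<bar> powr p \<partial>MD) \<le> C * (\<integral>x. (norm (G x))\<^sup>2 \<partial>MD) powr (p / 2)"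
      by (simp add: I_def A_def)
  qed
qed

lemma hgrad_inner_bound:
  assumes "has_hgrad u G" "has_hgrad v H"
  shows "integrable MD (\<lambda>x. G x \<bullet> H x)"
    and "\<bar>\<integral>x. G x \<bullet> H x \<partial>MD\<bar> \<le> sqrt (\<integral>x. (norm (G x))\<^sup>2 \<partial>MD) * sqrt (\<integral>x. (norm (H x))\<^sup>2 \<partial>MD)"
proof -
  note [measurable] = has_hgrad_measurable[OF assms(1)] has_hgrad_measurable[OF assms(2)]
  have sq: "(norm y)\<^sup>2 powr (1/2) = norm y" for y :: "real^'m"
    by (simp add: powr_half_sqrt)
  have int: "integrable MD (\<lambda>x. norm (G x) * norm (H x))"
    using Hoelder_integrable[OF hgrad_sq_integrable[OF assms(1)] _ hgrad_sq_integrable[OF assms(2)], of "1/2" "1/2"]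
    by (simp add: sq)
  show *: "integrable MD (\<lambda>x. G x \<bullet> H x)"
    by (rule Bochner_Integration.integrable_bound[OF int]) (auto simp: Cauchy_Schwarz_ineq2)
  have "\<bar>\<integral>x. G x \<bullet> H x \<partial>MD\<bar> \<le> (\<integral>x. \<bar>G x \<bullet> H x\<bar> \<partial>MD)"
    by (rule integral_abs_bound)
  also have "\<dots> \<le> (\<integral>x. norm (G x) * norm (H x) \<partial>MD)"
    using * by (intro integral_mono int) (auto simp: Cauchy_Schwarz_ineq2)
  also have "\<dots> \<le> (\<integral>x. (norm (G x))\<^sup>2 \<partial>MD) powr (1/2) * (\<integral>x. (norm (H x))\<^sup>2 \<partial>MD) powr (1/2)"
    using Hoelder_le[OF hgrad_sq_integrable[OF assms(1)] _ hgrad_sq_integrable[OF assms(2)], of "1/2" "1/2"]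
    by (simp add: sq)
  finally show "\<bar>\<integral>x. G x \<bullet> H x \<partial>MD\<bar> \<le> sqrt (\<integral>x. (norm (G x))\<^sup>2 \<partial>MD) * sqrt (\<integral>x. (norm (H x))\<^sup>2 \<partial>MD)"
    by (simp add: powr_half_sqrt)
qed

lemma Lp_Hoelder:
  assumes "has_hgrad u G" "has_hgrad w H" and s: "0 < s" "s < p"
  shows Lp_Hoelder_integrable: "integrable MD (\<lambda>x. \<bar>u x\<bar> powr (p - s) * \<bar>w x\<bar> powr s)"
    and Lp_Hoelder_le: "(\<integral>x. \<bar>u x\<bar> powr (p - s) * \<bar>w x\<bar> powr s \<partial>MD)
      \<le> (\<integral>x. \<bar>u x\<bar> powr p \<partial>MD) powr ((p - s) / p) * (\<integral>x. \<bar>w x\<bar> powr p \<partial>MD) powr (s / p)"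
proof -
  have p0: "p > 0"
    using p_gt_2 by simp
  have 1: "0 < (p - s) / p" "0 < s / p" "(p - s) / p + s / p = 1"
    using s p0 by (simp_all add: field_simps)
  show "integrable MD (\<lambda>x. \<bar>u x\<bar> powr (p - s) * \<bar>w x\<bar> powr s)"
    using Hoelder_integrable[OF Lp_integrable[OF assms(1)] _ Lp_integrable[OF assms(2)] _ 1] p0
    by (simp add: powr_powr)
  show "(\<integral>x. \<bar>u x\<bar> powr (p - s) * \<bar>w x\<bar> powr s \<partial>MD)
      \<le> (\<integral>x. \<bar>u x\<bar> powr p \<partial>MD) powr ((p - s) / p) * (\<integral>x. \<bar>w x\<bar> powr p \<partial>MD) powr (s / p)"
    using Hoelder_le[OF Lp_integrable[OF assms(1)] _ Lp_integrable[OF assms(2)] _ 1] p0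
    by (simp add: powr_powr)
qed

text \<open>The Gateaux derivative of the functional at \<open>u\<close> in direction
  \<open>w\<close>. It is written with the chosen gradients, so even its linearity in
  \<open>w\<close> has to be proved.\<close>

definition deriv_functional :: "real \<Rightarrow> (real^'n \<Rightarrow> real) \<Rightarrow> (real^'n \<Rightarrow> real) \<Rightarrow> real" where
  "deriv_functional \<mu> u w = (\<integral>x. hgrad X p D u x \<bullet> hgrad X p D w x \<partial>MD)
     - \<mu> * (\<integral>x. \<bar>u x\<bar> powr (p - 2) * u x * w x \<partial>MD)"

lemma potential_integrable:
  assumes "has_hgrad u G" "has_hgrad w H"
  shows "integrable MD (\<lambda>x. \<bar>u x\<bar> powr (p - 2) * u x * w x)"
    and "\<bar>\<integral>x. \<bar>u x\<bar> powr (p - 2) * u x * w x \<partial>MD\<bar>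
      \<le> (\<integral>x. \<bar>u x\<bar> powr p \<partial>MD) powr ((p - 1) / p) * (\<integral>x. \<bar>w x\<bar> powr p \<partial>MD) powr (1 / p)"
proof -
  note [measurable] = has_hgrad_measurable[OF assms(1)] has_hgrad_measurable[OF assms(2)]
  have eq: "\<bar>\<bar>u x\<bar> powr (p - 2) * u x * w x\<bar> = \<bar>u x\<bar> powr (p - 1) * \<bar>w x\<bar> powr 1" for x
    using powr_add[of "\<bar>u x\<bar>" "p - 2" 1] by (simp add: abs_mult)
  have s: "0 < (1::real)" "1 < p"
    using p_gt_2 by auto
  show int: "integrable MD (\<lambda>x. \<bar>u x\<bar> powr (p - 2) * u x * w x)"
    by (rule Bochner_Integration.integrable_bound[OF Lp_Hoelder_integrable[OF assms s]]) (auto simp: eq[simplified])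
  have "\<bar>\<integral>x. \<bar>u x\<bar> powr (p - 2) * u x * w x \<partial>MD\<bar> \<le> (\<integral>x. \<bar>\<bar>u x\<bar> powr (p - 2) * u x * w x\<bar> \<partial>MD)"
    by (rule integral_abs_bound)
  also have "\<dots> = (\<integral>x. \<bar>u x\<bar> powr (p - 1) * \<bar>w x\<bar> powr 1 \<partial>MD)"
    by (simp only: eq)
  also have "\<dots> \<le> (\<integral>x. \<bar>u x\<bar> powr p \<partial>MD) powr ((p - 1) / p) * (\<integral>x. \<bar>w x\<bar> powr p \<partial>MD) powr (1 / p)"
    by (rule Lp_Hoelder_le[OF assms s])
  finally show "\<bar>\<integral>x. \<bar>u x\<bar> powr (p - 2) * u x * w x \<partial>MD\<bar>
      \<le> (\<integral>x. \<bar>u x\<bar> powr p \<partial>MD) powr ((p - 1) / p) * (\<integral>x. \<bar>w x\<bar> powr p \<partial>MD) powr (1 / p)" .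
qed

lemma hgrad_AE_eq:
  assumes "has_hgrad u G"
  shows "AE x in MD. hgrad X p D u x = G x"
  using has_hgrad_unique[OF has_hgrad_hgrad[OF assms] assms] .

text \<open>The gradients chosen for \<open>v\<close>, \<open>w\<close> and \<open>v + w\<close> are
  unrelated representatives and agree with the expected sum only almost everywhere, by
  \<open>has_hgrad_unique\<close>. Boundedness is Cauchy-Schwarz for the Dirichlet part, Hoelder and
  the Folland-Stein inequality for the critical part.\<close>

lemma deriv_functional_dual:
  assumes u: "u \<in> folland_stein X p D"
  shows "deriv_functional \<mu> u \<in> fs_dual X p D"
proof -
  let ?g = "hgrad X p D"
  note hg = folland_stein_has_hgrad
  note hu = hg[OF u]
  obtain C where C: "0 < C"
    "\<And>u G. has_hgrad u G \<Longrightarrow> (\<integral>x. \<bar>u x\<bar> powr p \<partial>MD) \<le> C * (\<integral>x. (norm (G x))\<^sup>2 \<partial>MD) powr (p / 2)"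
    by (rule sobolev_completion) blast
  have add: "deriv_functional \<mu> u (v + w) = deriv_functional \<mu> u v + deriv_functional \<mu> u w"
    if v: "v \<in> folland_stein X p D" and w: "w \<in> folland_stein X p D" for v w
  proof -
    have vw: "has_hgrad (v + w) (\<lambda>x. ?g v x + ?g w x)"
      using has_hgrad_add[OF hg[OF v] hg[OF w]] by (simp add: plus_fun_def)
    have [measurable]: "?g u \<in> borel_measurable MD" "?g v \<in> borel_measurable MD" "?g w \<in> borel_measurable MD" "?g (v + w) \<in> borel_measurable MD"
      by (rule has_hgrad_measurable(2)[OF has_hgrad_hgrad], rule hu hg[OF v] hg[OF w] vw)+
    have "(\<integral>x. ?g u x \<bullet> ?g (v + w) x \<partial>MD) = (\<integral>x. ?g u x \<bullet> ?g v x + ?g u x \<bullet> ?g w x \<partial>MD)"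
      by (rule integral_cong_AE) (measurable, use hgrad_AE_eq[OF vw] in \<open>eventually_elim; simp add: inner_add_right\<close>)
    also have "\<dots> = (\<integral>x. ?g u x \<bullet> ?g v x \<partial>MD) + (\<integral>x. ?g u x \<bullet> ?g w x \<partial>MD)"
      by (intro Bochner_Integration.integral_add hgrad_inner_bound(1)[OF hu hg] v w)
    finally show ?thesis
      using potential_integrable(1)[OF hu hg[OF v]] potential_integrable(1)[OF hu hg[OF w]]
      by (simp add: deriv_functional_def algebra_simps)
  qed
  have scale: "deriv_functional \<mu> u (c *\<^sub>R v) = c * deriv_functional \<mu> u v"
    if v: "v \<in> folland_stein X p D" for v c
  proof -
    have cv: "has_hgrad (c *\<^sub>R v) (\<lambda>x. c *\<^sub>R ?g v x)"
      using has_hgrad_scale[OF hg[OF v], of c] by (simp add: scaleR_fun_def)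
    have [measurable]: "?g u \<in> borel_measurable MD" "?g v \<in> borel_measurable MD" "?g (c *\<^sub>R v) \<in> borel_measurable MD"
      by (rule has_hgrad_measurable(2)[OF has_hgrad_hgrad], rule hu hg[OF v] cv)+
    have "(\<integral>x. ?g u x \<bullet> ?g (c *\<^sub>R v) x \<partial>MD) = (\<integral>x. c * (?g u x \<bullet> ?g v x) \<partial>MD)"
      by (rule integral_cong_AE) (measurable, use hgrad_AE_eq[OF cv] in \<open>eventually_elim; simp\<close>)
    then have "(\<integral>x. ?g u x \<bullet> ?g (c *\<^sub>R v) x \<partial>MD) = c * (\<integral>x. ?g u x \<bullet> ?g v x \<partial>MD)"
      by simp
    moreover have "(\<integral>x. \<bar>u x\<bar> powr (p - 2) * u x * (c *\<^sub>R v) x \<partial>MD) = c * (\<integral>x. \<bar>u x\<bar> powr (p - 2) * u x * v x \<partial>MD)"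
      by (simp add: scaleR_fun_def mult.left_commute)
    ultimately show ?thesis
      by (simp add: deriv_functional_def algebra_simps)
  qed
  define I where "I = (\<integral>x. \<bar>u x\<bar> powr p \<partial>MD) powr ((p - 1) / p)"
  have bound: "\<bar>deriv_functional \<mu> u w\<bar> \<le> (fs_norm X p D u + \<bar>\<mu>\<bar> * (I * C powr (1 / p))) * fs_norm X p D w"
    if w: "w \<in> folland_stein X p D" for w
  proof -
    let ?A = "\<integral>x. (norm (?g w x))\<^sup>2 \<partial>MD"
    have "\<bar>\<integral>x. \<bar>u x\<bar> powr (p - 2) * u x * w x \<partial>MD\<bar> \<le> I * (\<integral>x. \<bar>w x\<bar> powr p \<partial>MD) powr (1 / p)"
      unfolding I_def by (rule potential_integrable(2)[OF hu hg[OF w]])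
    also have "\<dots> \<le> I * (C * ?A powr (p / 2)) powr (1 / p)"
      using p_gt_2 by (intro mult_left_mono powr_mono2 C(2) hg w) (auto simp: I_def)
    also have "\<dots> = I * C powr (1 / p) * sqrt ?A"
      using C(1) p_gt_2 by (simp add: powr_mult powr_powr powr_half_sqrt)
    finally have 1: "\<bar>\<integral>x. \<bar>u x\<bar> powr (p - 2) * u x * w x \<partial>MD\<bar> \<le> I * C powr (1 / p) * fs_norm X p D w"
      by (simp add: fs_norm_def)
    have 2: "\<bar>\<integral>x. ?g u x \<bullet> ?g w x \<partial>MD\<bar> \<le> fs_norm X p D u * fs_norm X p D w"
      using hgrad_inner_bound(2)[OF hu hg[OF w]] by (simp add: fs_norm_def)
    have "\<bar>deriv_functional \<mu> u w\<bar> \<le> \<bar>\<integral>x. ?g u x \<bullet> ?g w x \<partial>MD\<bar> + \<bar>\<mu>\<bar> * \<bar>\<integral>x. \<bar>u x\<bar> powr (p - 2) * u x * w x \<partial>MD\<bar>"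
      unfolding deriv_functional_def abs_mult[symmetric] by (rule abs_triangle_ineq4)
    also have "\<dots> \<le> fs_norm X p D u * fs_norm X p D w + \<bar>\<mu>\<bar> * (I * C powr (1 / p) * fs_norm X p D w)"
      by (intro add_mono 2 mult_left_mono 1) simp
    finally show ?thesis
      by (simp add: algebra_simps)
  qed
  show ?thesis
    unfolding fs_dual_def mem_Collect_eq
    by (intro conjI ballI allI add scale exI[of _ "fs_norm X p D u + \<bar>\<mu>\<bar> * (I * C powr (1 / p))"] bound)
qed

text \<open>Convexity in the form of a supporting tangent at every point of the ball, which is all
  that weak lower semicontinuity requires.\<close>

lemma convexity_inequality:
  assumes \<mu>: "0 < \<mu>"
  obtains \<rho> where "0 < \<rho>"
    "\<And>u v. u \<in> fs_closed_ball X p D \<rho> \<Longrightarrow> v \<in> fs_closed_ball X p D \<rho> \<Longrightarrow>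
      critical_functional X p D \<mu> u + (deriv_functional \<mu> u v - deriv_functional \<mu> u u)
        \<le> critical_functional X p D \<mu> v"
proof -
  let ?g = "hgrad X p D"
  obtain C where C: "0 < C"
    "\<And>u G. has_hgrad u G \<Longrightarrow> (\<integral>x. \<bar>u x\<bar> powr p \<partial>MD) \<le> C * (\<integral>x. (norm (G x))\<^sup>2 \<partial>MD) powr (p / 2)"
    by (rule sobolev_completion) blast
  \<comment> \<open>Solves \<open>\<mu> * (p - 1) * 2 * C * \<rho> powr (p - 2) = 1 / 2\<close>, so
    that the critical remainder is exactly absorbed by half the squared distance. The 2 counts the
    weights at both endpoints \<open>u\<close> and \<open>v\<close>.\<close>
  define \<rho> where "\<rho> = (1 / (4 * \<mu> * (p - 1) * C)) powr (1 / (p - 2))"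
  have \<rho>: "0 < \<rho>"
    using \<mu> p_gt_2 C(1) by (simp add: \<rho>_def)
  have \<rho>p: "\<mu> * (p - 1) * (2 * (C * \<rho> powr (p - 2))) = 1 / 2"
    using \<mu> p_gt_2 C(1) by (simp add: \<rho>_def powr_powr field_simps)
  show thesis
  proof (rule that[OF \<rho>])
    fix u v
    assume uB: "u \<in> fs_closed_ball X p D \<rho>" and vB: "v \<in> fs_closed_ball X p D \<rho>"
    have hu: "has_hgrad u (?g u)" and hv: "has_hgrad v (?g v)"
      using uB vB by (auto simp: fs_closed_ball_def intro: folland_stein_has_hgrad)
    define w where "w = (\<lambda>x. v x - u x)"
    define H where "H = (\<lambda>x. ?g v x - ?g u x)"
    have hw: "has_hgrad w H"
      unfolding w_def H_def by (rule has_hgrad_diff[OF hv hu])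
    define W where "W = (\<integral>x. (norm (H x))\<^sup>2 \<partial>MD)"
    have W: "0 \<le> W"
      by (simp add: W_def)
    note int = hgrad_sq_integrable[OF hu] hgrad_sq_integrable[OF hv] hgrad_inner_bound(1)[OF hu hv]
      hgrad_inner_bound(1)[OF hu hu]
    have "W = (\<integral>x. (norm (?g v x))\<^sup>2 - 2 * (?g u x \<bullet> ?g v x) + (norm (?g u x))\<^sup>2 \<partial>MD)"
      unfolding W_def H_def
      by (simp add: power2_norm_eq_inner inner_diff_left inner_diff_right inner_commute algebra_simps)
    then have Weq: "W = (\<integral>x. (norm (?g v x))\<^sup>2 \<partial>MD) - 2 * (\<integral>x. ?g u x \<bullet> ?g v x \<partial>MD) + (\<integral>x. (norm (?g u x))\<^sup>2 \<partial>MD)"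
      using int by simp
    have uu: "(\<integral>x. ?g u x \<bullet> ?g u x \<partial>MD) = (\<integral>x. (norm (?g u x))\<^sup>2 \<partial>MD)"
      by (simp add: power2_norm_eq_inner)
    \<comment> \<open>Hoelder with exponents \<open>(p - 2) / p\<close> and \<open>2 / p\<close>:
      the powers of \<open>C\<close> add up to \<open>C\<close> itself, the ball contributes
      \<open>\<rho> powr (p - 2)\<close> and the difference contributes \<open>W\<close>.\<close>
    have weight: "integrable MD (\<lambda>x. \<bar>z x\<bar> powr (p - 2) * (w x)\<^sup>2)"
      "(\<integral>x. \<bar>z x\<bar> powr (p - 2) * (w x)\<^sup>2 \<partial>MD) \<le> C * \<rho> powr (p - 2) * W"
      if z: "z \<in> fs_closed_ball X p D \<rho>" for z
    proof -
      have hz: "has_hgrad z (?g z)"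
        using z by (auto simp: fs_closed_ball_def intro: folland_stein_has_hgrad)
      have s: "0 < (2::real)" "2 < p"
        using p_gt_2 by auto
      show "integrable MD (\<lambda>x. \<bar>z x\<bar> powr (p - 2) * (w x)\<^sup>2)"
        using Lp_Hoelder_integrable[OF hz hw s] by simp
      let ?A = "\<integral>x. (norm (?g z x))\<^sup>2 \<partial>MD"
      have A: "0 \<le> ?A" "?A \<le> \<rho>\<^sup>2"
        using z \<rho> real_sqrt_le_iff[of ?A "\<rho>\<^sup>2"] by (simp_all add: fs_closed_ball_def fs_norm_def)
      have "(\<integral>x. \<bar>z x\<bar> powr p \<partial>MD) \<le> C * ?A powr (p / 2)"
        by (rule C(2)[OF hz])
      also have "\<dots> \<le> C * (\<rho>\<^sup>2) powr (p / 2)"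
        using C(1) A p_gt_2 by (intro mult_left_mono powr_mono2) auto
      also have "(\<rho>\<^sup>2) powr (p / 2) = \<rho> powr p"
        using \<rho> powr_powr[of \<rho> 2 "p / 2"] by simp
      finally have zp: "(\<integral>x. \<bar>z x\<bar> powr p \<partial>MD) \<le> C * \<rho> powr p" .
      have wp: "(\<integral>x. \<bar>w x\<bar> powr p \<partial>MD) \<le> C * W powr (p / 2)"
        unfolding W_def by (rule C(2)[OF hw])
      have "(\<integral>x. \<bar>z x\<bar> powr (p - 2) * (w x)\<^sup>2 \<partial>MD)
          \<le> (\<integral>x. \<bar>z x\<bar> powr p \<partial>MD) powr ((p - 2) / p) * (\<integral>x. \<bar>w x\<bar> powr p \<partial>MD) powr (2 / p)"
        using Lp_Hoelder_le[OF hz hw s] by simp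
      also have "\<dots> \<le> (C * \<rho> powr p) powr ((p - 2) / p) * (C * W powr (p / 2)) powr (2 / p)"
        using p_gt_2 by (intro mult_mono powr_mono2 zp wp) auto
      also have "\<dots> = (C powr ((p - 2) / p) * C powr (2 / p)) * \<rho> powr (p - 2) * W"
        using p_gt_2 C(1) \<rho> W by (simp add: powr_mult powr_powr)
      also have "C powr ((p - 2) / p) * C powr (2 / p) = C"
        using p_gt_2 C(1) by (simp flip: powr_add add_divide_distrib)
      finally show "(\<integral>x. \<bar>z x\<bar> powr (p - 2) * (w x)\<^sup>2 \<partial>MD) \<le> C * \<rho> powr (p - 2) * W" .
    qed
    note intp = Lp_integrable[OF hu] Lp_integrable[OF hv] potential_integrable(1)[OF hu hv] potential_integrable(1)[OF hu hu]
    have uup: "\<bar>u x\<bar> powr (p - 2) * u x * u x = \<bar>u x\<bar> powr p" for x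
      using powr_add[of "\<bar>u x\<bar>" "p - 2" 2] by (cases "u x = 0") (simp_all add: power2_eq_square mult.assoc)
    let ?P = "\<lambda>f. \<integral>x. \<bar>f x\<bar> powr p \<partial>MD" and ?B = "\<integral>x. \<bar>u x\<bar> powr (p - 2) * u x * v x \<partial>MD"
    \<comment> \<open>The Taylor remainder at \<open>u\<close> of the integral of the
      \<open>p\<close>-th power, estimated pointwise by \<open>powr_taylor\<close> under the
      integral.\<close>
    have "?P v - ?P u - p * (?B - ?P u)
        = (\<integral>x. \<bar>v x\<bar> powr p - \<bar>u x\<bar> powr p - p * (\<bar>u x\<bar> powr (p - 2) * u x * v x - \<bar>u x\<bar> powr p) \<partial>MD)"
      using intp by simp
    also have "\<dots> \<le> (\<integral>x. p * (p - 1) * (\<bar>u x\<bar> powr (p - 2) * (w x)\<^sup>2 + \<bar>v x\<bar> powr (p - 2) * (w x)\<^sup>2) \<partial>MD)"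
    proof (rule integral_mono)
      show "integrable MD (\<lambda>x. \<bar>v x\<bar> powr p - \<bar>u x\<bar> powr p - p * (\<bar>u x\<bar> powr (p - 2) * u x * v x - \<bar>u x\<bar> powr p))"
        using intp by simp
      show "integrable MD (\<lambda>x. p * (p - 1) * (\<bar>u x\<bar> powr (p - 2) * (w x)\<^sup>2 + \<bar>v x\<bar> powr (p - 2) * (w x)\<^sup>2))"
        using weight(1)[OF uB] weight(1)[OF vB] by simp
      fix x
      show "\<bar>v x\<bar> powr p - \<bar>u x\<bar> powr p - p * (\<bar>u x\<bar> powr (p - 2) * u x * v x - \<bar>u x\<bar> powr p)
          \<le> p * (p - 1) * (\<bar>u x\<bar> powr (p - 2) * (w x)\<^sup>2 + \<bar>v x\<bar> powr (p - 2) * (w x)\<^sup>2)"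
        using powr_taylor[OF p_gt_2, of "v x" "u x"] unfolding uup[symmetric]
        by (simp add: w_def algebra_simps)
    qed
    also have "\<dots> = p * (p - 1) * ((\<integral>x. \<bar>u x\<bar> powr (p - 2) * (w x)\<^sup>2 \<partial>MD) + (\<integral>x. \<bar>v x\<bar> powr (p - 2) * (w x)\<^sup>2 \<partial>MD))"
      using weight(1)[OF uB] weight(1)[OF vB] by simp
    also have "\<dots> \<le> p * (p - 1) * (C * \<rho> powr (p - 2) * W + C * \<rho> powr (p - 2) * W)"
      using p_gt_2 by (intro mult_left_mono add_mono weight uB vB) auto
    finally have "\<mu> / p * (?P v - ?P u - p * (?B - ?P u)) \<le> \<mu> / p * (p * (p - 1) * (C * \<rho> powr (p - 2) * W + C * \<rho> powr (p - 2) * W))"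
      using \<mu> p_gt_2 by (intro mult_left_mono) auto
    also have "\<dots> = \<mu> * (p - 1) * (2 * (C * \<rho> powr (p - 2))) * W"
      using p_gt_2 by (simp add: field_simps)
    also have "\<dots> = 1 / 2 * W"
      by (simp only: \<rho>p)
    finally have pot: "\<mu> / p * (?P v - ?P u - p * (?B - ?P u)) \<le> 1 / 2 * W" .
    have pot': "\<mu> / p * (?P v - ?P u - p * (?B - ?P u)) = \<mu> / p * ?P v - \<mu> / p * ?P u - \<mu> * ?B + \<mu> * ?P u"
      using p_gt_2 by (simp add: field_simps)
    have "deriv_functional \<mu> u v - deriv_functional \<mu> u u
        = ((\<integral>x. ?g u x \<bullet> ?g v x \<partial>MD) - \<mu> * ?B) - ((\<integral>x. (norm (?g u x))\<^sup>2 \<partial>MD) - \<mu> * ?P u)"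
      by (simp add: deriv_functional_def uu uup)
    \<comment> \<open>The functional minus its tangent is \<open>W / 2\<close> minus the scaled
      remainder, and \<open>pot\<close> says that this is nonnegative.\<close>
    then show "critical_functional X p D \<mu> u + (deriv_functional \<mu> u v - deriv_functional \<mu> u u)
        \<le> critical_functional X p D \<mu> v"
      unfolding critical_functional_def using pot Weq unfolding pot' by argo
  qed
qed

lemma weakly_lsc_small_ball:
  assumes "0 < \<mu>"
  shows "\<exists>\<rho>>0. fs_seq_weakly_lsc_on X p D (fs_closed_ball X p D \<rho>) (critical_functional X p D \<mu>)"
proof -
  obtain \<rho> where \<rho>: "0 < \<rho>"
    "\<And>u v. u \<in> fs_closed_ball X p D \<rho> \<Longrightarrow> v \<in> fs_closed_ball X p D \<rho> \<Longrightarrow>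
      critical_functional X p D \<mu> u + (deriv_functional \<mu> u v - deriv_functional \<mu> u u)
        \<le> critical_functional X p D \<mu> v"
    by (rule convexity_inequality[OF assms]) blast
  let ?F = "critical_functional X p D \<mu>"
  have "ereal (?F u) \<le> liminf (\<lambda>j. ereal (?F (us j)))"
    if us: "\<And>j. us j \<in> fs_closed_ball X p D \<rho>" and u: "u \<in> fs_closed_ball X p D \<rho>"
      and weak: "fs_weakly_converges X p D us u" for us u
  proof -
    have "deriv_functional \<mu> u \<in> fs_dual X p D"
      using u by (intro deriv_functional_dual) (simp add: fs_closed_ball_def)
    then have "(\<lambda>j. deriv_functional \<mu> u (us j)) \<longlonglongrightarrow> deriv_functional \<mu> u u"
      using weak by (simp add: fs_weakly_converges_def)
    then have "(\<lambda>j. ?F u + (deriv_functional \<mu> u (us j) - deriv_functional \<mu> u u)) \<longlonglongrightarrow>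
        ?F u + (deriv_functional \<mu> u u - deriv_functional \<mu> u u)"
      by (intro tendsto_intros)
    then have "(\<lambda>j. ereal (?F u + (deriv_functional \<mu> u (us j) - deriv_functional \<mu> u u))) \<longlonglongrightarrow> ereal (?F u)"
      by simp
    from lim_imp_Liminf[OF sequentially_bot this]
    have "ereal (?F u) = liminf (\<lambda>j. ereal (?F u + (deriv_functional \<mu> u (us j) - deriv_functional \<mu> u u)))"
      by simp
    also have "\<dots> \<le> liminf (\<lambda>j. ereal (?F (us j)))"
      by (intro Liminf_mono always_eventually allI) (simp add: \<rho>(2)[OF u us])
    finally show ?thesis .
  qed
  with \<rho>(1) show ?thesis
    unfolding fs_seq_weakly_lsc_on_def by blast
qed

end

theorem proposition3p1:
  fixes mul :: "real^'n \<Rightarrow> real^'n \<Rightarrow> real^'n" and e :: "real^'n" and iv :: "real^'n \<Rightarrow> real^'n"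
    and \<sigma> :: "'n::finite \<Rightarrow> nat" and r :: nat
    and V :: "nat \<Rightarrow> (real^'n \<Rightarrow> real^'n) set"
    and X :: "'m::finite \<Rightarrow> real^'n \<Rightarrow> real^'n"
    and D :: "(real^'n) set"
    and p :: real
  assumes "carnot_group mul e iv \<sigma> r V"
    and "basis_of X (V 1)"
    and "hom_dim \<sigma> r \<ge> 3"
    and "smooth_bounded_domain D"
    and p: "p = critical_exponent (hom_dim \<sigma> r)"
  shows "\<forall>\<mu>>0. \<exists>\<rho>>0.
    fs_seq_weakly_lsc_on X p D (fs_closed_ball X p D \<rho>) (critical_functional X p D \<mu>)"
proof -
  interpret carnot_group mul e iv \<sigma> r V
    by fact
  interpret carnot_basis mul e iv \<sigma> r V X
    by unfold_locales fact
  interpret fs_space mul e iv \<sigma> r V X D p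
    using assms(3,4) p by unfold_locales (auto simp: smooth_bounded_domain_def hom_dim_eq_Q)
  show ?thesis
    using weakly_lsc_small_ball by blast
qed

end
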